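(* Let $k_0\ge1$, let $b=b(v_1,\dots,v_{k_0})\in\mathbb{R}^{3k_0}$ be a smooth, bounded, divergence-free vector field on $\mathbb{R}^{3k_0}$, and let $\partial=b\cdot\nabla_{1\dots k_0}$ be the associated derivation acting on the variables $(v_1,\dots,v_{k_0})$. For nonnegative functions $F$ on $\mathbb{R}^{3N}$, $N\ge k_0$, let $$I^\partial(F)=\int_{\mathbb{R}^{3N}}\frac{|\partial F|^2}{F},\qquad K^\partial(F)=\int_{\mathbb{R}^{3N}}\frac{(\partial^2F)^2}{F}.$$ Then for all $N\ge k_0$: (1) (Lower semi-continuity and convexity) $I^\partial$ and $K^\partial$ can be extended as non-negative, possibly infinite functionals on $\mathcal{P}(\mathbb{R}^{3N})$; they are convex and lower semi-continuous with respect to weak convergence on that space. (2) (Super-additivity) If $F\in\mathcal{P}(\mathbb{R}^{3N})$ and $F^{:j}=\int_{\mathbb{R}^{3(N-j)}}F\,dv_{j+1}\cdots dv_N$ is its $j$-th marginal, $k_0\le j\le N$, then $$I^\partial(F^{:j})\le I^\partial(F),\qquad K^\partial(F^{:j})\le K^\partial(F).$$ (3) (Infinite-dimensional affinity) Let $\nu\in\mathcal{P}(\mathcal{P}(\mathbb{R}^3))$ and $\nu^j=\int_{\mathcal{P}(\mathbb{R}^3)}\rho^{\otimes j}\,\nu(d\rho)\in\mathcal{P}(\mathbb{R}^{3j})$ for $j\ge1$. Suppose $\sup_{j\ge1}I(\nu^j)<+\infty$ and $\int_{\mathbb{R}^3}|v|^2\nu^1(dv)<+\infty$. Then $$\int_{\mathcal{P}(\mathbb{R}^3)}I^\partial(\rho^{\otimes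 k_0})\,\nu(d\rho)=\lim_{j\to\infty}I^\partial(\nu^j),$$ $$\lim_{j\to\infty}K^\partial(\nu^j)\le\int_{\mathcal{P}(\mathbb{R}^3)}K^\partial(\rho^{\otimes k_0})\,\nu(d\rho)\le16\lim_{j\to\infty}K^\partial(\nu^j),$$ where the sequences (indexed by $j\ge k_0$) whose limits are taken are non-decreasing in $j$.
   Context: $\mathcal{P}(X)$ is the space of Borel probability measures on $X$ with the topology of weak convergence against bounded continuous functions. $\nabla_{1\dots k_0}$ is the gradient in $(v_1,\dots,v_{k_0})$, each $v_i\in\mathbb{R}^3$. The usual (normalized) Fisher information of a probability $F$ on $\mathbb{R}^{3j}$ is $I(F)=\frac1j\int_{\mathbb{R}^{3j}}\frac{|\nabla F|^2}{F}$, with value $+\infty$ if $F$ has no density or its density has no gradient. For arbitrary probability measures $F$ on $\mathbb{R}^{3N}$, $I^\partial(F)$ and $K^\partial(F)$ denote the values of the extensions $$I^\partial(F)=\sup_{\psi}\int_{\mathbb{R}^{3N}}\Big(\partial\psi-\tfrac{\psi^2}{4}\Big)dF,\qquad K^\partial(F)=\sup_{\psi}\int_{\mathbb{R}^{3N}}\Big(\partial^2\psi-\tfrac{\psi^2}{4}\Big)dF,$$ the suprema being over compactly supported test functions $\psi$ on $\mathbb{R}^{3N}$ of class $C^1$, respectively $C^2$; they agree with the integral formulas for regular $F$. *)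

theory Defs
  imports "HOL-Probability.Probability"
begin

section \<open>Borel probability measures with the weak topology\<close>

definition borel_of :: "'a topology \<Rightarrow> 'a measure" where
  "borel_of X = sigma (topspace X) {U. openin X U}"

definition prob_measures :: "'a topology \<Rightarrow> 'a measure set" where
  "prob_measures X = space (prob_algebra (borel_of X))"

definition weak_topology :: "'a topology \<Rightarrow> 'a measure topology" where
  "weak_topology X = topology_generated_by
     {{\<mu> \<in> prob_measures X. (\<integral>x. f x \<partial>\<mu>) \<in> U} | f U.
        continuous_map X euclideanreal f \<and> bounded (f ` topspace X) \<and> open (U :: real set)}"

definition lsc_on_topology :: "'a topology \<Rightarrow> ('a \<Rightarrow> ereal) \<Rightarrow> bool" where
  "lsc_on_topology X J \<longleftrightarrow> (\<forall>c. openin X {x \<in> topspace X. c < J x})"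

definition convex_comb :: "real \<Rightarrow> 'a measure \<Rightarrow> 'a measure \<Rightarrow> 'a measure" where
  "convex_comb t F G = measure_of (space F) (sets F)
     (\<lambda>A. ennreal (1 - t) * emeasure F A + ennreal t * emeasure G A)"

definition convex_on_prob_measures :: "'a topology \<Rightarrow> ('a measure \<Rightarrow> ereal) \<Rightarrow> bool" where
  "convex_on_prob_measures X J \<longleftrightarrow>
     (\<forall>F \<in> prob_measures X. \<forall>G \<in> prob_measures X. \<forall>t. 0 \<le> t \<and> t \<le> 1 \<longrightarrow>
        J (convex_comb t F G) \<le> ereal (1 - t) * J F + ereal t * J G)"


section \<open>Configurations of N particles in three-dimensional space\<close>

text \<open>
  The dimension varies inside the statements, so a point of the 3N-dimensional space is a
  family \<open>v 0, \<dots>, v (N - 1)\<close> of elements of \<open>real^3\<close>, that is, an element of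
  \<open>{..<N} \<rightarrow>\<^sub>E UNIV\<close>. Particles are numbered from 0. Functions are defined on all of
  \<open>nat \<Rightarrow> real^3\<close>, but only their values on \<open>{..<N} \<rightarrow>\<^sub>E UNIV\<close> matter.
\<close>

type_synonym config = "nat \<Rightarrow> real^3"

definition cfg_top :: "nat \<Rightarrow> config topology" where
  "cfg_top N = product_topology (\<lambda>_. euclidean) {..<N}"

definition cfg_leb :: "nat \<Rightarrow> config measure" where
  "cfg_leb N = PiM {..<N} (\<lambda>_. lborel)"

definition tensor_power :: "nat \<Rightarrow> (real^3) measure \<Rightarrow> config measure" where
  "tensor_power j \<rho> = PiM {..<j} (\<lambda>_. \<rho>)"

definition marginal :: "nat \<Rightarrow> config measure \<Rightarrow> config measure" where
  "marginal j F = distr F (borel_of (cfg_top j)) (\<lambda>v. restrict v {..<j})"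

definition mixture :: "(real^3) measure measure \<Rightarrow> nat \<Rightarrow> config measure" where
  "mixture \<nu> j = \<nu> \<bind> (\<lambda>\<rho>. tensor_power j \<rho>)"

definition pderiv_at :: "nat \<Rightarrow> real^3 \<Rightarrow> (config \<Rightarrow> real) \<Rightarrow> config \<Rightarrow> real" where
  "pderiv_at i e f v = deriv (\<lambda>t. f (v(i := v i + t *\<^sub>R e))) 0"

primrec C_diff :: "nat \<Rightarrow> nat \<Rightarrow> (config \<Rightarrow> real) \<Rightarrow> bool" where
  "C_diff 0 N f \<longleftrightarrow> continuous_map (cfg_top N) euclideanreal f"
| "C_diff (Suc m) N f \<longleftrightarrow> continuous_map (cfg_top N) euclideanreal f \<and>
     (\<forall>i<N. \<forall>e\<in>Basis.
        (\<forall>v \<in> topspace (cfg_top N). (\<lambda>t. f (v(i := v i + t *\<^sub>R e))) differentiable at 0) \<and>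
        C_diff m N (pderiv_at i e f))"

definition test_functions :: "nat \<Rightarrow> nat \<Rightarrow> (config \<Rightarrow> real) set" where
  "test_functions m N = {\<psi>. C_diff m N \<psi> \<and>
     (\<exists>K. compactin (cfg_top N) K \<and> (\<forall>v \<in> topspace (cfg_top N) - K. \<psi> v = 0))}"


section \<open>The derivation along a vector field in the first variables\<close>

definition smooth_field :: "nat \<Rightarrow> (config \<Rightarrow> config) \<Rightarrow> bool" where
  "smooth_field k b \<longleftrightarrow> (\<forall>m. \<forall>i<k. \<forall>e\<in>Basis. C_diff m k (\<lambda>v. b v i \<bullet> e))"

definition bounded_field :: "nat \<Rightarrow> (config \<Rightarrow> config) \<Rightarrow> bool" where
  "bounded_field k b \<longleftrightarrow> (\<exists>C. \<forall>v \<in> topspace (cfg_top k). \<forall>i<k. norm (b v i) \<le> C)"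

definition divergence_free :: "nat \<Rightarrow> (config \<Rightarrow> config) \<Rightarrow> bool" where
  "divergence_free k b \<longleftrightarrow> (\<forall>v \<in> topspace (cfg_top k).
     (\<Sum>i<k. \<Sum>e\<in>Basis. pderiv_at i e (\<lambda>w. b w i \<bullet> e) v) = 0)"

definition derivation :: "nat \<Rightarrow> (config \<Rightarrow> config) \<Rightarrow> (config \<Rightarrow> real) \<Rightarrow> config \<Rightarrow> real" where
  "derivation k b f v =
     (\<Sum>i<k. \<Sum>e\<in>Basis. (b (restrict v {..<k}) i \<bullet> e) * pderiv_at i e f v)"

text \<open>
  Integral formulas for densities. Real division gives the integrand the value 0 where
  \<open>f = 0\<close>. At such points \<open>\<partial>f = 0\<close> if \<open>f\<close> is nonnegative and of class C1, and
  \<open>\<partial>\<^sup>2f = 0\<close> almost everywhere if \<open>f\<close> is of class C2.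
\<close>

definition I_formula :: "nat \<Rightarrow> (config \<Rightarrow> config) \<Rightarrow> nat \<Rightarrow> (config \<Rightarrow> real) \<Rightarrow> ennreal" where
  "I_formula k b N f = (\<integral>\<^sup>+v. ennreal (\<bar>derivation k b f v\<bar>\<^sup>2 / f v) \<partial>cfg_leb N)"

definition K_formula :: "nat \<Rightarrow> (config \<Rightarrow> config) \<Rightarrow> nat \<Rightarrow> (config \<Rightarrow> real) \<Rightarrow> ennreal" where
  "K_formula k b N f =
     (\<integral>\<^sup>+v. ennreal ((derivation k b (derivation k b f) v)\<^sup>2 / f v) \<partial>cfg_leb N)"

definition I_ext :: "nat \<Rightarrow> (config \<Rightarrow> config) \<Rightarrow> nat \<Rightarrow> config measure \<Rightarrow> ereal" where
  "I_ext k b N F = (SUP \<psi> \<in> test_functions 1 N.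
     ereal (\<integral>v. (derivation k b \<psi> v - (\<psi> v)\<^sup>2 / 4) \<partial>F))"

definition K_ext :: "nat \<Rightarrow> (config \<Rightarrow> config) \<Rightarrow> nat \<Rightarrow> config measure \<Rightarrow> ereal" where
  "K_ext k b N F = (SUP \<psi> \<in> test_functions 2 N.
     ereal (\<integral>v. (derivation k b (derivation k b \<psi>) v - (\<psi> v)\<^sup>2 / 4) \<partial>F))"

definition regular_density :: "nat \<Rightarrow> nat \<Rightarrow> (config \<Rightarrow> real) \<Rightarrow> bool" where
  "regular_density m N f \<longleftrightarrow> C_diff m N f \<and> (\<forall>v \<in> topspace (cfg_top N). 0 \<le> f v) \<and>
     (\<integral>\<^sup>+v. ennreal (f v) \<partial>cfg_leb N) = 1"


section \<open>Normalized Fisher information\<close>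

text \<open>The gradient of a density is the weak one, a family of locally integrable functions.\<close>

definition weak_gradient :: "nat \<Rightarrow> (config \<Rightarrow> real) \<Rightarrow> (config \<Rightarrow> config) \<Rightarrow> bool" where
  "weak_gradient N f g \<longleftrightarrow> (\<forall>i<N. \<forall>e\<in>Basis.
     (\<forall>K. compactin (cfg_top N) K \<longrightarrow> set_integrable (cfg_leb N) K (\<lambda>v. g v i \<bullet> e)) \<and>
     (\<forall>\<phi> \<in> test_functions 1 N.
        (\<integral>v. f v * pderiv_at i e \<phi> v \<partial>cfg_leb N) = - (\<integral>v. (g v i \<bullet> e) * \<phi> v \<partial>cfg_leb N)))"

text \<open>
  The density and its weak gradient are unique almost everywhere, so the set below has at most
  one element; it is empty, with infimum \<open>\<infinity>\<close>, if there is no density or no gradient.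
  The weak gradient vanishes almost everywhere on \<open>{f = 0}\<close>, which justifies the value 0
  that real division gives there.
\<close>

definition fisher_info :: "nat \<Rightarrow> config measure \<Rightarrow> ennreal" where
  "fisher_info N F = Inf {(\<integral>\<^sup>+v. ennreal ((\<Sum>i<N. (norm (g v i))\<^sup>2) / f v) \<partial>cfg_leb N) / of_nat N | f g.
     f \<in> borel_measurable (cfg_leb N) \<and> (\<forall>v. 0 \<le> f v) \<and>
     F = density (cfg_leb N) (\<lambda>v. ennreal (f v)) \<and> weak_gradient N f g}"

end

theory Submission
  imports Defs
begin

text \<open>
  Both functionals have the form \<open>sup \<psi>. \<integral> (D\<^sup>m \<psi> - \<psi>\<^sup>2 / 4) dF\<close> with \<open>D\<close> the derivation and \<open>m = 1, 2\<close>, so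
  convexity and lower semi-continuity are immediate. For a regular density \<open>f\<close>, integration by parts
  moves \<open>D\<^sup>m\<close> to \<open>f\<close>, and the supremum is approached by test functions close to \<open>2 D\<^sup>m f / f\<close>
  (up to sign) in a weighted L2 space.

  Since \<open>D\<close> does not differentiate in the variables with index at least \<open>k0\<close>, a test function may
  be multiplied by a cutoff in them, which gives super-additivity, and may even be selected
  measurably depending on them. Under the mixture, averages over disjoint blocks of these variables
  recover the integrals against the random measure \<open>\<rho>\<close>, so that for many variables a nearly optimal
  test function for \<open>\<rho>\<close> can be selected. The limit therefore equals the averaged functional for
  \<open>m = 2\<close> as well, and the constant 16 could be replaced by 1.
\<close>

section \<open>Calculus of functions of class \<open>C_diff\<close>\<close>

text \<open>The obstacle for mixtures is that a good test function for the \<open>k\<close>-fold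
  product of \<rho> depends on \<rho>, while a test function for the mixture sees only particles.
  Given \<rho> the particles are independent, so averages over p disjoint blocks deviate in mean by
  O(1 / sqrt p) from their expectations, with a constant that involves the bound of the integrand
  but not \<rho>. Hence the later particles reveal which of finitely many candidates is nearly best,
  and this choice is independent of the first \<open>k\<close> particles, so using it does not bias
  the integral over them. Finitely many candidates suffice because the integrands have a countable
  uniformly dense family, and monotone convergence applies to the maxima over its initial segments.
  For densities the delicate places are the zeros of the density: the quotient is 0 there by
  convention, so the term linear in the test function must be shown to contribute nothing. Moreover
  the optimal test function is known only pointwise and has to be truncated before it can be
  approximated.\<close>

abbreviation cfgs :: "nat \<Rightarrow> config set" where
  "cfgs N \<equiv> topspace (cfg_top N)"

text \<open>For \<open>w = (\<lambda>_. undefined)\<close> this is the restriction to the first \<open>a\<close> variables; for other \<open>w\<close> it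
  freezes the remaining variables.\<close>

definition overlay :: "nat \<Rightarrow> config \<Rightarrow> config \<Rightarrow> config" where
  "overlay a w v = (\<lambda>i. if i < a then v i else w i)"

lemma cfgs_eq: "cfgs N = {..<N} \<rightarrow>\<^sub>E UNIV"
  by (simp add: cfg_top_def)

lemma cfgs_iff: "v \<in> cfgs N \<longleftrightarrow> v \<in> extensional {..<N}"
  by (simp add: cfgs_eq PiE_iff)

lemma cfgs_upd: "v \<in> cfgs N \<Longrightarrow> i < N \<Longrightarrow> v(i := x) \<in> cfgs N"
  by (auto simp: cfgs_iff extensional_def)

lemma pderiv_at_cong:
  assumes "\<And>v. v \<in> cfgs N \<Longrightarrow> f v = g v" "v \<in> cfgs N" "i < N"
  shows "pderiv_at i e f v = pderiv_at i e g v"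
  unfolding pderiv_at_def using assms cfgs_upd by (intro arg_cong2[where f = deriv] ext) auto

text \<open>The perturbed points \<open>v(i := x)\<close> with \<open>i < N\<close> stay in
  \<open>cfgs N\<close>, so no value outside \<open>cfgs N\<close> enters at any order. This permits
  replacing a derivative by a formula that is valid on configurations only.\<close>

lemma C_diff_cong_imp:
  assumes "\<And>v. v \<in> cfgs N \<Longrightarrow> f v = g v" "C_diff m N f"
  shows "C_diff m N g"
  using assms
proof (induction m arbitrary: f g)
  case 0
  then show ?case by (auto intro: continuous_map_eq)
next
  case (Suc m)
  have "continuous_map (cfg_top N) euclideanreal g"
    using Suc.prems by (auto intro: continuous_map_eq)
  moreover have "(\<lambda>t. g (v(i := v i + t *\<^sub>R e))) = (\<lambda>t. f (v(i := v i + t *\<^sub>R e)))"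
    if "v \<in> cfgs N" "i < N" for v i e
    by (intro ext Suc.prems(1)[symmetric] cfgs_upd that)
  moreover have "C_diff m N (pderiv_at i e g)" if "i < N" "e \<in> Basis" for i e
    using Suc.IH[of "pderiv_at i e f" "pderiv_at i e g"] Suc.prems pderiv_at_cong[OF Suc.prems(1)] that
    by auto
  ultimately show ?case using Suc.prems by auto
qed

lemma C_diff_cont: "C_diff m N f \<Longrightarrow> continuous_map (cfg_top N) euclideanreal f"
  by (cases m) auto

lemma C_diff_SucD: "C_diff (Suc m) N f \<Longrightarrow> C_diff m N f"
  by (induction m arbitrary: f) auto

lemma C_diff_mono: "C_diff m N f \<Longrightarrow> m' \<le> m \<Longrightarrow> C_diff m' N f"
  by (induction m) (auto simp: le_Suc_eq dest: C_diff_SucD simp del: C_diff.simps)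

lemma C_diff_pderiv: "C_diff (Suc m) N f \<Longrightarrow> i < N \<Longrightarrow> e \<in> Basis \<Longrightarrow> C_diff m N (pderiv_at i e f)"
  by simp

lemma C_diff_DERIV:
  assumes "C_diff (Suc m) N f" "v \<in> cfgs N" "i < N" "e \<in> Basis"
  shows "((\<lambda>t. f (v(i := v i + t *\<^sub>R e))) has_real_derivative pderiv_at i e f v) (at 0)"
  using assms unfolding pderiv_at_def by (auto simp: DERIV_deriv_iff_real_differentiable)

text \<open>\<open>C_diff\<close> speaks about the parameter 0 only; recentring at the shifted
  configuration gives the derivative along the whole line, as the mean value theorem
  requires.\<close>

lemma C_diff_DERIV_line:
  assumes "C_diff (Suc m) N f" "v \<in> cfgs N" "i < N" "e \<in> Basis"
  shows "((\<lambda>t. f (v(i := v i + t *\<^sub>R e))) has_real_derivative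
           pderiv_at i e f (v(i := v i + s *\<^sub>R e))) (at s)"
proof -
  let ?w = "v(i := v i + s *\<^sub>R e)"
  have "((\<lambda>t. f (?w(i := ?w i + t *\<^sub>R e))) has_real_derivative pderiv_at i e f ?w) (at 0)"
    by (rule C_diff_DERIV[OF assms(1) cfgs_upd[OF assms(2,3)] assms(3,4)])
  moreover have "(\<lambda>t. f (?w(i := ?w i + t *\<^sub>R e))) = (\<lambda>t. f (v(i := v i + (t + s) *\<^sub>R e)))"
    by (auto simp: algebra_simps)
  ultimately show ?thesis
    using DERIV_shift[of "\<lambda>t. f (v(i := v i + t *\<^sub>R e))" "pderiv_at i e f ?w" 0 s] by simp
qed

text \<open>Serves to introduce \<open>C_diff\<close> from formulas for the partial derivatives that
  are known on \<open>cfgs N\<close> only; regularity is then checked on the formulas instead of on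
  \<open>pderiv_at\<close>.\<close>

lemma C_diff_SucI:
  assumes "continuous_map (cfg_top N) euclideanreal f"
    and "\<And>i e v. i < N \<Longrightarrow> e \<in> Basis \<Longrightarrow> v \<in> cfgs N \<Longrightarrow>
      ((\<lambda>t. f (v(i := v i + t *\<^sub>R e))) has_real_derivative f' i e v) (at 0)"
    and "\<And>i e. i < N \<Longrightarrow> e \<in> Basis \<Longrightarrow> C_diff m N (f' i e)"
  shows "C_diff (Suc m) N f"
proof -
  have "C_diff m N (pderiv_at i e f)" if "i < N" "e \<in> Basis" for i e
  proof (rule C_diff_cong_imp[OF _ assms(3)])
    show "f' i e v = pderiv_at i e f v" if "v \<in> cfgs N" for v
      unfolding pderiv_at_def using assms(2) that \<open>i < N\<close> \<open>e \<in> Basis\<close> by (metis DERIV_imp_deriv)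
  qed (use that in auto)
  moreover have "(\<lambda>t. f (v(i := v i + t *\<^sub>R e))) differentiable at 0"
    if "i < N" "e \<in> Basis" "v \<in> cfgs N" for i e v
    using assms(2)[OF that] by (auto simp: real_differentiable_def)
  ultimately show ?thesis using assms(1) by auto
qed

lemma C_diff_const [intro, simp]: "C_diff m N (\<lambda>_. c)"
proof (induction m arbitrary: c)
  case (Suc m)
  show ?case by (rule C_diff_SucI[where f' = "\<lambda>_ _ _. 0"]) (use Suc in auto)
qed auto

lemma C_diff_add:
  assumes "C_diff m N f" "C_diff m N g"
  shows "C_diff m N (\<lambda>v. f v + g v)"
  using assms
proof (induction m arbitrary: f g)
  case 0 then show ?case by (auto intro: continuous_map_add)
next
  case (Suc m)
  show ?case
  proof (rule C_diff_SucI)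
    show "continuous_map (cfg_top N) euclideanreal (\<lambda>v. f v + g v)"
      using Suc.prems by (auto intro: continuous_map_add)
    show "((\<lambda>t. f (v(i := v i + t *\<^sub>R e)) + g (v(i := v i + t *\<^sub>R e))) has_real_derivative
        pderiv_at i e f v + pderiv_at i e g v) (at 0)" if "i < N" "e \<in> Basis" "v \<in> cfgs N" for i e v
      by (intro DERIV_add C_diff_DERIV) (use Suc.prems that in auto)
    show "C_diff m N (\<lambda>v. pderiv_at i e f v + pderiv_at i e g v)" if "i < N" "e \<in> Basis" for i e
      using Suc that by auto
  qed
qed

lemma C_diff_mult:
  assumes "C_diff m N f" "C_diff m N g"
  shows "C_diff m N (\<lambda>v. f v * g v)"
  using assms
proof (induction m arbitrary: f g)
  case 0 then show ?case by (auto intro: continuous_map_real_mult)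
next
  case (Suc m)
  show ?case
  proof (rule C_diff_SucI)
    show "continuous_map (cfg_top N) euclideanreal (\<lambda>v. f v * g v)"
      using Suc.prems by (auto intro: continuous_map_real_mult)
    show "((\<lambda>t. f (v(i := v i + t *\<^sub>R e)) * g (v(i := v i + t *\<^sub>R e))) has_real_derivative
        pderiv_at i e f v * g v + f v * pderiv_at i e g v) (at 0)"
      if "i < N" "e \<in> Basis" "v \<in> cfgs N" for i e v
      by (rule DERIV_cong[OF DERIV_mult[OF C_diff_DERIV[OF Suc.prems(1) that(3,1,2)] C_diff_DERIV[OF Suc.prems(2) that(3,1,2)]]])
         (simp add: algebra_simps)
    show "C_diff m N (\<lambda>v. pderiv_at i e f v * g v + f v * pderiv_at i e g v)"
      if "i < N" "e \<in> Basis" for i e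
      using Suc.IH Suc.prems that C_diff_pderiv C_diff_SucD by (intro C_diff_add) blast+
  qed
qed

lemma C_diff_cmult: "C_diff m N f \<Longrightarrow> C_diff m N (\<lambda>v. c * f v)"
  by (intro C_diff_mult) auto

lemma C_diff_sum: "(\<And>a. a \<in> A \<Longrightarrow> C_diff m N (f a)) \<Longrightarrow> C_diff m N (\<lambda>v. \<Sum>a\<in>A. f a v)"
  by (induction A rule: infinite_finite_induct) (auto intro: C_diff_add simp del: C_diff.simps)

lemma C_diff_prod: "(\<And>a. a \<in> A \<Longrightarrow> C_diff m N (f a)) \<Longrightarrow> C_diff m N (\<lambda>v. \<Prod>a\<in>A. f a v)"
  by (induction A rule: infinite_finite_induct) (auto intro: C_diff_mult simp del: C_diff.simps)

lemma pderiv_at_add: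
  assumes "C_diff (Suc m) N f" "C_diff (Suc m) N g" "v \<in> cfgs N" "i < N" "e \<in> Basis"
  shows "pderiv_at i e (\<lambda>v. f v + g v) v = pderiv_at i e f v + pderiv_at i e g v"
  unfolding pderiv_at_def[of _ _ "\<lambda>v. f v + g v"]
  by (intro DERIV_imp_deriv DERIV_add C_diff_DERIV) (use assms in auto)

lemma pderiv_at_mult:
  assumes "C_diff (Suc m) N f" "C_diff (Suc m) N g" "v \<in> cfgs N" "i < N" "e \<in> Basis"
  shows "pderiv_at i e (\<lambda>v. f v * g v) v = pderiv_at i e f v * g v + f v * pderiv_at i e g v"
  unfolding pderiv_at_def[of _ _ "\<lambda>v. f v * g v"]
  by (intro DERIV_imp_deriv,
      rule DERIV_cong[OF DERIV_mult[OF C_diff_DERIV[OF assms(1,3-5)] C_diff_DERIV[OF assms(2,3-5)]]])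
     (simp add: algebra_simps)

lemma pderiv_at_mult_const:
  assumes "C_diff (Suc m) N f" "v \<in> cfgs N" "i < N" "e \<in> Basis"
    and "\<And>x. c (v(i := x)) = c v"
  shows "pderiv_at i e (\<lambda>v. c v * f v) v = c v * pderiv_at i e f v"
  unfolding pderiv_at_def[of _ _ "\<lambda>v. c v * f v"]
  using DERIV_cmult[OF C_diff_DERIV[OF assms(1-4)], of "c v"]
  by (intro DERIV_imp_deriv) (simp add: assms(5))

section \<open>Restricting and freezing variables, and the derivation in more variables\<close>

lemma restrict_eq_overlay: "restrict v {..<a} = overlay a (\<lambda>_. undefined) v"
  by (auto simp: overlay_def)

lemma overlay_upd: "i < a \<Longrightarrow> overlay a w (v(i := x)) = (overlay a w v)(i := x)"
  by (auto simp: overlay_def)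

lemma overlay_upd_other: "\<not> i < a \<Longrightarrow> overlay a w (v(i := x)) = overlay a w v"
  by (auto simp: overlay_def)

lemma overlay_in_cfgs:
  assumes "a \<le> N" "w \<in> cfgs N"
  shows "overlay a w v \<in> cfgs N"
  using assms by (auto simp: overlay_def cfgs_iff extensional_def)

lemma undefined_in_cfgs: "(\<lambda>_. undefined) \<in> cfgs N"
  by (auto simp: cfgs_iff extensional_def)

lemma continuous_map_overlay:
  assumes "a \<le> N" "a \<le> N'" "w \<in> cfgs N"
  shows "continuous_map (cfg_top N') (cfg_top N) (overlay a w)"
  unfolding cfg_top_def continuous_map_componentwise
proof (intro conjI ballI)
  show "overlay a w ` topspace (product_topology (\<lambda>_. euclidean) {..<N'}) \<subseteq> extensional {..<N}"
    using overlay_in_cfgs[OF assms(1,3)] by (auto simp: cfgs_iff)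
  fix i assume "i \<in> {..<N}"
  show "continuous_map (product_topology (\<lambda>_. euclidean) {..<N'}) euclidean (\<lambda>x. overlay a w x i)"
  proof (cases "i < a")
    case True
    have "continuous_map (product_topology (\<lambda>_. euclidean) {..<N'}) euclidean (\<lambda>x. x i)"
      by (rule continuous_map_product_projection) (use True assms in auto)
    then show ?thesis using True by (simp add: overlay_def)
  qed (simp add: overlay_def)
qed

lemma pderiv_at_overlay:
  "pderiv_at i e (\<lambda>v. f (overlay a w v)) v = (if i < a then pderiv_at i e f (overlay a w v) else 0)"
proof (cases "i < a")
  case True
  then show ?thesis by (simp add: pderiv_at_def overlay_upd) (simp add: overlay_def)
qed (simp add: pderiv_at_def overlay_upd_other)

text \<open>Every coordinate either passes through \<open>overlay\<close> unchanged or leaves its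
  value fixed. \<open>N\<close> and \<open>N'\<close> are independent of each other, so this covers
  both the extension of a function to more particles and its slices at a frozen configuration
  \<open>w\<close>.\<close>

lemma C_diff_overlay:
  assumes "a \<le> N" "a \<le> N'" "w \<in> cfgs N" "C_diff m N f"
  shows "C_diff m N' (\<lambda>v. f (overlay a w v))"
  using assms(4)
proof (induction m arbitrary: f)
  case 0
  then show ?case
    using continuous_map_compose[OF continuous_map_overlay[OF assms(1-3)]] by (simp add: o_def)
next
  case (Suc m)
  show ?case
  proof (rule C_diff_SucI)
    show "continuous_map (cfg_top N') euclideanreal (\<lambda>v. f (overlay a w v))"
      using continuous_map_compose[OF continuous_map_overlay[OF assms(1-3)] C_diff_cont[OF Suc.prems]] by (simp add: o_def)
    fix i e assume *: "i < N'" "e \<in> (Basis :: (real^3) set)"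
    show "((\<lambda>t. f (overlay a w (v(i := v i + t *\<^sub>R e)))) has_real_derivative
            (if i < a then pderiv_at i e f (overlay a w v) else 0)) (at 0)" if "v \<in> cfgs N'" for v
    proof (cases "i < a")
      case True
      have eq: "overlay a w (v(i := v i + t *\<^sub>R e)) = (overlay a w v)(i := overlay a w v i + t *\<^sub>R e)" for t
        using True by (auto simp: overlay_def)
      show ?thesis
        unfolding eq if_P[OF True]
        by (rule C_diff_DERIV[OF Suc.prems overlay_in_cfgs[OF assms(1,3)]]) (use True * assms(1) in auto)
    qed (simp add: overlay_upd_other)
    show "C_diff m N' (\<lambda>v. if i < a then pderiv_at i e f (overlay a w v) else 0)"
      using Suc.IH[of "pderiv_at i e f"] Suc.prems * assms by (cases "i < a") auto
  qed
qed

text \<open>The coefficients see only the first \<open>k\<close> variables, only these are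
  differentiated, and \<open>overlay a w\<close> with \<open>k \<le> a\<close> changes none of them.
  Hence an equality of functions, which iterates without side conditions.\<close>

lemma derivation_overlay:
  assumes "k \<le> a"
  shows "derivation k b (\<lambda>v. f (overlay a w v)) = (\<lambda>v. derivation k b f (overlay a w v))"
proof
  fix v
  have "restrict (overlay a w v) {..<k} = restrict v {..<k}"
    using assms by (auto simp: overlay_def)
  then show "derivation k b (\<lambda>v. f (overlay a w v)) v = derivation k b f (overlay a w v)"
    using assms unfolding derivation_def by (intro sum.cong refl) (auto simp: pderiv_at_overlay)
qed

lemma derivation_pow_overlay:
  assumes "k \<le> a"
  shows "(derivation k b ^^ m) (\<lambda>v. f (overlay a w v)) = (\<lambda>v. (derivation k b ^^ m) f (overlay a w v))"
  by (induction m) (simp_all add: derivation_overlay[OF assms])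

lemma derivation_cong:
  assumes "\<And>v. v \<in> cfgs N \<Longrightarrow> f v = g v" "v \<in> cfgs N" "k \<le> N"
  shows "derivation k b f v = derivation k b g v"
  unfolding derivation_def
  by (intro sum.cong refl arg_cong2[where f = "(*)"] pderiv_at_cong[where N = N] assms(1)) (use assms in auto)

lemma C_diff_field:
  assumes "smooth_field k b" "k \<le> N" "i < k" "e \<in> Basis"
  shows "C_diff m N (\<lambda>v. b (restrict v {..<k}) i \<bullet> e)"
  unfolding restrict_eq_overlay
  by (rule C_diff_overlay[of k k N "\<lambda>_. undefined" m "\<lambda>v. b v i \<bullet> e"])
     (use assms undefined_in_cfgs in \<open>auto simp: smooth_field_def\<close>)

lemma C_diff_derivation:
  assumes "smooth_field k b" "k \<le> N" "C_diff (Suc m) N f"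
  shows "C_diff m N (derivation k b f)"
  unfolding derivation_def
  by (intro C_diff_sum C_diff_mult C_diff_field[OF assms(1,2)] C_diff_pderiv[OF assms(3)])
     (use assms(2) in auto)

lemma C_diff_derivation_pow:
  assumes "smooth_field k b" "k \<le> N" "C_diff (m + n) N f"
  shows "C_diff n N ((derivation k b ^^ m) f)"
  using assms(3)
proof (induction m arbitrary: n)
  case (Suc m)
  then show ?case using C_diff_derivation[OF assms(1,2), of n "(derivation k b ^^ m) f"]
    by (metis add_Suc_shift comp_apply funpow.simps(2))
qed simp

lemma derivation_add:
  assumes "k \<le> N" "C_diff (Suc m) N f" "C_diff (Suc m) N g" "v \<in> cfgs N"
  shows "derivation k b (\<lambda>v. f v + g v) v = derivation k b f v + derivation k b g v"
  unfolding derivation_def sum.distrib[symmetric]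
  by (intro sum.cong refl, subst pderiv_at_add[OF assms(2,3)]) (use assms in \<open>auto simp: algebra_simps\<close>)

lemma derivation_mult:
  assumes "k \<le> N" "C_diff (Suc m) N f" "C_diff (Suc m) N g" "v \<in> cfgs N"
  shows "derivation k b (\<lambda>v. f v * g v) v = derivation k b f v * g v + f v * derivation k b g v"
  unfolding derivation_def sum.distrib[symmetric] sum_distrib_right sum_distrib_left
  by (intro sum.cong refl, subst pderiv_at_mult[OF assms(2,3)]) (use assms in \<open>auto simp: algebra_simps\<close>)

lemma derivation_mult_const:
  assumes "k \<le> N" "C_diff (Suc m) N f" "v \<in> cfgs N"
    and "\<And>v i x. i < k \<Longrightarrow> c (v(i := x)) = c v"
  shows "derivation k b (\<lambda>v. c v * f v) v = c v * derivation k b f v"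
  unfolding derivation_def sum_distrib_left
  by (intro sum.cong refl, subst pderiv_at_mult_const[OF assms(2)]) (use assms in \<open>auto simp: algebra_simps\<close>)

text \<open>The factor is constant along every line on which the derivation differentiates, so no
  derivative of it appears. The identity holds on \<open>cfgs N\<close> only, which is why the
  induction passes through \<open>derivation_cong\<close>.\<close>

lemma derivation_pow_mult_const:
  assumes "smooth_field k b" "k \<le> N" "C_diff m N f" "v \<in> cfgs N"
    and "\<And>v i x. i < k \<Longrightarrow> c (v(i := x)) = c v"
  shows "(derivation k b ^^ m) (\<lambda>v. c v * f v) v = c v * (derivation k b ^^ m) f v"
  using assms(3,4)
proof (induction m arbitrary: v)
  case (Suc m)
  have "(derivation k b ^^ Suc m) (\<lambda>v. c v * f v) v = derivation k b (\<lambda>v. c v * (derivation k b ^^ m) f v) v"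
    using derivation_cong[OF Suc.IH _ assms(2)] Suc.prems C_diff_SucD by auto
  also have "\<dots> = c v * (derivation k b ^^ Suc m) f v"
    using derivation_mult_const[OF assms(2) C_diff_derivation_pow[OF assms(1,2), of m "Suc 0" f]]
      Suc.prems assms(5) by simp
  finally show ?case .
qed simp

lemma derivation_pow_add:
  assumes "smooth_field k b" "k \<le> N" "C_diff m N f" "C_diff m N g" "v \<in> cfgs N"
  shows "(derivation k b ^^ m) (\<lambda>v. f v + g v) v = (derivation k b ^^ m) f v + (derivation k b ^^ m) g v"
  using assms(3-5)
proof (induction m arbitrary: v)
  case (Suc m)
  have "(derivation k b ^^ Suc m) (\<lambda>v. f v + g v) v
      = derivation k b (\<lambda>v. (derivation k b ^^ m) f v + (derivation k b ^^ m) g v) v"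
    using derivation_cong[OF Suc.IH _ assms(2)] Suc.prems C_diff_SucD by auto
  also have "\<dots> = (derivation k b ^^ Suc m) f v + (derivation k b ^^ Suc m) g v"
    using derivation_add[OF assms(2) C_diff_derivation_pow[OF assms(1,2), of m "Suc 0" f]
       C_diff_derivation_pow[OF assms(1,2), of m "Suc 0" g]] Suc.prems by simp
  finally show ?case .
qed simp

lemma derivation_pow_const0: "(derivation k b ^^ m) (\<lambda>_. 0) = (\<lambda>_. 0)"
proof (induction m)
  case (Suc m)
  have "derivation k b (\<lambda>_. 0) = (\<lambda>_. 0)"
    by (auto simp: derivation_def pderiv_at_def)
  then show ?case using Suc by simp
qed simp

lemma derivation_pow_sum:
  assumes "smooth_field k b" "k \<le> N" "\<And>a. a \<in> A \<Longrightarrow> C_diff m N (f a)" "v \<in> cfgs N" "finite A"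
  shows "(derivation k b ^^ m) (\<lambda>v. \<Sum>a\<in>A. f a v) v = (\<Sum>a\<in>A. (derivation k b ^^ m) (f a) v)"
  using assms(5,3)
proof (induction A rule: finite_induct)
  case empty then show ?case by (simp add: derivation_pow_const0)
next
  case (insert a A)
  then show ?case
    using derivation_pow_add[OF assms(1,2) _ C_diff_sum assms(4), of m "f a" A f] by auto
qed

section \<open>Measurability, supports and the dual functionals\<close>

lemma space_borel_of [simp]: "space (borel_of X) = topspace X"
  unfolding borel_of_def by (intro space_measure_of) (auto dest: openin_subset)

lemma sets_borel_of: "sets (borel_of X) = sigma_sets (topspace X) {U. openin X U}"
  unfolding borel_of_def by (intro sets_measure_of) (auto dest: openin_subset)

lemma borel_of_euclidean: "borel_of euclidean = (borel :: 'a::topological_space measure)"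
  by (simp add: borel_of_def borel_def)

lemma measurable_borel_of_continuous_map:
  fixes f :: "'a \<Rightarrow> 'b::topological_space"
  assumes "continuous_map X euclidean f"
  shows "f \<in> borel_measurable (borel_of X)"
proof (rule borel_measurableI)
  fix S :: "'b set" assume "open S"
  then have "openin X {x \<in> topspace X. f x \<in> S}"
    using assms by (simp add: continuous_map_def)
  moreover have "f -` S \<inter> space (borel_of X) = {x \<in> topspace X. f x \<in> S}" by auto
  ultimately show "f -` S \<inter> space (borel_of X) \<in> sets (borel_of X)"
    by (auto simp: sets_borel_of)
qed

lemma prob_measures_iff: "F \<in> prob_measures X \<longleftrightarrow> prob_space F \<and> sets F = sets (borel_of X)"
  by (auto simp: prob_measures_def space_prob_algebra)

lemma space_prob_measures: "F \<in> prob_measures X \<Longrightarrow> space F = topspace X"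
  using sets_eq_imp_space_eq[of F "borel_of X"] by (simp add: prob_measures_iff)

abbreviation pborel :: "nat set \<Rightarrow> config measure" where
  "pborel J \<equiv> Pi\<^sub>M J (\<lambda>_. borel)"

lemma space_pborel: "space (pborel {..<N}) = cfgs N"
  by (simp add: space_PiM cfgs_eq)

lemma continuous_map_restrict_cfg:
  "continuous_map euclidean (cfg_top N) (\<lambda>v::config. restrict v {..<N})"
  unfolding cfg_top_def continuous_map_componentwise
proof (intro conjI ballI)
  fix i assume "i \<in> {..<N}"
  have "continuous_map (product_topology (\<lambda>_. euclidean) UNIV) euclidean (\<lambda>v::config. v i)"
    by (rule continuous_map_product_projection) auto
  then show "continuous_map euclidean euclidean (\<lambda>v::config. restrict v {..<N} i)"
    using \<open>i \<in> {..<N}\<close> by (simp add: euclidean_product_topology)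
qed auto

text \<open>Open sets are measurable because they extend to open cylinders among all sequences,
  where the countable product of Borel sigma-algebras is the Borel sigma-algebra. Conversely, the
  coordinates are continuous.\<close>

lemma sets_borel_of_cfg: "sets (borel_of (cfg_top N)) = sets (pborel {..<N})"
proof
  have *: "U \<in> sets (pborel {..<N})" if U: "openin (cfg_top N) U" for U
  proof -
    define V where "V = {v :: config. restrict v {..<N} \<in> U}"
    have "open V"
      using openin_continuous_map_preimage[OF continuous_map_restrict_cfg U] by (simp add: V_def)
    then have V: "V \<in> sets (Pi\<^sub>M UNIV (\<lambda>_. borel) :: config measure)"
      by (simp add: sets_PiM_equal_borel)
    have "(\<lambda>v. v) \<in> measurable (pborel {..<N}) (Pi\<^sub>M UNIV (\<lambda>_. borel))"
    proof (rule measurable_PiM_single')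
      show "(\<lambda>v. v i) \<in> borel_measurable (pborel {..<N})" for i
      proof (cases "i < N")
        case False
        have "(\<lambda>v. v i) \<in> borel_measurable (pborel {..<N}) \<longleftrightarrow>
            (\<lambda>v. undefined :: real^3) \<in> borel_measurable (pborel {..<N})"
          by (intro measurable_cong) (use False in \<open>auto simp: space_PiM PiE_iff extensional_def\<close>)
        then show ?thesis by simp
      qed (auto intro: measurable_component_singleton)
    qed auto
    from measurable_sets[OF this V] have "V \<inter> cfgs N \<in> sets (pborel {..<N})"
      by (simp add: space_pborel)
    moreover have "V \<inter> cfgs N = U"
      using openin_subset[OF U] by (auto simp: V_def cfgs_iff extensional_restrict)
    ultimately show ?thesis by simp
  qed
  have "sigma_sets (space (pborel {..<N})) {U. openin (cfg_top N) U} \<subseteq> sets (pborel {..<N})"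
    by (rule sets.sigma_sets_subset) (use * in auto)
  then show "sets (borel_of (cfg_top N)) \<subseteq> sets (pborel {..<N})"
    by (simp add: sets_borel_of space_pborel)
  have "(\<lambda>v. v) \<in> measurable (borel_of (cfg_top N)) (pborel {..<N})"
  proof (rule measurable_PiM_single')
    fix i assume "i \<in> {..<N}"
    then show "(\<lambda>v. v i) \<in> borel_measurable (borel_of (cfg_top N))"
      unfolding cfg_top_def
      by (intro measurable_borel_of_continuous_map continuous_map_product_projection)
  qed (auto simp: cfgs_eq)
  from measurable_sets[OF this] show "sets (pborel {..<N}) \<subseteq> sets (borel_of (cfg_top N))"
    using sets.sets_into_space[of _ "pborel {..<N}"] by (auto simp: space_pborel Int_absorb2)
qed

lemma sets_cfg_leb: "sets (cfg_leb N) = sets (pborel {..<N})"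
  unfolding cfg_leb_def by (rule sets_PiM_cong) auto

lemma space_cfg_leb: "space (cfg_leb N) = cfgs N"
  using sets_eq_imp_space_eq[OF sets_cfg_leb] by (simp add: space_pborel)

lemma measurable_continuous_cfg:
  fixes f :: "config \<Rightarrow> 'b::topological_space"
  shows "continuous_map (cfg_top N) euclidean f \<Longrightarrow> f \<in> borel_measurable (pborel {..<N})"
  using measurable_borel_of_continuous_map[of "cfg_top N" f]
  by (simp add: measurable_cong_sets[OF sets_borel_of_cfg refl])

lemma C_diff_measurable: "C_diff m N f \<Longrightarrow> f \<in> borel_measurable (pborel {..<N})"
  by (intro measurable_continuous_cfg C_diff_cont)

text \<open>An explicit radius instead of a compact set: it passes unchanged to derivatives and
  products, and shifts enlarge it by a known amount.\<close>

definition supported :: "nat \<Rightarrow> real \<Rightarrow> (config \<Rightarrow> real) \<Rightarrow> bool" where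
  "supported N R f \<longleftrightarrow> (\<forall>v \<in> cfgs N. (\<exists>i<N. R < norm (v i)) \<longrightarrow> f v = 0)"

definition cfg_box :: "nat \<Rightarrow> real \<Rightarrow> config set" where
  "cfg_box N R = {..<N} \<rightarrow>\<^sub>E cball 0 R"

lemma compactin_cfg_box: "compactin (cfg_top N) (cfg_box N R)"
  unfolding cfg_top_def cfg_box_def by (simp add: compactin_PiE)

lemma cfg_box_subset: "cfg_box N R \<subseteq> cfgs N"
  using compactin_cfg_box compactin_subset_topspace by blast

lemma supported_iff_box: "supported N R f \<longleftrightarrow> (\<forall>v \<in> cfgs N - cfg_box N R. f v = 0)"
proof -
  have "v \<in> cfg_box N R \<longleftrightarrow> v \<in> cfgs N \<and> \<not> (\<exists>i<N. R < norm (v i))" for v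
    unfolding cfg_box_def cfgs_eq PiE_iff by (auto simp: not_less[symmetric])
  then show ?thesis by (auto simp: supported_def)
qed

lemma supported_mono: "supported N R f \<Longrightarrow> R \<le> R' \<Longrightarrow> supported N R' f"
  unfolding supported_def by (meson le_less_trans)

text \<open>A compact set has bounded coordinate projections, and boxes are compact by Tychonoff's
  theorem.\<close>

lemma test_functions_iff:
  "\<psi> \<in> test_functions m N \<longleftrightarrow> C_diff m N \<psi> \<and> (\<exists>R. supported N R \<psi>)"
proof safe
  assume *: "\<psi> \<in> test_functions m N"
  then show "C_diff m N \<psi>" by (simp add: test_functions_def)
  obtain K where K: "compactin (cfg_top N) K" "\<forall>v \<in> cfgs N - K. \<psi> v = 0"
    using * by (auto simp: test_functions_def)
  have "\<exists>R. \<forall>v\<in>K. norm (v i) \<le> R" if "i < N" for i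
  proof -
    have "continuous_map (cfg_top N) euclidean (\<lambda>v. v i)"
      unfolding cfg_top_def by (rule continuous_map_product_projection) (use that in auto)
    from image_compactin[OF K(1) this] have "bounded ((\<lambda>v. v i) ` K)"
      by (simp add: compact_imp_bounded)
    then show ?thesis by (auto simp: bounded_iff)
  qed
  then have "\<forall>i. \<exists>R. i < N \<longrightarrow> (\<forall>v\<in>K. norm (v i) \<le> R)" by blast
  then obtain R where R: "\<And>i v. i < N \<Longrightarrow> v \<in> K \<Longrightarrow> norm (v i) \<le> R i"
    unfolding choice_iff by blast
  \<comment> \<open>The sum of the absolute values is a common bound for the radii, also when there
    are none.\<close>
  have "supported N (\<Sum>i<N. \<bar>R i\<bar>) \<psi>"
    unfolding supported_def
  proof safe
    fix v i assume v: "v \<in> cfgs N" "i < N" "(\<Sum>i<N. \<bar>R i\<bar>) < norm (v i)"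
    have "\<bar>R i\<bar> \<le> (\<Sum>i<N. \<bar>R i\<bar>)" by (rule member_le_sum) (use v in auto)
    then have "v \<notin> K" using R[of i v] v by force
    then show "\<psi> v = 0" using K v by auto
  qed
  then show "\<exists>R. supported N R \<psi>" by blast
next
  fix R assume "C_diff m N \<psi>" "supported N R \<psi>"
  then show "\<psi> \<in> test_functions m N"
    using compactin_cfg_box by (auto simp: test_functions_def supported_iff_box)
qed

lemma supported_bounded:
  assumes "continuous_map (cfg_top N) euclideanreal f" "supported N R f"
  obtains B where "0 \<le> B" "\<And>v. v \<in> cfgs N \<Longrightarrow> \<bar>f v\<bar> \<le> B"
proof -
  have "bounded (f ` cfg_box N R)"
    using image_compactin[OF compactin_cfg_box assms(1)] by (simp add: compact_imp_bounded)
  then obtain B where B: "\<And>v. v \<in> cfg_box N R \<Longrightarrow> \<bar>f v\<bar> \<le> B" by (auto simp: bounded_iff)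
  have "\<bar>f v\<bar> \<le> \<bar>B\<bar>" if "v \<in> cfgs N" for v
    using B[of v] assms(2) that by (cases "v \<in> cfg_box N R") (auto simp: supported_iff_box)
  then show ?thesis using that[of "\<bar>B\<bar>"] by auto
qed

text \<open>The condition \<open>R < norm (v j)\<close> is open along the coordinate line, so
  \<open>f\<close> vanishes for all small parameters and not only at the point itself.\<close>

lemma supported_pderiv_at:
  assumes "supported N R f" "i < N"
  shows "supported N R (pderiv_at i e f)"
  unfolding supported_def
proof safe
  fix v j assume v: "v \<in> cfgs N" "j < N" "R < norm (v j)"
  have "((\<lambda>t. norm ((v(i := v i + t *\<^sub>R e)) j)) \<longlongrightarrow> norm (v j)) (nhds 0)"
  proof (cases "j = i")
    case True
    have "((\<lambda>t. norm (v i + t *\<^sub>R e)) \<longlongrightarrow> norm (v i + 0 *\<^sub>R e)) (nhds 0)"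
      by (intro tendsto_intros filterlim_ident)
    then show ?thesis using True by simp
  qed auto
  then have "eventually (\<lambda>t. R < norm ((v(i := v i + t *\<^sub>R e)) j)) (nhds 0)"
    using v(3) by (rule order_tendstoD)
  then have "eventually (\<lambda>t. f (v(i := v i + t *\<^sub>R e)) = 0) (nhds 0)"
  proof eventually_elim
    case (elim t)
    then show ?case using assms cfgs_upd[OF v(1) assms(2)] v(2) unfolding supported_def by blast
  qed
  then have "deriv (\<lambda>t. f (v(i := v i + t *\<^sub>R e))) 0 = deriv (\<lambda>t. 0) (0::real)"
    by (intro deriv_cong_ev) auto
  then show "pderiv_at i e f v = 0" by (simp add: pderiv_at_def)
qed

lemma supported_derivation:
  "supported N R f \<Longrightarrow> k \<le> N \<Longrightarrow> supported N R (derivation k b f)"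
proof -
  assume *: "supported N R f" "k \<le> N"
  have "pderiv_at i e f v = 0" if "i < k" "v \<in> cfgs N" "\<exists>i<N. R < norm (v i)" for i e v
    using supported_pderiv_at[OF *(1), of i e] that *(2) by (simp add: supported_def)
  then show ?thesis by (simp add: supported_def derivation_def)
qed

lemma supported_derivation_pow:
  "supported N R f \<Longrightarrow> k \<le> N \<Longrightarrow> supported N R ((derivation k b ^^ m) f)"
  by (induction m) (auto intro: supported_derivation)

definition integrand :: "nat \<Rightarrow> (config \<Rightarrow> config) \<Rightarrow> nat \<Rightarrow> (config \<Rightarrow> real) \<Rightarrow> config \<Rightarrow> real" where
  "integrand k b m \<psi> v = (derivation k b ^^ m) \<psi> v - (\<psi> v)\<^sup>2 / 4"

definition J_ext :: "nat \<Rightarrow> (config \<Rightarrow> config) \<Rightarrow> nat \<Rightarrow> nat \<Rightarrow> config measure \<Rightarrow> ereal" where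
  "J_ext k b m N F = (SUP \<psi> \<in> test_functions m N. ereal (\<integral>v. integrand k b m \<psi> v \<partial>F))"

lemma I_ext_eq: "I_ext k b = J_ext k b 1"
  by (simp add: I_ext_def J_ext_def integrand_def fun_eq_iff)

lemma K_ext_eq: "K_ext k b = J_ext k b 2"
  by (simp add: K_ext_def J_ext_def integrand_def fun_eq_iff numeral_2_eq_2)

lemma zero_test_function: "(\<lambda>_. 0) \<in> test_functions m N"
  by (auto simp: test_functions_iff supported_def)

lemma integrand_zero: "integrand k b m (\<lambda>_. 0) = (\<lambda>_. 0)"
  by (simp add: integrand_def derivation_pow_const0 fun_eq_iff)

lemma J_ext_upper: "\<psi> \<in> test_functions m N \<Longrightarrow> ereal (\<integral>v. integrand k b m \<psi> v \<partial>F) \<le> J_ext k b m N F"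
  unfolding J_ext_def by (rule SUP_upper)

lemma J_ext_nonneg: "0 \<le> J_ext k b m N F"
  using J_ext_upper[OF zero_test_function, where F = F and k = k and b = b and m = m and N = N] by (simp add: integrand_zero zero_ereal_def)

lemma integrand_continuous:
  assumes "smooth_field k b" "k \<le> N" "C_diff m N \<psi>"
  shows "continuous_map (cfg_top N) euclideanreal (integrand k b m \<psi>)"
proof -
  have "C_diff 0 N (\<lambda>v. (derivation k b ^^ m) \<psi> v + (- 1 / 4) * (\<psi> v * \<psi> v))"
    using C_diff_derivation_pow[OF assms(1,2), of m 0 \<psi>] assms(3) C_diff_mono[OF assms(3), of 0]
    by (intro C_diff_add C_diff_cmult C_diff_mult) auto
  then show ?thesis by (simp add: integrand_def[abs_def] power2_eq_square)
qed

lemma supported_integrand: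
  assumes "supported N R \<psi>" "k \<le> N"
  shows "supported N R (integrand k b m \<psi>)"
  using supported_derivation_pow[OF assms, of m b] assms by (auto simp: supported_def integrand_def)

lemma integrand_bounded:
  assumes "smooth_field k b" "k \<le> N" "\<psi> \<in> test_functions m N"
  obtains B where "0 \<le> B" "\<And>v. v \<in> cfgs N \<Longrightarrow> \<bar>integrand k b m \<psi> v\<bar> \<le> B"
proof -
  obtain R where "C_diff m N \<psi>" "supported N R \<psi>"
    using assms(3) by (auto simp: test_functions_iff)
  then show ?thesis
    using supported_bounded[OF integrand_continuous[OF assms(1,2)] supported_integrand[OF _ assms(2)]] that by blast
qed

lemma integrand_measurable:
  assumes "smooth_field k b" "k \<le> N" "\<psi> \<in> test_functions m N"
  shows "integrand k b m \<psi> \<in> borel_measurable (pborel {..<N})"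
  using assms by (intro measurable_continuous_cfg integrand_continuous) (auto simp: test_functions_iff)

section \<open>Lower semi-continuity and convexity\<close>

lemma topspace_weak_topology: "topspace (weak_topology X) = prob_measures X"
proof
  \<comment> \<open>The zero integrand with \<open>U = UNIV\<close> makes the whole space a subbasic
    set, so the generated topology lives on all of \<open>prob_measures X\<close>.\<close>
  have "{\<mu> \<in> prob_measures X. (\<integral>x. 0 \<partial>\<mu>) \<in> (UNIV :: real set)} \<in>
     {{\<mu> \<in> prob_measures X. (\<integral>x. f x \<partial>\<mu>) \<in> U} | f U.
        continuous_map X euclideanreal f \<and> bounded (f ` topspace X) \<and> open (U :: real set)}"
    by (intro CollectI exI[of _ "\<lambda>_. 0"] exI[of _ UNIV]) (auto simp: bounded_iff)
  then show "prob_measures X \<subseteq> topspace (weak_topology X)"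
    unfolding weak_topology_def topology_generated_by_topspace by (auto simp only: UNIV_I simp_thms Collect_mem_eq intro!: UnionI)
qed (auto simp: weak_topology_def)

lemma openin_weak_topology:
  assumes "continuous_map X euclideanreal f" "\<And>x. x \<in> topspace X \<Longrightarrow> \<bar>f x\<bar> \<le> B" "open U"
  shows "openin (weak_topology X) {\<mu> \<in> prob_measures X. (\<integral>x. f x \<partial>\<mu>) \<in> U}"
  unfolding weak_topology_def
  by (rule topology_generated_by_Basis) (use assms in \<open>auto simp: bounded_iff\<close>)

text \<open>Each integrand is bounded and continuous, so its integral is weakly continuous in the
  measure and the superlevel sets of the supremum are unions of subbasic open sets.\<close>

lemma J_ext_lsc:
  assumes "smooth_field k b" "k \<le> N"
  shows "lsc_on_topology (weak_topology (cfg_top N)) (J_ext k b m N)"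
  unfolding lsc_on_topology_def
proof
  fix c
  have "{F \<in> topspace (weak_topology (cfg_top N)). c < J_ext k b m N F}
     = (\<Union>\<psi> \<in> test_functions m N. {F \<in> prob_measures (cfg_top N). (\<integral>v. integrand k b m \<psi> v \<partial>F) \<in> {x. c < ereal x}})"
    by (auto simp: topspace_weak_topology J_ext_def less_SUP_iff)
  moreover have "openin (weak_topology (cfg_top N)) \<dots>"
  proof (intro openin_Union ballI, clarify)
    fix \<psi> assume \<psi>: "\<psi> \<in> test_functions m N"
    obtain B where B: "\<And>v. v \<in> cfgs N \<Longrightarrow> \<bar>integrand k b m \<psi> v\<bar> \<le> B"
      using integrand_bounded[OF assms \<psi>] by blast
    have "open {x. c < ereal x}"
      by (intro open_Collect_less continuous_intros continuous_on_ereal)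
    then show "openin (weak_topology (cfg_top N)) {F \<in> prob_measures (cfg_top N).
         (\<integral>v. integrand k b m \<psi> v \<partial>F) \<in> {x. c < ereal x}}"
      using \<psi> by (intro openin_weak_topology[OF integrand_continuous[OF assms] B]) (auto simp: test_functions_iff)
  qed
  ultimately show "openin (weak_topology (cfg_top N)) {F \<in> topspace (weak_topology (cfg_top N)). c < J_ext k b m N F}"
    by simp
qed

lemma integral_bounded:
  fixes f :: "'a \<Rightarrow> real"
  assumes "prob_space M" "f \<in> borel_measurable M" "\<And>x. x \<in> space M \<Longrightarrow> \<bar>f x\<bar> \<le> B"
  shows "integrable M f" "\<bar>\<integral>x. f x \<partial>M\<bar> \<le> B"
proof -
  interpret prob_space M by fact
  show int: "integrable M f"
    using assms(2,3) by (intro integrable_const_bound[where B = B]) auto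
  have "\<bar>\<integral>x. f x \<partial>M\<bar> \<le> (\<integral>x. \<bar>f x\<bar> \<partial>M)" by (rule integral_abs_bound)
  also have "\<dots> \<le> (\<integral>x. B \<partial>M)"
    using int assms(3) by (intro integral_mono) auto
  finally show "\<bar>\<integral>x. f x \<partial>M\<bar> \<le> B" by (simp add: prob_space)
qed

lemma integral_bind_bounded:
  fixes f :: "'b \<Rightarrow> real"
  assumes M: "M \<in> space (prob_algebra L)" and K: "K \<in> L \<rightarrow>\<^sub>M prob_algebra N"
    and f: "f \<in> borel_measurable N" and B: "\<And>x. x \<in> space N \<Longrightarrow> \<bar>f x\<bar> \<le> B"
  shows "(\<integral>x. f x \<partial>(M \<bind> K)) = (\<integral>y. (\<integral>x. f x \<partial>K y) \<partial>M)"
proof -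
  have sM: "sets M = sets L" "prob_space M"
    using M by (auto simp: space_prob_algebra)
  have KM: "K \<in> M \<rightarrow>\<^sub>M subprob_algebra N"
    using measurable_prob_algebraD[OF K] by (simp add: measurable_cong_sets[OF sM(1) refl])
  have "emeasure (K y) (space (K y)) \<le> ennreal 1" if "y \<in> space M" for y
    using measurable_space[OF KM that] by (auto simp: space_subprob_algebra subprob_space.emeasure_space_le_1)
  then show ?thesis
    by (intro integral_bind[OF f B KM prob_space.finite_measure[OF sM(2)] AE_I2])
qed

text \<open>\<open>measure_of\<close> takes the prescribed values only if they form a measure. The
  experiment that picks \<open>G\<close> with probability \<open>t\<close> and \<open>F\<close>
  otherwise is a measure with these values, so sigma-additivity comes for free and integrals follow
  from the rule for \<open>bind\<close>.\<close>

lemma convex_comb_eq_bind: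
  assumes "F \<in> prob_measures X" "G \<in> prob_measures X" "0 \<le> t" "t \<le> 1"
  shows "convex_comb t F G = measure_pmf (bernoulli_pmf t) \<bind> (\<lambda>c. if c then G else F)" (is "_ = ?B")
proof -
  have sets: "sets F = sets (borel_of X)" "sets G = sets (borel_of X)"
    using assms by (auto simp: prob_measures_iff)
  have K: "(\<lambda>c. if c then G else F) \<in> count_space UNIV \<rightarrow>\<^sub>M prob_algebra (borel_of X)"
    using assms by (auto simp: prob_measures_def)
  have M: "measure_pmf (bernoulli_pmf t) \<in> space (prob_algebra (count_space UNIV))"
    by (simp add: space_prob_algebra measure_pmf.prob_space_axioms)
  have sB: "sets ?B = sets F"
    using sets_bind'[OF M K] sets by simp
  have em: "emeasure ?B A = ennreal (1 - t) * emeasure F A + ennreal t * emeasure G A" if "A \<in> sets F" for A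
    using assms that sets
    by (subst emeasure_bind_prob_algebra[OF M K])
       (auto simp: nn_integral_bernoulli_pmf mult.commute add.commute)
  have "convex_comb t F G = measure_of (space F) (sets F) (emeasure ?B)"
    unfolding convex_comb_def by (rule measure_of_eq) (use em sets.space_closed in \<open>auto simp: sets.sigma_sets_eq\<close>)
  also have "\<dots> = ?B"
    using measure_of_of_measure[of ?B] sB sets_eq_imp_space_eq[OF sB] by simp
  finally show ?thesis .
qed

lemma integral_convex_comb:
  assumes "F \<in> prob_measures X" "G \<in> prob_measures X" "0 \<le> t" "t \<le> 1"
    and "f \<in> borel_measurable (borel_of X)" "\<And>x. x \<in> topspace X \<Longrightarrow> \<bar>f x\<bar> \<le> B"
  shows "(\<integral>x. f x \<partial>convex_comb t F G) = (1 - t) * (\<integral>x. f x \<partial>F) + t * (\<integral>x. f x \<partial>G)"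
proof -
  have K: "(\<lambda>c. if c then G else F) \<in> count_space UNIV \<rightarrow>\<^sub>M prob_algebra (borel_of X)"
    using assms by (auto simp: prob_measures_def)
  have M: "measure_pmf (bernoulli_pmf t) \<in> space (prob_algebra (count_space UNIV))"
    by (simp add: space_prob_algebra measure_pmf.prob_space_axioms)
  show ?thesis
    unfolding convex_comb_eq_bind[OF assms(1-4)]
    by (subst integral_bind_bounded[OF M K assms(5)])
       (use assms(3,4,6) in \<open>auto simp: integral_bernoulli_pmf\<close>)
qed

lemma J_ext_convex:
  assumes "smooth_field k b" "k \<le> N"
  shows "convex_on_prob_measures (cfg_top N) (J_ext k b m N)"
  unfolding convex_on_prob_measures_def
proof (intro ballI allI impI)
  fix F G and t :: real
  assume FG: "F \<in> prob_measures (cfg_top N)" "G \<in> prob_measures (cfg_top N)" and t: "0 \<le> t \<and> t \<le> 1"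
  show "J_ext k b m N (convex_comb t F G) \<le> ereal (1 - t) * J_ext k b m N F + ereal t * J_ext k b m N G"
    unfolding J_ext_def[of k b m N "convex_comb t F G"]
  proof (rule SUP_least)
    fix \<psi> assume \<psi>: "\<psi> \<in> test_functions m N"
    obtain B where B: "\<And>v. v \<in> cfgs N \<Longrightarrow> \<bar>integrand k b m \<psi> v\<bar> \<le> B"
      using integrand_bounded[OF assms \<psi>] by blast
    have meas: "integrand k b m \<psi> \<in> borel_measurable (borel_of (cfg_top N))"
      using \<psi> by (intro measurable_borel_of_continuous_map integrand_continuous assms) (auto simp: test_functions_iff)
    have "ereal (\<integral>v. integrand k b m \<psi> v \<partial>convex_comb t F G)
      = ereal (1 - t) * ereal (\<integral>v. integrand k b m \<psi> v \<partial>F) + ereal t * ereal (\<integral>v. integrand k b m \<psi> v \<partial>G)"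
      using integral_convex_comb[OF FG _ _ meas B] t by simp
    also have "\<dots> \<le> ereal (1 - t) * J_ext k b m N F + ereal t * J_ext k b m N G"
      using t by (intro add_mono ereal_mult_left_mono J_ext_upper \<psi>) auto
    finally show "ereal (\<integral>v. integrand k b m \<psi> v \<partial>convex_comb t F G) \<le>
       ereal (1 - t) * J_ext k b m N F + ereal t * J_ext k b m N G" .
  qed
qed

section \<open>Density of cylindrical test functions\<close>

text \<open>\<open>D\<close> is the sequence of successive derivatives of a function on the line,
  and the induction step drops its first entry. As basis vectors are orthonormal, moving along
  \<open>e'\<close> changes \<open>v i \<bullet> e\<close> only for \<open>i' = i\<close> and
  \<open>e' = e\<close>, and then with speed one.\<close>

lemma C_diff_coordinate:
  assumes "\<And>n t. n < m \<Longrightarrow> (D n has_real_derivative D (Suc n) t) (at t)"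
    and "\<And>n. n \<le> m \<Longrightarrow> continuous_on UNIV (D n)" and "e \<in> Basis"
  shows "C_diff m N (\<lambda>v. D 0 (v i \<bullet> e))"
proof -
  have cont: "continuous_map (cfg_top N) euclideanreal (\<lambda>v. g (v i \<bullet> e))"
    if "continuous_on UNIV g" for g :: "real \<Rightarrow> real"
  proof (cases "i < N")
    case True
    have "continuous_map (cfg_top N) euclidean (\<lambda>v. v i)"
      unfolding cfg_top_def by (rule continuous_map_product_projection) (use True in auto)
    moreover have "continuous_on UNIV (\<lambda>x::real^3. g (x \<bullet> e))"
      by (rule continuous_on_compose2[OF that]) (auto intro!: continuous_intros)
    ultimately show ?thesis
      using continuous_map_compose[of "cfg_top N" euclidean "\<lambda>v. v i" euclideanreal "\<lambda>x. g (x \<bullet> e)"]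
      by (simp add: o_def)
  next
    case False
    show ?thesis
      by (rule continuous_map_eq[of _ _ "\<lambda>_. g (undefined \<bullet> e)"])
         (use False in \<open>auto simp: cfgs_iff extensional_def\<close>)
  qed
  show ?thesis
    using assms(1,2)
  proof (induction m arbitrary: D)
    case 0 then show ?case using cont by simp
  next
    case (Suc m)
    show ?case
    proof (rule C_diff_SucI)
      show "continuous_map (cfg_top N) euclideanreal (\<lambda>v. D 0 (v i \<bullet> e))"
        using Suc.prems by (intro cont) auto
      fix i' and e' :: "real^3" assume e': "e' \<in> Basis"
      show "((\<lambda>t. D 0 ((v(i' := v i' + t *\<^sub>R e')) i \<bullet> e)) has_real_derivative
          (if i' = i \<and> e' = e then D (Suc 0) (v i \<bullet> e) else 0)) (at 0)" for v
      proof (cases "i' = i \<and> e' = e")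
        case True
        have "(\<lambda>t. D 0 ((v(i' := v i' + t *\<^sub>R e')) i \<bullet> e)) = (\<lambda>t. D 0 (t + v i \<bullet> e))"
          using True assms(3) by (auto simp: inner_add_left algebra_simps)
        then show ?thesis
          using True Suc.prems(1)[of 0 "v i \<bullet> e"] DERIV_shift[of "D 0" "D (Suc 0) (v i \<bullet> e)" 0 "v i \<bullet> e"]
          by simp
      next
        case False
        have "(\<lambda>t. D 0 ((v(i' := v i' + t *\<^sub>R e')) i \<bullet> e)) = (\<lambda>t. D 0 (v i \<bullet> e))"
          using False assms(3) e' by (auto simp: inner_add_left inner_Basis)
        then show ?thesis unfolding if_not_P[OF False] by simp
      qed
      have "C_diff m N (\<lambda>v. D (Suc 0) (v i \<bullet> e))"
        using Suc.IH[of "\<lambda>n. D (Suc n)"] Suc.prems by auto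
      then show "C_diff m N (\<lambda>v. if i' = i \<and> e' = e then D (Suc 0) (v i \<bullet> e) else 0)"
        by (cases "i' = i \<and> e' = e") auto
    qed
  qed
qed

text \<open>\<open>pos_cube\<close> is the cube of the positive part, which is only of class C2; this is where \<open>m \<le> 2\<close> enters.
  As \<open>c\<close> tends to 0, \<open>bump c l u\<close> tends to the indicator of the open interval from \<open>l\<close> to \<open>u\<close>.\<close>

definition pos_cube :: "real \<Rightarrow> real" where
  "pos_cube x = (x ^ 3 + x * x * \<bar>x\<bar>) / 2"

definition bump :: "real \<Rightarrow> real \<Rightarrow> real \<Rightarrow> real \<Rightarrow> real" where
  "bump c l u t = pos_cube ((t - l) * (u - t)) / (c + pos_cube ((t - l) * (u - t)))"

text \<open>Away from 0 the function is locally the square with a constant sign; at 0 the difference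
  quotient is \<open>\<bar>h\<bar>\<close>.\<close>

lemma DERIV_mult_abs: "((\<lambda>x::real. x * \<bar>x\<bar>) has_real_derivative 2 * \<bar>x\<bar>) (at x)"
proof (cases "x = 0")
  case True
  have "((\<lambda>h::real. \<bar>h\<bar>) \<longlongrightarrow> \<bar>0\<bar>) (at 0)" by (intro tendsto_intros)
  moreover have "eventually (\<lambda>h. \<bar>h\<bar> = h * \<bar>h\<bar> / h) (at (0::real))"
    by (auto simp: eventually_at_filter)
  ultimately have "((\<lambda>h::real. h * \<bar>h\<bar> / h) \<longlongrightarrow> \<bar>0\<bar>) (at 0)"
    by (rule Lim_transform_eventually)
  then show ?thesis using True by (simp add: DERIV_def)
next
  case False
  have "((\<lambda>y::real. sgn x * (y * y)) has_real_derivative 2 * \<bar>x\<bar>) (at x)"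
    by (auto intro!: derivative_eq_intros simp: sgn_real_def)
  moreover have "open {y. 0 < sgn x * y}"
    by (intro open_Collect_less continuous_intros)
  moreover have "0 < sgn x * x" using False by (simp add: sgn_real_def)
  moreover have "sgn x * (y * y) = y * \<bar>y\<bar>" if "y \<in> {y. 0 < sgn x * y}" for y
    using that by (auto simp: sgn_real_def split: if_splits)
  ultimately show ?thesis by (auto intro: has_field_derivative_transform_within_open)
qed

lemma DERIV_pos_cube:
  "(pos_cube has_real_derivative 3 * (x * x + x * \<bar>x\<bar>) / 2) (at x)"
proof -
  have "((\<lambda>x. (x ^ 3 + x * (x * \<bar>x\<bar>)) / 2) has_real_derivative
      (3 * x ^ 2 + (x * (2 * \<bar>x\<bar>) + 1 * (x * \<bar>x\<bar>))) / 2) (at x)"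
    by (rule derivative_eq_intros DERIV_mult_abs refl | simp)+
  then show ?thesis by (simp add: pos_cube_def[abs_def] algebra_simps power2_eq_square)
qed

lemma pos_cube_eq: "pos_cube x = (if x \<le> 0 then 0 else x ^ 3)"
  by (auto simp: pos_cube_def abs_if power3_eq_cube)

lemma pos_cube_nonneg: "0 \<le> pos_cube x"
  by (simp add: pos_cube_eq)

lemma bump_bounds: "0 < c \<Longrightarrow> 0 \<le> bump c l u t" "0 < c \<Longrightarrow> bump c l u t \<le> 1"
  using pos_cube_nonneg[of "(t - l) * (u - t)"] by (auto simp: bump_def divide_simps)

lemma bump_support: "t \<le> l \<or> u \<le> t \<Longrightarrow> l \<le> u \<Longrightarrow> bump c l u t = 0"
  by (auto simp: bump_def pos_cube_eq mult_le_0_iff)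

text \<open>Inside the interval the quadratic is positive, so p / (c + p) tends to 1 as c tends to
  0; outside, the positive part makes it 0 for every c.\<close>

lemma bump_tendsto:
  assumes "l \<le> u"
  shows "(\<lambda>n. bump (1 / real (Suc n)) l u t) \<longlonglongrightarrow> (if l < t \<and> t < u then 1 else 0)"
proof (cases "l < t \<and> t < u")
  case True
  then have p: "0 < pos_cube ((t - l) * (u - t))" by (auto simp: pos_cube_eq mult_le_0_iff)
  have "(\<lambda>n. bump (1 / real (Suc n)) l u t) \<longlonglongrightarrow>
      pos_cube ((t - l) * (u - t)) / (0 + pos_cube ((t - l) * (u - t)))"
    unfolding bump_def using p by (intro tendsto_intros LIMSEQ_Suc[OF lim_1_over_n]) auto
  then show ?thesis using True p by simp
next
  case False
  then show ?thesis using assms by (auto simp: bump_support)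
qed

lemma C_diff_bump:
  assumes "0 < c" "m \<le> 2" "e \<in> Basis"
  shows "C_diff m N (\<lambda>v. bump c l u (v i \<bullet> e))"
proof -
  \<comment> \<open>\<open>x\<close> is the quadratic inside \<open>pos_cube\<close> and
    \<open>y\<close> its derivative; \<open>p0\<close>, \<open>p1\<close>, \<open>p2\<close> are the
    composition and its first two derivatives. The derivative of \<open>pos_cube\<close> at
    \<open>x t\<close> is \<open>3 * s t / 2\<close>.\<close>
  define x where "x = (\<lambda>t::real. (t - l) * (u - t))"
  define y where "y = (\<lambda>t::real. l + u - 2 * t)"
  define p0 where "p0 = (\<lambda>t. pos_cube (x t))"
  define s where "s = (\<lambda>t. x t * x t + x t * \<bar>x t\<bar>)"
  define p1 where "p1 = (\<lambda>t. 3 * s t / 2 * y t)"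
  define p2 where "p2 = (\<lambda>t. 3 * ((2 * x t + 2 * \<bar>x t\<bar>) * y t) / 2 * y t + 3 * s t / 2 * (- 2))"
  have dy: "(y has_real_derivative - 2) (at t)" for t
    unfolding y_def by (auto intro!: derivative_eq_intros)
  have dx: "(x has_real_derivative y t) (at t)" for t
    unfolding x_def y_def by (auto intro!: derivative_eq_intros simp: algebra_simps)
  have d0: "(p0 has_real_derivative p1 t) (at t)" for t
    using DERIV_chain2[OF DERIV_pos_cube dx] by (simp add: p0_def p1_def s_def)
  have ds: "(s has_real_derivative (2 * x t + 2 * \<bar>x t\<bar>) * y t) (at t)" for t
    unfolding s_def
    using DERIV_add[OF DERIV_mult[OF dx dx] DERIV_chain2[OF DERIV_mult_abs dx]]
    by (rule DERIV_cong) (simp add: algebra_simps)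
  have d1: "(p1 has_real_derivative p2 t) (at t)" for t
  proof -
    have "((\<lambda>t. 3 * s t / 2) has_real_derivative 3 * ((2 * x t + 2 * \<bar>x t\<bar>) * y t) / 2) (at t)"
      by (intro DERIV_cdivide DERIV_cmult ds)
    from DERIV_mult[OF this dy] show ?thesis
      unfolding p1_def p2_def by (rule DERIV_cong) (simp add: algebra_simps)
  qed
  have pos: "0 < c + p0 t" for t
    using assms(1) pos_cube_nonneg[of "x t"] by (simp add: p0_def)
  \<comment> \<open>Quotient rule for p0 / (c + p0): in the first derivative the numerator collapses
    to \<open>c * p1\<close>, and in the second a power of the denominator cancels.\<close>
  define D where "D = (\<lambda>n::nat. if n = 0 then (\<lambda>t. p0 t / (c + p0 t))
     else if n = 1 then (\<lambda>t. c * p1 t / (c + p0 t) ^ 2)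
     else (\<lambda>t. c * (p2 t * (c + p0 t) - 2 * p1 t * p1 t) / (c + p0 t) ^ 3))"
  have D: "(D n has_real_derivative D (Suc n) t) (at t)" if "n < 2" for n t
  proof -
    have nz: "c + p0 t \<noteq> 0" using pos[of t] by simp
    have "((\<lambda>t. p0 t / (c + p0 t)) has_real_derivative c * p1 t / (c + p0 t) ^ 2) (at t)"
      by (rule derivative_eq_intros d0 refl nz)+ (use nz in \<open>simp add: field_simps power2_eq_square\<close>)
    moreover have alg: "(c * a * w ^ 2 - c * b * (2 * w * b)) / (w ^ 2 * w ^ 2) = c * (a * w - 2 * b * b) / w ^ 3"
      if "w \<noteq> 0" for a b w :: real
      using that by (simp add: divide_simps power2_eq_square power3_eq_cube) (simp add: algebra_simps)
    have "((\<lambda>t. (c + p0 t) ^ 2) has_real_derivative 2 * (c + p0 t) * p1 t) (at t)"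
      by (rule derivative_eq_intros d0 refl | simp)+
    from DERIV_divide[OF DERIV_cmult[OF d1, of c] this]
    have d: "((\<lambda>t. c * p1 t / (c + p0 t) ^ 2) has_real_derivative
        (c * p2 t * (c + p0 t) ^ 2 - c * p1 t * (2 * (c + p0 t) * p1 t)) / ((c + p0 t) ^ 2 * (c + p0 t) ^ 2)) (at t)"
      using nz by simp
    have "((\<lambda>t. c * p1 t / (c + p0 t) ^ 2) has_real_derivative
        c * (p2 t * (c + p0 t) - 2 * p1 t * p1 t) / (c + p0 t) ^ 3) (at t)"
      by (rule DERIV_cong[OF d alg[OF nz]])
    ultimately show ?thesis using that by (cases "n = 0") (auto simp: D_def)
  qed
  have DC: "continuous_on UNIV f" if "\<And>t. (f has_real_derivative f' t) (at t)" for f f' :: "real \<Rightarrow> real"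
    by (rule DERIV_continuous_on) (rule that)
  have cxy: "continuous_on UNIV x" "continuous_on UNIV y" "continuous_on UNIV s"
    by (rule DC[OF dx] DC[OF dy] DC[OF ds])+
  have c2: "continuous_on UNIV p2"
    unfolding p2_def by (intro continuous_on_add continuous_on_mult continuous_on_divide
      continuous_on_rabs continuous_on_const cxy) auto
  have c01: "continuous_on UNIV p0" "continuous_on UNIV p1"
    by (rule DC[OF d0] DC[OF d1])+
  have nz: "c + p0 t \<noteq> 0" for t using pos[of t] by simp
  \<comment> \<open>The highest derivative is the only one whose continuity does not follow from
    differentiability.\<close>
  have "continuous_on UNIV (\<lambda>t. c * (p2 t * (c + p0 t) - 2 * p1 t * p1 t) / (c + p0 t) ^ 3)"
    by (intro continuous_on_divide continuous_on_mult continuous_on_diff continuous_on_add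
      continuous_on_power continuous_on_const c01 c2) (use nz in auto)
  moreover have "continuous_on UNIV (D n)" if "n < 2" for n
    by (rule DC[OF D[OF that]])
  ultimately have "continuous_on UNIV (D n)" for n
    by (cases "n < 2") (auto simp: D_def)
  then have "C_diff m N (\<lambda>v. D 0 (v i \<bullet> e))"
    using assms D by (intro C_diff_coordinate) auto
  then show ?thesis by (simp add: D_def bump_def p0_def x_def)
qed

text \<open>Smooth functions of the variables in \<open>J\<close>, with support bounded in these
  variables only. Regularity for every \<open>N\<close> and boundedness on the whole function space
  let the same function be used among any number of particles and be multiplied with test functions
  of the other variables.\<close>

definition cyl_test :: "nat \<Rightarrow> nat set \<Rightarrow> (config \<Rightarrow> real) \<Rightarrow> bool" where
  "cyl_test m J \<eta> \<longleftrightarrow> (\<forall>N. C_diff m N \<eta>) \<and> (\<forall>v w. (\<forall>i\<in>J. v i = w i) \<longrightarrow> \<eta> v = \<eta> w) \<and>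
     (\<exists>R. \<forall>v. (\<exists>i\<in>J. R < norm (v i)) \<longrightarrow> \<eta> v = 0) \<and> (\<exists>B. \<forall>v. \<bar>\<eta> v\<bar> \<le> B)"

lemma cyl_testI:
  assumes "\<And>N. C_diff m N \<eta>" "\<And>v w. (\<And>i. i \<in> J \<Longrightarrow> v i = w i) \<Longrightarrow> \<eta> v = \<eta> w"
    "\<And>v i. i \<in> J \<Longrightarrow> R < norm (v i) \<Longrightarrow> \<eta> v = 0" "\<And>v. \<bar>\<eta> v\<bar> \<le> B"
  shows "cyl_test m J \<eta>"
  using assms unfolding cyl_test_def by blast

lemma cyl_test_C_diff: "cyl_test m J \<eta> \<Longrightarrow> C_diff m N \<eta>"
  by (simp add: cyl_test_def)

lemma cyl_test_local: "cyl_test m J \<eta> \<Longrightarrow> (\<And>i. i \<in> J \<Longrightarrow> v i = w i) \<Longrightarrow> \<eta> v = \<eta> w"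
  unfolding cyl_test_def by blast

lemma cyl_test_support:
  assumes "cyl_test m J \<eta>"
  obtains R where "\<And>v i. i \<in> J \<Longrightarrow> R < norm (v i) \<Longrightarrow> \<eta> v = 0"
  using assms unfolding cyl_test_def by blast

lemma cyl_test_bounded:
  assumes "cyl_test m J \<eta>"
  obtains B where "\<And>v. \<bar>\<eta> v\<bar> \<le> B"
  using assms unfolding cyl_test_def by blast

lemma cyl_test_add:
  assumes "cyl_test m J f" "cyl_test m J g"
  shows "cyl_test m J (\<lambda>v. f v + g v)"
proof -
  obtain R where R: "\<And>v i. i \<in> J \<Longrightarrow> R < norm (v i) \<Longrightarrow> f v = 0" using cyl_test_support[OF assms(1)] by blast
  obtain R' where R': "\<And>v i. i \<in> J \<Longrightarrow> R' < norm (v i) \<Longrightarrow> g v = 0" using cyl_test_support[OF assms(2)] by blast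
  obtain B where B: "\<And>v. \<bar>f v\<bar> \<le> B" using cyl_test_bounded[OF assms(1)] by blast
  obtain B' where B': "\<And>v. \<bar>g v\<bar> \<le> B'" using cyl_test_bounded[OF assms(2)] by blast
  show ?thesis
  proof (rule cyl_testI[where R = "max R R'" and B = "B + B'"])
    show "f v + g v = f w + g w" if "\<And>i. i \<in> J \<Longrightarrow> v i = w i" for v w
      using cyl_test_local[OF assms(1) that] cyl_test_local[OF assms(2) that] by simp
    show "\<bar>f v + g v\<bar> \<le> B + B'" for v using B[of v] B'[of v] by linarith
  qed (use R R' assms in \<open>auto intro: C_diff_add cyl_test_C_diff\<close>)
qed

lemma cyl_test_cmult:
  assumes "cyl_test m J f"
  shows "cyl_test m J (\<lambda>v. c * f v)"
proof -
  obtain R where R: "\<And>v i. i \<in> J \<Longrightarrow> R < norm (v i) \<Longrightarrow> f v = 0" using cyl_test_support[OF assms(1)] by blast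
  obtain B where B: "\<And>v. \<bar>f v\<bar> \<le> B" using cyl_test_bounded[OF assms(1)] by blast
  show ?thesis
  proof (rule cyl_testI[where R = R and B = "\<bar>c\<bar> * B"])
    show "c * f v = c * f w" if "\<And>i. i \<in> J \<Longrightarrow> v i = w i" for v w
      using cyl_test_local[OF assms(1) that] by simp
    show "\<bar>c * f v\<bar> \<le> \<bar>c\<bar> * B" for v using B[of v] by (simp add: abs_mult mult_left_mono)
  qed (use R assms in \<open>auto intro: C_diff_cmult cyl_test_C_diff\<close>)
qed

lemma cyl_test_zero: "cyl_test m J (\<lambda>_. 0)"
  by (rule cyl_testI[where B = 0]) auto

section \<open>Smoothed indicators of boxes\<close>

definition box_bump :: "nat set \<Rightarrow> (nat \<Rightarrow> real^3) \<Rightarrow> (nat \<Rightarrow> real^3) \<Rightarrow> real \<Rightarrow> config \<Rightarrow> real" where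
  "box_bump J l u c v = (\<Prod>i\<in>J. \<Prod>e\<in>Basis. bump c (l i \<bullet> e) (u i \<bullet> e) (v i \<bullet> e))"

lemma box_bump_bounds:
  assumes "0 < c"
  shows "0 \<le> box_bump J l u c v" "box_bump J l u c v \<le> 1"
  unfolding box_bump_def using bump_bounds[OF assms] by (auto intro!: prod_nonneg prod_le_1)

text \<open>The norm is at most the sum of the absolute coordinates. So if \<open>norm (v i)\<close>
  exceeds the sum over all corner coordinates, some coordinate of \<open>v i\<close> lies outside
  its interval and the bump there is 0.\<close>

lemma cyl_test_box_bump:
  assumes "finite J" "0 < c" "m \<le> 2" "\<And>i e. i \<in> J \<Longrightarrow> e \<in> Basis \<Longrightarrow> l i \<bullet> e \<le> u i \<bullet> e"
  shows "cyl_test m J (box_bump J l u c)"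
proof (rule cyl_testI[where R = "\<Sum>i\<in>J. \<Sum>e\<in>Basis. \<bar>l i \<bullet> e\<bar> + \<bar>u i \<bullet> e\<bar>" and B = 1])
  show "C_diff m N (box_bump J l u c)" for N
    unfolding box_bump_def[abs_def] by (intro C_diff_prod C_diff_bump assms)
  show "box_bump J l u c v = box_bump J l u c w" if "\<And>i. i \<in> J \<Longrightarrow> v i = w i" for v w
    using that by (simp add: box_bump_def)
  show "\<bar>box_bump J l u c v\<bar> \<le> 1" for v
    using box_bump_bounds[OF assms(2)] by simp
  fix v :: config and i assume i: "i \<in> J" and v: "(\<Sum>i\<in>J. \<Sum>e\<in>Basis. \<bar>l i \<bullet> e\<bar> + \<bar>u i \<bullet> e\<bar>) < norm (v i)"
  have "(\<Sum>e\<in>Basis. \<bar>l i \<bullet> e\<bar> + \<bar>u i \<bullet> e\<bar>)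
      \<le> (\<Sum>i\<in>J. \<Sum>e\<in>Basis. \<bar>l i \<bullet> e\<bar> + \<bar>u i \<bullet> e\<bar>)"
    by (rule member_le_sum) (use i assms(1) in \<open>auto intro!: add_nonneg_nonneg sum_nonneg\<close>)
  then have *: "(\<Sum>e\<in>Basis. \<bar>l i \<bullet> e\<bar> + \<bar>u i \<bullet> e\<bar>) < norm (v i)"
    using v by linarith
  also have "norm (v i) \<le> (\<Sum>e\<in>Basis. \<bar>v i \<bullet> e\<bar>)" by (rule norm_le_l1)
  finally obtain e where e: "e \<in> Basis" "\<bar>l i \<bullet> e\<bar> + \<bar>u i \<bullet> e\<bar> < \<bar>v i \<bullet> e\<bar>"
    by (meson not_less sum_mono)
  then have "bump c (l i \<bullet> e) (u i \<bullet> e) (v i \<bullet> e) = 0"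
    using assms(4)[OF i e(1)] by (intro bump_support) auto
  then have "(\<Prod>e\<in>Basis. bump c (l i \<bullet> e) (u i \<bullet> e) (v i \<bullet> e)) = 0"
    using e(1) by (auto simp: prod_zero_iff)
  then show "box_bump J l u c v = 0"
    unfolding box_bump_def using i assms(1) by (auto simp: prod_zero_iff)
qed

lemma box_bump_tendsto:
  assumes "finite J" "\<And>i e. i \<in> J \<Longrightarrow> e \<in> Basis \<Longrightarrow> l i \<bullet> e \<le> u i \<bullet> e"
  shows "(\<lambda>n. box_bump J l u (1 / real (Suc n)) v) \<longlonglongrightarrow> (if \<forall>i\<in>J. v i \<in> box (l i) (u i) then 1 else 0)"
proof -
  have "(\<lambda>n. box_bump J l u (1 / real (Suc n)) v) \<longlonglongrightarrow>
      (\<Prod>i\<in>J. \<Prod>e\<in>Basis. if l i \<bullet> e < v i \<bullet> e \<and> v i \<bullet> e < u i \<bullet> e then 1 else 0)"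
    unfolding box_bump_def by (intro tendsto_prod bump_tendsto assms)
  also have "(\<Prod>i\<in>J. \<Prod>e\<in>Basis. if l i \<bullet> e < v i \<bullet> e \<and> v i \<bullet> e < u i \<bullet> e then 1 else 0)
      = (if \<forall>i\<in>J. v i \<in> box (l i) (u i) then 1 else (0::real))"
  proof (cases "\<forall>i\<in>J. v i \<in> box (l i) (u i)")
    case False
    then obtain i e where ie: "i \<in> J" "e \<in> Basis" "\<not> (l i \<bullet> e < v i \<bullet> e \<and> v i \<bullet> e < u i \<bullet> e)"
      by (auto simp: mem_box)
    then have "(\<Prod>e\<in>Basis. if l i \<bullet> e < v i \<bullet> e \<and> v i \<bullet> e < u i \<bullet> e then 1 else (0::real)) = 0"
      by (intro prod_zero) auto
    then have "(\<Prod>i\<in>J. \<Prod>e\<in>Basis. if l i \<bullet> e < v i \<bullet> e \<and> v i \<bullet> e < u i \<bullet> e then 1 else (0::real)) = 0"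
      by (intro prod_zero[OF assms(1)] bexI[OF _ ie(1)])
    then show ?thesis unfolding if_not_P[OF False] .
  qed (auto simp: mem_box intro!: prod.neutral)
  finally show ?thesis .
qed

text \<open>Approximation in L2 of \<open>F\<close> by smooth functions of the variables in
  \<open>J\<close>. The nonnegative integral avoids an integrability condition, and \<open>f\<close>
  is evaluated at the restriction because only its values on functions with domain \<open>J\<close>
  are meaningful.\<close>

definition approximable :: "nat \<Rightarrow> nat set \<Rightarrow> config measure \<Rightarrow> (config \<Rightarrow> real) \<Rightarrow> bool" where
  "approximable m J F f \<longleftrightarrow> (\<forall>\<epsilon>>0. \<exists>\<eta>. cyl_test m J \<eta> \<and>
     (\<integral>\<^sup>+v. ennreal ((\<eta> v - f (restrict v J))\<^sup>2) \<partial>F) < ennreal \<epsilon>)"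

lemma restrict_in_space: "restrict v J \<in> space (pborel J)"
  by (simp add: space_PiM)

lemma approximable_cong:
  assumes "\<And>w. w \<in> space (pborel J) \<Longrightarrow> f w = g w"
  shows "approximable m J F f \<longleftrightarrow> approximable m J F g"
  unfolding approximable_def assms[OF restrict_in_space] ..

section \<open>From smoothed boxes to all bounded measurable functions\<close>

context
  fixes F :: "config measure" and N m :: nat and J :: "nat set"
  assumes F: "finite_measure F" "sets F = sets (pborel {..<N})" and J: "J \<subseteq> {..<N}" and m: "m \<le> 2"
begin

lemma measurable_pborel_F: "f \<in> borel_measurable (pborel {..<N}) \<Longrightarrow> f \<in> borel_measurable F"
  by (subst measurable_cong_sets[OF F(2) refl])

lemma measurable_restrict_F:
  assumes "f \<in> borel_measurable (pborel J)"
  shows "(\<lambda>v. f (restrict v J)) \<in> borel_measurable F"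
  by (rule measurable_pborel_F[OF measurable_compose[OF measurable_restrict_subset[OF J] assms]])

lemma measurable_cyl_test: "cyl_test m J \<eta> \<Longrightarrow> \<eta> \<in> borel_measurable F"
  by (rule measurable_pborel_F) (auto simp: cyl_test_def intro: C_diff_measurable)

lemma power2_add_le: "(x + y)\<^sup>2 \<le> 2 * x\<^sup>2 + 2 * (y::real)\<^sup>2"
  using sum_squares_bound[of x y] by (simp add: power2_sum)

text \<open>The square of a sum is at most twice the sum of the squares, so two bounds
  \<open>\<epsilon> / 8\<close> give \<open>\<epsilon> / 2\<close>; the spare factor keeps the
  inequality strict.\<close>

lemma nn_integral_sq_add_less:
  assumes "f \<in> borel_measurable F" "g \<in> borel_measurable F" "0 < \<epsilon>"
    "(\<integral>\<^sup>+v. ennreal ((f v)\<^sup>2) \<partial>F) < ennreal (\<epsilon> / 8)" "(\<integral>\<^sup>+v. ennreal ((g v)\<^sup>2) \<partial>F) < ennreal (\<epsilon> / 8)"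
  shows "(\<integral>\<^sup>+v. ennreal ((f v + g v)\<^sup>2) \<partial>F) < ennreal \<epsilon>"
proof -
  have "(\<integral>\<^sup>+v. ennreal ((f v + g v)\<^sup>2) \<partial>F) \<le> (\<integral>\<^sup>+v. 2 * ennreal ((f v)\<^sup>2) + 2 * ennreal ((g v)\<^sup>2) \<partial>F)"
  proof (intro nn_integral_mono)
    fix v
    have eq: "2 * ennreal ((f v)\<^sup>2) + 2 * ennreal ((g v)\<^sup>2) = ennreal (2 * (f v)\<^sup>2 + 2 * (g v)\<^sup>2)"
      by (simp add: ennreal_mult ennreal_plus)
    show "ennreal ((f v + g v)\<^sup>2) \<le> 2 * ennreal ((f v)\<^sup>2) + 2 * ennreal ((g v)\<^sup>2)"
      unfolding eq by (intro ennreal_leI power2_add_le)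
  qed
  also have "\<dots> = 2 * (\<integral>\<^sup>+v. ennreal ((f v)\<^sup>2) \<partial>F) + 2 * (\<integral>\<^sup>+v. ennreal ((g v)\<^sup>2) \<partial>F)"
    using assms(1,2) by (subst nn_integral_add) (auto simp: nn_integral_cmult)
  also have "\<dots> \<le> 2 * ennreal (\<epsilon> / 8) + 2 * ennreal (\<epsilon> / 8)"
    using assms(4,5) by (intro add_mono mult_left_mono) auto
  also have "\<dots> = ennreal (2 * (\<epsilon> / 8) + 2 * (\<epsilon> / 8))"
  proof -
    have "2 * ennreal (\<epsilon> / 8) = ennreal (2 * (\<epsilon> / 8))"
      using assms(3) ennreal_mult[of 2 "\<epsilon> / 8"] by simp
    then show ?thesis using assms(3) by (simp only: ennreal_plus[of "2 * (\<epsilon> / 8)" "2 * (\<epsilon> / 8)"])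
  qed
  also have "\<dots> < ennreal \<epsilon>"
    using assms(3) by (intro ennreal_lessI) auto
  finally show ?thesis .
qed

lemma approximable_cyl:
  assumes "cyl_test m J \<eta>"
  shows "approximable m J F \<eta>"
proof -
  have "\<eta> (restrict v J) = \<eta> v" for v
    by (rule cyl_test_local[OF assms]) simp
  then show ?thesis using assms unfolding approximable_def by (intro allI impI exI[of _ \<eta>]) simp
qed

lemma approximable_add:
  assumes "approximable m J F f" "approximable m J F g"
    "f \<in> borel_measurable (pborel J)" "g \<in> borel_measurable (pborel J)"
  shows "approximable m J F (\<lambda>v. f v + g v)"
  unfolding approximable_def
proof (intro allI impI)
  fix \<epsilon> :: real assume "\<epsilon> > 0"
  then obtain \<eta>1 \<eta>2 where \<eta>: "cyl_test m J \<eta>1" "cyl_test m J \<eta>2"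
    "(\<integral>\<^sup>+v. ennreal ((\<eta>1 v - f (restrict v J))\<^sup>2) \<partial>F) < ennreal (\<epsilon> / 8)"
    "(\<integral>\<^sup>+v. ennreal ((\<eta>2 v - g (restrict v J))\<^sup>2) \<partial>F) < ennreal (\<epsilon> / 8)"
    using assms(1,2) unfolding approximable_def by (meson divide_pos_pos zero_less_numeral)
  have "(\<integral>\<^sup>+v. ennreal (((\<eta>1 v - f (restrict v J)) + (\<eta>2 v - g (restrict v J)))\<^sup>2) \<partial>F) < ennreal \<epsilon>"
    using \<eta> \<open>\<epsilon> > 0\<close> assms(3,4)
    by (intro nn_integral_sq_add_less borel_measurable_diff measurable_cyl_test measurable_restrict_F) auto
  then show "\<exists>\<eta>. cyl_test m J \<eta> \<and> (\<integral>\<^sup>+v. ennreal ((\<eta> v - (f (restrict v J) + g (restrict v J)))\<^sup>2) \<partial>F) < ennreal \<epsilon>"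
    using cyl_test_add[OF \<eta>(1,2)] by (intro exI[of _ "\<lambda>v. \<eta>1 v + \<eta>2 v"]) (simp add: algebra_simps)
qed

lemma approximable_cmult:
  assumes "approximable m J F f" "f \<in> borel_measurable (pborel J)"
  shows "approximable m J F (\<lambda>v. c * f v)"
  unfolding approximable_def
proof (intro allI impI)
  fix \<epsilon> :: real assume "\<epsilon> > 0"
  \<comment> \<open>Dividing by \<open>c\<^sup>2 + 1\<close> instead of \<open>c\<^sup>2\<close>
    covers the case \<open>c = 0\<close>.\<close>
  then have "\<epsilon> / (c\<^sup>2 + 1) > 0" by (simp add: add_nonneg_pos)
  then obtain \<eta> where \<eta>: "cyl_test m J \<eta>"
    "(\<integral>\<^sup>+v. ennreal ((\<eta> v - f (restrict v J))\<^sup>2) \<partial>F) < ennreal (\<epsilon> / (c\<^sup>2 + 1))"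
    using assms(1) unfolding approximable_def by blast
  have "(\<integral>\<^sup>+v. ennreal ((c * \<eta> v - c * f (restrict v J))\<^sup>2) \<partial>F)
      = (\<integral>\<^sup>+v. ennreal (c\<^sup>2) * ennreal ((\<eta> v - f (restrict v J))\<^sup>2) \<partial>F)"
    by (intro nn_integral_cong) (simp add: ennreal_mult[symmetric] power_mult_distrib[symmetric] right_diff_distrib)
  also have "\<dots> = ennreal (c\<^sup>2) * (\<integral>\<^sup>+v. ennreal ((\<eta> v - f (restrict v J))\<^sup>2) \<partial>F)"
    using \<eta>(1) assms(2) measurable_cyl_test[of \<eta>] measurable_restrict_F[of f] by (intro nn_integral_cmult) auto
  also have "\<dots> \<le> ennreal (c\<^sup>2) * ennreal (\<epsilon> / (c\<^sup>2 + 1))"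
    using \<eta>(2) by (intro mult_left_mono) auto
  also have "\<dots> = ennreal (c\<^sup>2 * (\<epsilon> / (c\<^sup>2 + 1)))"
    by (rule ennreal_mult[symmetric]) (use \<open>\<epsilon> > 0\<close> in auto)
  also have "\<dots> < ennreal \<epsilon>"
  proof (rule ennreal_lessI[OF \<open>\<epsilon> > 0\<close>])
    have "0 < c\<^sup>2 + 1" by (simp add: add_nonneg_pos)
    then show "c\<^sup>2 * (\<epsilon> / (c\<^sup>2 + 1)) < \<epsilon>" using \<open>\<epsilon> > 0\<close> by (simp add: field_simps)
  qed
  finally show "\<exists>\<eta>. cyl_test m J \<eta> \<and> (\<integral>\<^sup>+v. ennreal ((\<eta> v - c * f (restrict v J))\<^sup>2) \<partial>F) < ennreal \<epsilon>"
    using cyl_test_cmult[OF \<eta>(1), of c] by blast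
qed

text \<open>A uniform bound and the finiteness of \<open>F\<close> give convergence in L2 by
  dominated convergence; then a single late member of the sequence is approximated.\<close>

lemma approximable_lim:
  assumes "\<And>n. approximable m J F (f n)" "\<And>n. f n \<in> borel_measurable (pborel J)"
    and g: "g \<in> borel_measurable (pborel J)"
    and B: "\<And>n w. w \<in> space (pborel J) \<Longrightarrow> \<bar>f n w\<bar> \<le> B"
    and lim: "\<And>w. w \<in> space (pborel J) \<Longrightarrow> (\<lambda>n. f n w) \<longlonglongrightarrow> g w"
  shows "approximable m J F g"
  unfolding approximable_def
proof (intro allI impI)
  fix \<epsilon> :: real assume "\<epsilon> > 0"
  have gB: "\<bar>g w\<bar> \<le> B" if "w \<in> space (pborel J)" for w
    by (rule LIMSEQ_le_const2[OF tendsto_rabs[OF lim[OF that]]]) (use B that in auto)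
  have "(\<lambda>n. \<integral>\<^sup>+v. ennreal ((f n (restrict v J) - g (restrict v J))\<^sup>2) \<partial>F) \<longlonglongrightarrow> (\<integral>\<^sup>+v. ennreal 0 \<partial>F)"
  proof (rule nn_integral_dominated_convergence[where w = "\<lambda>_. ennreal ((2 * B)\<^sup>2)"])
    show "(\<integral>\<^sup>+x. ennreal ((2 * B)\<^sup>2) \<partial>F) < \<infinity>"
      using finite_measure.emeasure_finite[OF F(1)] by (simp add: ennreal_mult_less_top top.not_eq_extremum)
    show "AE v in F. ennreal ((f n (restrict v J) - g (restrict v J))\<^sup>2) \<le> ennreal ((2 * B)\<^sup>2)" for n
    proof (intro AE_I2 ennreal_leI)
      fix v
      have "\<bar>f n (restrict v J) - g (restrict v J)\<bar> \<le> \<bar>2 * B\<bar>"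
        using B[OF restrict_in_space, of n v] gB[OF restrict_in_space, of v] by linarith
      then show "(f n (restrict v J) - g (restrict v J))\<^sup>2 \<le> (2 * B)\<^sup>2"
        by (simp only: abs_le_square_iff)
    qed
    show "AE v in F. (\<lambda>n. ennreal ((f n (restrict v J) - g (restrict v J))\<^sup>2)) \<longlonglongrightarrow> ennreal 0"
    proof (intro AE_I2 tendsto_ennrealI)
      fix v
      have "(\<lambda>n. (f n (restrict v J) - g (restrict v J))\<^sup>2) \<longlonglongrightarrow> (g (restrict v J) - g (restrict v J))\<^sup>2"
        by (intro tendsto_intros lim restrict_in_space)
      then show "(\<lambda>n. (f n (restrict v J) - g (restrict v J))\<^sup>2) \<longlonglongrightarrow> 0" by simp
    qed
    show "(\<lambda>v. ennreal ((f n (restrict v J) - g (restrict v J))\<^sup>2)) \<in> borel_measurable F" for n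
      by (intro measurable_compose[OF _ measurable_ennreal] borel_measurable_power borel_measurable_diff
          measurable_restrict_F assms(2) g)
  qed auto
  then have "eventually (\<lambda>n. (\<integral>\<^sup>+v. ennreal ((f n (restrict v J) - g (restrict v J))\<^sup>2) \<partial>F) < ennreal (\<epsilon> / 8)) sequentially"
    by (rule order_tendstoD) (use \<open>\<epsilon> > 0\<close> in auto)
  then obtain n where n: "(\<integral>\<^sup>+v. ennreal ((f n (restrict v J) - g (restrict v J))\<^sup>2) \<partial>F) < ennreal (\<epsilon> / 8)"
    by (auto simp: eventually_sequentially)
  obtain \<eta> where \<eta>: "cyl_test m J \<eta>" "(\<integral>\<^sup>+v. ennreal ((\<eta> v - f n (restrict v J))\<^sup>2) \<partial>F) < ennreal (\<epsilon> / 8)"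
    using assms(1)[of n] \<open>\<epsilon> > 0\<close> unfolding approximable_def by (meson divide_pos_pos zero_less_numeral)
  have "(\<integral>\<^sup>+v. ennreal (((\<eta> v - f n (restrict v J)) + (f n (restrict v J) - g (restrict v J)))\<^sup>2) \<partial>F) < ennreal \<epsilon>"
    using \<eta> n \<open>\<epsilon> > 0\<close> assms(2) g
    by (intro nn_integral_sq_add_less borel_measurable_diff measurable_cyl_test measurable_restrict_F) auto
  then show "\<exists>\<eta>. cyl_test m J \<eta> \<and> (\<integral>\<^sup>+v. ennreal ((\<eta> v - g (restrict v J))\<^sup>2) \<partial>F) < ennreal \<epsilon>"
    using \<eta>(1) by (intro exI[of _ \<eta>]) simp
qed

lemma approximable_box:
  "approximable m J F (\<lambda>w. if \<forall>i\<in>J. w i \<in> box (l i) (u i) then 1 else 0)"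
proof (cases "\<exists>i\<in>J. box (l i) (u i) = {}")
  \<comment> \<open>Bumps require ordered corners, so empty boxes are treated as the zero
    function.\<close>
  case True
  have "cyl_test m J (\<lambda>_. 0)" by (rule cyl_test_zero)
  moreover have "(\<lambda>w. if \<forall>i\<in>J. w i \<in> box (l i) (u i) then 1 else 0) = (\<lambda>_. 0 :: real)" using True by fastforce
  ultimately show ?thesis using approximable_cyl[of "\<lambda>_. 0"] by (simp only:)
next
  case False
  then have lu: "l i \<bullet> e \<le> u i \<bullet> e" if "i \<in> J" "e \<in> Basis" for i e
    using that box_ne_empty(2)[of "l i" "u i"] by (auto intro: less_imp_le)
  have finJ: "finite J" using J finite_subset by auto
  have cyl: "cyl_test m J (box_bump J l u (1 / real (Suc n)))" for n
    using finJ lu m by (intro cyl_test_box_bump) auto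
  have meas: "box_bump J l u (1 / real (Suc n)) \<in> borel_measurable (pborel J)" for n
  proof -
    have "(\<lambda>t. bump (1 / real (Suc n)) a b t) \<in> borel_measurable borel" for a b
      unfolding bump_def pos_cube_def by measurable
    then have "(\<lambda>v. bump (1 / real (Suc n)) (l i \<bullet> e) (u i \<bullet> e) (v i \<bullet> e)) \<in> borel_measurable (pborel J)"
      if "i \<in> J" for i e
      using that by (intro measurable_compose[OF _ \<open>\<And>a b. (\<lambda>t. bump (1 / real (Suc n)) a b t) \<in> borel_measurable borel\<close>]) measurable
    then show ?thesis unfolding box_bump_def[abs_def] by measurable
  qed
  show ?thesis
  proof (rule approximable_lim[where f = "\<lambda>n. box_bump J l u (1 / real (Suc n))" and B = 1])
    show "(\<lambda>w. if \<forall>i\<in>J. w i \<in> box (l i) (u i) then 1 else (0::real)) \<in> borel_measurable (pborel J)"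
      by (rule borel_measurable_LIMSEQ_real[OF _ meas]) (rule box_bump_tendsto[OF finJ lu])
    show "\<bar>box_bump J l u (1 / real (Suc n)) w\<bar> \<le> 1" for n w
      using box_bump_bounds[of "1 / real (Suc n)" J l u w] by simp
  qed (use approximable_cyl[OF cyl] meas box_bump_tendsto[OF finJ lu] in auto)
qed

text \<open>Boxes in all coordinates at once generate because \<open>J\<close> is finite and each
  factor is a countable union of boxes. The result is a generator whose indicators are limits of
  \<open>box_bump\<close>.\<close>

lemma sets_pborel_boxes:
  "sets (pborel J) = sigma_sets (space (pborel J))
     (range (\<lambda>(l, u). {w \<in> space (pborel J). \<forall>i\<in>J. w i \<in> box (l i) (u i)}))"
proof -
  have finJ: "finite J" using J finite_subset by auto
  let ?E = "\<lambda>_::nat. range (\<lambda>(a, b). box a b :: (real^3) set)"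
  let ?P = "{{f \<in> (\<Pi>\<^sub>E i\<in>J. UNIV). \<forall>i\<in>j. f i \<in> A i} | A j. j \<in> {J} \<and> A \<in> Pi j ?E}"
  have "sets (pborel J) = sets (Pi\<^sub>M J (\<lambda>_. sigma UNIV (range (\<lambda>(a, b). box a b :: (real^3) set))))"
    unfolding borel_eq_box[symmetric] ..
  also have "\<dots> = sets (sigma (\<Pi>\<^sub>E i\<in>J. UNIV) ?P)"
  proof (rule sets_PiM_sigma)
    show "\<exists>S\<subseteq>?E i. countable S \<and> UNIV = \<Union>S" for i :: nat
    proof (intro exI conjI)
      show "range (\<lambda>n::nat. box (\<Sum>e\<in>Basis. (- real n) *\<^sub>R e) (\<Sum>e\<in>Basis. real n *\<^sub>R e)) \<subseteq> ?E i" by auto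
      show "UNIV = \<Union>(range (\<lambda>n::nat. box (\<Sum>e\<in>Basis. (- real n) *\<^sub>R e) (\<Sum>e\<in>Basis. real n *\<^sub>R e :: real^3)))"
      proof (intro set_eqI iffI UNIV_I)
        fix x :: "real^3"
        obtain n :: nat where n: "norm x < real n" using reals_Archimedean2 by blast
        have "x \<in> box (\<Sum>e\<in>Basis. (- real n) *\<^sub>R e) (\<Sum>e\<in>Basis. real n *\<^sub>R e)"
          unfolding mem_box
        proof
          fix e :: "real^3" assume e: "e \<in> Basis"
          have "\<bar>x \<bullet> e\<bar> < real n" using Basis_le_norm[OF e, of x] n by linarith
          then show "(\<Sum>e\<in>Basis. (- real n) *\<^sub>R e) \<bullet> e < x \<bullet> e \<and> x \<bullet> e < (\<Sum>e\<in>Basis. real n *\<^sub>R e) \<bullet> e"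
            using e by (simp add: inner_sum_left_Basis sum_negf) (auto simp: inner_sum_left_Basis abs_less_iff)
        qed
        then show "x \<in> \<Union>(range (\<lambda>n::nat. box (\<Sum>e\<in>Basis. (- real n) *\<^sub>R e) (\<Sum>e\<in>Basis. real n *\<^sub>R e)))" by blast
      qed
    qed auto
  qed (use finJ in auto)
  also have "\<dots> = sigma_sets (\<Pi>\<^sub>E i\<in>J. UNIV) ?P"
    by (rule sets_measure_of) auto
  also have "?P = range (\<lambda>(l, u). {w \<in> space (pborel J). \<forall>i\<in>J. w i \<in> box (l i) (u i)})" (is "_ = ?R")
  proof (intro set_eqI iffI)
    fix X assume "X \<in> ?P"
    then obtain A where A: "X = {f \<in> (\<Pi>\<^sub>E i\<in>J. UNIV). \<forall>i\<in>J. f i \<in> A i}" "A \<in> Pi J ?E" by auto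
    then have "\<forall>i. \<exists>a b. i \<in> J \<longrightarrow> A i = box a b" by (fastforce simp: Pi_iff)
    then obtain l u where lu: "\<And>i. i \<in> J \<Longrightarrow> A i = box (l i) (u i)" by metis
    then show "X \<in> ?R" unfolding A(1) by (intro image_eqI[of _ _ "(l, u)"]) (auto simp: space_PiM)
  next
    fix X assume "X \<in> ?R"
    then obtain l u where "X = {w \<in> space (pborel J). \<forall>i\<in>J. w i \<in> box (l i) (u i)}" by auto
    then show "X \<in> ?P"
      by (intro CollectI exI[of _ "\<lambda>i. box (l i) (u i)"] exI[of _ J]) (auto simp: space_PiM)
  qed
  finally show ?thesis by (simp add: space_PiM)
qed

text \<open>The whole space is reached as a limit of growing boxes; it is the set from which
  complements will be subtracted.\<close>

lemma approximable_space: "approximable m J F (indicator (space (pborel J)))"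
proof -
  have meas: "(\<lambda>w. if \<forall>i\<in>J. w i \<in> box (\<Sum>e\<in>Basis. (- real n) *\<^sub>R e) (\<Sum>e\<in>Basis. real n *\<^sub>R e) then 1 else (0::real))
     \<in> borel_measurable (pborel J)" for n :: nat
  proof -
    have "{w \<in> space (pborel J). \<forall>i\<in>J. w i \<in> box (\<Sum>e\<in>Basis. (- real n) *\<^sub>R e) (\<Sum>e\<in>Basis. real n *\<^sub>R e)} \<in> sets (pborel J)"
      unfolding sets_pborel_boxes
      by (rule sigma_sets.Basic, rule image_eqI[of _ _ "(\<lambda>_. \<Sum>e\<in>Basis. (- real n) *\<^sub>R e, \<lambda>_. \<Sum>e\<in>Basis. real n *\<^sub>R e)"]) auto
    then show ?thesis by (intro measurable_If) auto
  qed
  show ?thesis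
  proof (rule approximable_lim[where B = 1])
    fix w assume w: "w \<in> space (pborel J)"
    have finJ: "finite J" using J finite_subset by auto
    obtain n0 :: nat where n0: "(\<Sum>i\<in>J. norm (w i)) < real n0" using reals_Archimedean2 by blast
    have "w i \<in> box (\<Sum>e\<in>Basis. (- real n) *\<^sub>R e) (\<Sum>e\<in>Basis. real n *\<^sub>R e)" if "n \<ge> n0" "i \<in> J" for n i
      unfolding mem_box
    proof
      fix e :: "real^3" assume e: "e \<in> Basis"
      have "norm (w i) \<le> (\<Sum>i\<in>J. norm (w i))" by (rule member_le_sum) (use that finJ in auto)
      then have "\<bar>w i \<bullet> e\<bar> < real n" using Basis_le_norm[OF e, of "w i"] n0 that by linarith
      then show "(\<Sum>e\<in>Basis. (- real n) *\<^sub>R e) \<bullet> e < w i \<bullet> e \<and> w i \<bullet> e < (\<Sum>e\<in>Basis. real n *\<^sub>R e) \<bullet> e"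
        using e by (simp add: inner_sum_left_Basis sum_negf) (auto simp: inner_sum_left_Basis abs_less_iff)
    qed
    then show "(\<lambda>n. if \<forall>i\<in>J. w i \<in> box (\<Sum>e\<in>Basis. (- real n) *\<^sub>R e) (\<Sum>e\<in>Basis. real n *\<^sub>R e) then 1 else 0)
       \<longlonglongrightarrow> (indicator (space (pborel J)) w :: real)"
      using w by (intro tendsto_eventually) (auto simp: eventually_sequentially)
  qed (use meas approximable_box in auto)
qed

text \<open>Dynkin's argument: boxes are stable under intersection, complements are differences with
  the whole space, and partial sums over a disjoint family stay between 0 and 1, so that
  \<open>approximable_lim\<close> applies.\<close>

lemma approximable_indicator:
  assumes "A \<in> sets (pborel J)"
  shows "approximable m J F (indicator A)"
proof -
  let ?G = "range (\<lambda>(l, u). {w \<in> space (pborel J). \<forall>i\<in>J. w i \<in> box (l i) (u i)})"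
  have G: "?G \<subseteq> Pow (space (pborel J))" by auto
  have "Int_stable ?G"
  proof (rule Int_stableI_image; clarify)
    fix l u l' u' :: "nat \<Rightarrow> real^3"
    \<comment> \<open>The intersection is the box with the coordinatewise larger lower corner and
      smaller upper corner.\<close>
    have "\<exists>c. \<forall>i. box (l i) (u i) \<inter> box (l' i) (u' i) = box (fst (c i)) (snd (c i))"
      unfolding box_Int_box
      by (rule exI[of _ "\<lambda>i. (\<Sum>e\<in>Basis. max (l i \<bullet> e) (l' i \<bullet> e) *\<^sub>R e, \<Sum>e\<in>Basis. min (u i \<bullet> e) (u' i \<bullet> e) *\<^sub>R e)"]) simp
    then obtain c where c: "\<And>i. box (l i) (u i) \<inter> box (l' i) (u' i) = box (fst (c i)) (snd (c i))" by blast
    have "\<And>i x. x \<in> box (l i) (u i) \<and> x \<in> box (l' i) (u' i) \<longleftrightarrow> x \<in> box (fst (c i)) (snd (c i))"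
      using c by blast
    then show "\<exists>k\<in>UNIV. {w \<in> space (pborel J). \<forall>i\<in>J. w i \<in> box (l i) (u i)} \<inter>
         {w \<in> space (pborel J). \<forall>i\<in>J. w i \<in> box (l' i) (u' i)} =
       (case k of (l, u) \<Rightarrow> {w \<in> space (pborel J). \<forall>i\<in>J. w i \<in> box (l i) (u i)})"
      by (intro bexI[of _ "(\<lambda>i. fst (c i), \<lambda>i. snd (c i))"]) auto
  qed
  from this G assms[unfolded sets_pborel_boxes] show ?thesis
  proof (induction rule: sigma_sets_induct_disjoint)
    case (basic A)
    then obtain l u where A: "A = {w \<in> space (pborel J). \<forall>i\<in>J. w i \<in> box (l i) (u i)}" by auto
    have "approximable m J F (indicator A) \<longleftrightarrow> approximable m J F (\<lambda>w. if \<forall>i\<in>J. w i \<in> box (l i) (u i) then 1 else 0)"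
      unfolding A by (rule approximable_cong) (simp add: indicator_def)
    then show ?case using approximable_box by simp
  next
    case empty
    have "cyl_test m J (\<lambda>_. 0)" by (rule cyl_test_zero)
    then show ?case using approximable_cyl by (simp add: indicator_def[abs_def])
  next
    case (compl A)
    then have A: "A \<in> sets (pborel J)" by (simp add: sets_pborel_boxes)
    have "approximable m J F (\<lambda>w. indicator (space (pborel J)) w + (- 1) * indicator A w)"
      using A by (intro approximable_add approximable_cmult approximable_space compl.IH) auto
    moreover have "(\<lambda>w. indicator (space (pborel J)) w + (- 1) * indicator A w) = (indicator (space (pborel J) - A) :: _ \<Rightarrow> real)"
      using sets.sets_into_space[OF A] by (auto simp: indicator_def fun_eq_iff)
    ultimately show ?case by simp
  next
    case (union A)
    then have A: "A i \<in> sets (pborel J)" for i by (auto simp: sets_pborel_boxes)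
    have 1: "approximable m J F (\<lambda>w. \<Sum>i<n. indicator (A i) w)" for n
    proof (induction n)
      case 0
      have "cyl_test m J (\<lambda>_. 0)" by (rule cyl_test_zero)
      then show ?case using approximable_cyl by simp
    next
      case (Suc n)
      have "approximable m J F (\<lambda>w. (\<Sum>i<n. indicator (A i) w) + indicator (A n) w)"
        using A by (intro approximable_add Suc union.IH) auto
      then show ?case by simp
    qed
    have eq: "(\<Sum>i<n. indicator (A i) w) = (indicator (\<Union>i<n. A i) w :: real)" for n w
      using union.hyps(1) by (subst indicator_UN_disjoint) (auto simp: disjoint_family_on_def)
    show ?case
    proof (rule approximable_lim[OF 1, where B = 1])
      show "(\<lambda>n. \<Sum>i<n. indicator (A i) w) \<longlonglongrightarrow> (indicator (\<Union>i. A i) w :: real)" for w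
        unfolding eq by (rule LIMSEQ_indicator_UN)
      show "\<bar>\<Sum>i<n. indicator (A i) w :: real\<bar> \<le> 1" for n w
        unfolding eq by (simp add: indicator_def)
    qed (use A in auto)
  qed
qed

lemma approximable_nonneg:
  assumes "f \<in> borel_measurable (pborel J)" "\<And>w. 0 \<le> f w"
    and "\<And>w. w \<in> space (pborel J) \<Longrightarrow> f w \<le> B"
  shows "approximable m J F f"
proof -
  \<comment> \<open>Boundedness is kept as an implication inside the induction, since every stage
    must derive bounds for its own parts.\<close>
  have "(\<exists>B. \<forall>w\<in>space (pborel J). f w \<le> B) \<longrightarrow> approximable m J F f"
    using assms(1,2)
  proof (induction rule: borel_measurable_induct_real)
    case (set A)
    then show ?case using approximable_indicator by blast
  next
    case (mult u c)
    show ?case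
    proof
      assume "\<exists>B. \<forall>w\<in>space (pborel J). c * u w \<le> B"
      then obtain B where B: "\<And>w. w \<in> space (pborel J) \<Longrightarrow> c * u w \<le> B" by blast
      show "approximable m J F (\<lambda>w. c * u w)"
      \<comment> \<open>For \<open>c = 0\<close> a bound on \<open>c * u\<close> says nothing about
        \<open>u\<close>.\<close>
      proof (cases "c = 0")
        case True
        have "cyl_test m J (\<lambda>_. 0)" by (rule cyl_test_zero)
        then show ?thesis using approximable_cyl True by simp
      next
        case False
        have "u w \<le> B / c" if "w \<in> space (pborel J)" for w
          using B[OF that] mult(1) False by (simp add: field_simps)
        then have "approximable m J F u" using mult.IH by blast
        then show ?thesis using mult by (intro approximable_cmult) auto
      qed
    qed
  next
    case (add u v)
    show ?case
    proof
      assume "\<exists>B. \<forall>w\<in>space (pborel J). v w + u w \<le> B"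
      then obtain B where B: "\<And>w. w \<in> space (pborel J) \<Longrightarrow> v w + u w \<le> B" by blast
      have uv: "u w \<le> B" "v w \<le> B" if "w \<in> space (pborel J)" for w
        using B[OF that] add(2)[of w] add(4)[of w] by linarith+
      have "approximable m J F u" "approximable m J F v" using uv add.IH by blast+
      then show "approximable m J F (\<lambda>w. v w + u w)" using add by (intro approximable_add) auto
    qed
  next
    case (seq U)
    show ?case
    proof
      assume "\<exists>B. \<forall>w\<in>space (pborel J). f w \<le> B"
      then obtain B where B: "\<And>w. w \<in> space (pborel J) \<Longrightarrow> f w \<le> B" by blast
      have U: "U i w \<le> B" if "w \<in> space (pborel J)" for i w
      proof -
        have "incseq (\<lambda>i. U i w)" using seq(3) by (auto simp: incseq_def le_fun_def)
        then show ?thesis using incseq_le[OF _ seq(4)[OF that], of i] B[OF that] by linarith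
      qed
      have "approximable m J F (U i)" for i using U seq.IH by blast
      then show "approximable m J F f"
        by (rule approximable_lim[where f = U and B = B]) (use U seq.hyps assms(1) in \<open>auto simp: abs_of_nonneg\<close>)
    qed
  qed
  then show ?thesis using assms(3) by blast
qed

lemma approximable_bounded:
  assumes "f \<in> borel_measurable (pborel J)" "\<And>w. w \<in> space (pborel J) \<Longrightarrow> \<bar>f w\<bar> \<le> B"
  shows "approximable m J F f"
proof -
  have "approximable m J F (\<lambda>w. max 0 (f w) + (- 1) * max 0 (- f w))"
    using assms by (intro approximable_add approximable_cmult approximable_nonneg[where B = "\<bar>B\<bar>"]) fastforce+
  moreover have "(\<lambda>w. max 0 (f w) + (- 1) * max 0 (- f w)) = f" by (auto simp: max_def)
  ultimately show ?thesis by simp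
qed

end

section \<open>Integration by parts\<close>

interpretation lborel_product: product_sigma_finite "\<lambda>_::nat. lborel :: (real^3) measure"
  by standard

lemma measurable_cfg_leb: "f \<in> borel_measurable (pborel {..<N}) \<Longrightarrow> f \<in> borel_measurable (cfg_leb N)"
  by (subst measurable_cong_sets[OF sets_cfg_leb refl])

lemma cfg_box_sets: "cfg_box N R \<in> sets (cfg_leb N)"
proof -
  have "cfg_box N R = (\<Pi>\<^sub>E i\<in>{..<N}. cball 0 R)" by (simp add: cfg_box_def)
  also have "\<dots> \<in> sets (Pi\<^sub>M {..<N} (\<lambda>_. lborel))" by (rule sets_PiM_I_finite) auto
  finally show ?thesis by (simp add: cfg_leb_def)
qed

lemma emeasure_cfg_box: "emeasure (cfg_leb N) (cfg_box N R) < \<infinity>"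
proof -
  have "emeasure (cfg_leb N) (cfg_box N R) = (\<Prod>i<N. emeasure lborel (cball (0::real^3) R))"
    unfolding cfg_leb_def cfg_box_def by (rule lborel_product.emeasure_PiM) auto
  also have "\<dots> < \<infinity>"
    using emeasure_bounded_finite[OF bounded_cball[of "0::real^3" R]] by (simp add: power_less_top_ennreal)
  finally show ?thesis .
qed

lemma integrable_supported:
  assumes "f \<in> borel_measurable (cfg_leb N)" "supported N R f" "\<And>v. v \<in> cfgs N \<Longrightarrow> \<bar>f v\<bar> \<le> B"
  shows "integrable (cfg_leb N) f"
proof (rule Bochner_Integration.integrable_bound)
  show "integrable (cfg_leb N) (\<lambda>v. B * indicator (cfg_box N R) v)"
    using emeasure_cfg_box by (intro integrable_mult_right integrable_real_indicator cfg_box_sets) auto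
  show "AE v in cfg_leb N. norm (f v) \<le> norm (B * indicator (cfg_box N R) v)"
  proof (rule AE_I2)
    fix v assume "v \<in> space (cfg_leb N)"
    then show "norm (f v) \<le> norm (B * indicator (cfg_box N R) v)"
      using assms(2) assms(3)[of v] by (auto simp: supported_iff_box space_cfg_leb indicator_def)
  qed
qed (rule assms(1))

lemma integrable_cont_supported:
  assumes "continuous_map (cfg_top N) euclideanreal f" "supported N R f"
  shows "integrable (cfg_leb N) f"
proof -
  obtain B where "\<And>v. v \<in> cfgs N \<Longrightarrow> \<bar>f v\<bar> \<le> B" using supported_bounded[OF assms] by blast
  then show ?thesis
    using assms by (intro integrable_supported measurable_cfg_leb measurable_continuous_cfg)
qed

lemma continuous_map_shift:
  "continuous_map (cfg_top N) (cfg_top N) (\<lambda>v. v(i := v i + x))" if "i < N"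
  unfolding cfg_top_def continuous_map_componentwise
proof (intro conjI ballI)
  show "(\<lambda>v. v(i := v i + x)) ` topspace (product_topology (\<lambda>_. euclidean) {..<N}) \<subseteq> extensional {..<N}"
    using that by (auto simp: extensional_def)
  fix j assume j: "j \<in> {..<N}"
  have p: "continuous_map (product_topology (\<lambda>_. euclidean) {..<N}) euclidean (\<lambda>v. v j)"
    by (rule continuous_map_product_projection) (use j in auto)
  have "continuous_map (product_topology (\<lambda>_. euclidean) {..<N}) euclidean (\<lambda>v. v j + x)"
    using continuous_map_compose[OF p, of euclidean "\<lambda>y. y + x"]
    by (simp add: o_def continuous_intros)
  with p show "continuous_map (product_topology (\<lambda>_. euclidean) {..<N}) euclidean (\<lambda>v. (v(i := v i + x)) j)"
    by (cases "j = i") auto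
qed

lemma supported_shift:
  assumes "supported N R h" "i < N"
  shows "supported N (R + norm x) (\<lambda>v. h (v(i := v i + x)))"
  unfolding supported_def
proof safe
  fix v j assume v: "v \<in> cfgs N" "j < N" "R + norm x < norm (v j)"
  have "norm (v i) - norm x \<le> norm (v i + x)" using norm_diff_ineq by blast
  then have "R < norm ((v(i := v i + x)) j)"
  proof (cases "j = i")
    case True then show ?thesis using v(3) \<open>norm (v i) - norm x \<le> norm (v i + x)\<close> by simp
  next
    case False
    then have "(v(i := v i + x)) j = v j" by simp
    moreover have "R < norm (v j)" using v(3) norm_ge_zero[of x] by linarith
    ultimately show ?thesis by (simp only:)
  qed
  then show "h (v(i := v i + x)) = 0"
    using assms cfgs_upd[OF v(1) assms(2)] v(2) unfolding supported_def by blast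
qed

text \<open>Fubini isolates the variable with index \<open>i\<close>, and Lebesgue measure on
  \<open>real^3\<close> is invariant under translation.\<close>

lemma integral_shift:
  assumes h: "continuous_map (cfg_top N) euclideanreal h" "supported N R h" and i: "i < N"
  shows "(\<integral>v. h (v(i := v i + x)) \<partial>cfg_leb N) = (\<integral>v. h v \<partial>cfg_leb N)"
proof -
  have eq: "cfg_leb N = Pi\<^sub>M (insert i ({..<N} - {i})) (\<lambda>_. lborel)"
    using i by (simp add: cfg_leb_def insert_absorb)
  have "continuous_map (cfg_top N) euclideanreal (\<lambda>v. h (v(i := v i + x)))"
    using continuous_map_compose[OF continuous_map_shift[OF i] h(1)] by (simp add: o_def)
  from integrable_cont_supported[OF this supported_shift[OF h(2) i]]
  have int: "integrable (cfg_leb N) (\<lambda>v. h (v(i := v i + x)))" .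
  have "(\<integral>v. h (v(i := v i + x)) \<partial>cfg_leb N)
      = (\<integral>v. (\<integral>y. h ((v(i := y))(i := (v(i := y)) i + x)) \<partial>lborel) \<partial>Pi\<^sub>M ({..<N} - {i}) (\<lambda>_. lborel))"
    unfolding eq using int eq by (subst lborel_product.product_integral_insert) auto
  also have "\<dots> = (\<integral>v. (\<integral>y. h (v(i := y)) \<partial>lborel) \<partial>Pi\<^sub>M ({..<N} - {i}) (\<lambda>_. lborel))"
  proof (rule Bochner_Integration.integral_cong[OF refl])
    fix v assume v: "v \<in> space (Pi\<^sub>M ({..<N} - {i}) (\<lambda>_. lborel :: (real^3) measure))"
    have hm: "h \<in> borel_measurable (Pi\<^sub>M (insert i ({..<N} - {i})) (\<lambda>_. lborel))"
      using measurable_cfg_leb[OF measurable_continuous_cfg[OF h(1)]] eq by simp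
    have m: "(\<lambda>y. h (v(i := y))) \<in> borel_measurable lborel"
      by (rule measurable_compose[OF measurable_component_update hm]) (use v in auto)
    have "(\<integral>y. h (v(i := y)) \<partial>lborel) = (\<integral>y. h (v(i := y)) \<partial>distr lborel borel ((+) x))"
      by (simp add: lborel_distr_plus)
    also have "\<dots> = (\<integral>y. h (v(i := x + y)) \<partial>lborel)"
      using m by (subst integral_distr) auto
    finally show "(\<integral>y. h ((v(i := y))(i := (v(i := y)) i + x)) \<partial>lborel) = (\<integral>y. h (v(i := y)) \<partial>lborel)"
      by (simp add: add.commute)
  qed
  also have "\<dots> = (\<integral>v. h v \<partial>cfg_leb N)"
    unfolding eq using integrable_cont_supported[OF h] eq by (subst lborel_product.product_integral_insert) auto
  finally show ?thesis .
qed

text \<open>Translation invariance makes every difference quotient integrate to 0, and the quotients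
  converge to the derivative while staying bounded and supported in one box.\<close>

lemma integral_pderiv_at_eq_0:
  assumes h: "C_diff 1 N h" "supported N R h" and i: "i < N" and e: "e \<in> Basis"
  shows "(\<integral>v. pderiv_at i e h v \<partial>cfg_leb N) = 0"
proof -
  have h': "C_diff (Suc 0) N h" using h by simp
  have hc: "continuous_map (cfg_top N) euclideanreal h" by (rule C_diff_cont[OF h(1)])
  have pc: "continuous_map (cfg_top N) euclideanreal (pderiv_at i e h)"
    using C_diff_pderiv[OF h' i e] by simp
  obtain B where B: "0 \<le> B" "\<And>v. v \<in> cfgs N \<Longrightarrow> \<bar>pderiv_at i e h v\<bar> \<le> B"
    using supported_bounded[OF pc supported_pderiv_at[OF h(2) i]] by blast
  define s where "s = (\<lambda>n v. v(i := v i + (1 / real (Suc n)) *\<^sub>R e) :: config)"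
  define q where "q = (\<lambda>n v. (h (s n v) - h v) * real (Suc n))"
  have sc: "continuous_map (cfg_top N) euclideanreal (\<lambda>v. h (s n v))" for n
    using continuous_map_compose[OF continuous_map_shift[OF i] hc] by (simp add: o_def s_def)
  have ss: "supported N (R + norm ((1 / real (Suc n)) *\<^sub>R e)) (\<lambda>v. h (s n v))" for n
    unfolding s_def by (rule supported_shift[OF h(2) i])
  have int_q: "(\<integral>v. q n v \<partial>cfg_leb N) = 0" for n
    using integral_shift[OF hc h(2) i, of "(1 / real (Suc n)) *\<^sub>R e"]
      integrable_cont_supported[OF sc ss] integrable_cont_supported[OF hc h(2)]
    by (simp add: q_def s_def)
  have bound: "\<bar>q n v\<bar> \<le> B * indicator (cfg_box N (\<bar>R\<bar> + 1)) v" if v: "v \<in> cfgs N" for n v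
  proof -
    \<comment> \<open>By the mean value theorem the quotient is a value of the partial derivative,
      hence bounded by \<open>B\<close>.\<close>
    have "\<exists>z::real. 0 < z \<and> z < 1 / real (Suc n) \<and> h (v(i := v i + (1 / real (Suc n)) *\<^sub>R e)) - h (v(i := v i + 0 *\<^sub>R e))
        = (1 / real (Suc n) - 0) * pderiv_at i e h (v(i := v i + z *\<^sub>R e))"
    proof (rule MVT2)
      show "((\<lambda>t. h (v(i := v i + t *\<^sub>R e))) has_real_derivative pderiv_at i e h (v(i := v i + z *\<^sub>R e))) (at z)" for z
        by (rule C_diff_DERIV_line[OF h' v i e])
    qed simp
    then obtain z where "h (s n v) - h v = 1 / real (Suc n) * pderiv_at i e h (v(i := v i + z *\<^sub>R e))"
      by (auto simp: s_def)
    then have "q n v = pderiv_at i e h (v(i := v i + z *\<^sub>R e))" by (simp add: q_def field_simps)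
    then have 1: "\<bar>q n v\<bar> \<le> B" using B(2)[OF cfgs_upd[OF v i]] by simp
    \<comment> \<open>Shifts have length at most 1, so one enlarged box contains the supports of all
      quotients.\<close>
    have nle: "norm ((1 / real (Suc n)) *\<^sub>R e) \<le> 1" using e by (simp add: divide_le_eq)
    have "q n v = 0" if "v \<notin> cfg_box N (\<bar>R\<bar> + 1)"
    proof -
      have "supported N (\<bar>R\<bar> + 1) (\<lambda>v. h (s n v))" "supported N (\<bar>R\<bar> + 1) h"
        using nle by (auto intro!: supported_mono[OF ss[of n]] supported_mono[OF h(2)] simp del: norm_scaleR of_nat_Suc)
      then show ?thesis using that v by (simp add: supported_iff_box q_def)
    qed
    then show ?thesis using 1 B(1) by (auto simp: indicator_def)
  qed
  have "(\<lambda>n. \<integral>v. q n v \<partial>cfg_leb N) \<longlonglongrightarrow> (\<integral>v. pderiv_at i e h v \<partial>cfg_leb N)"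
  proof (rule integral_dominated_convergence[where w = "\<lambda>v. B * indicator (cfg_box N (\<bar>R\<bar> + 1)) v"])
    show "integrable (cfg_leb N) (\<lambda>v. B * indicator (cfg_box N (\<bar>R\<bar> + 1)) v)"
      using emeasure_cfg_box by (intro integrable_mult_right integrable_real_indicator cfg_box_sets) auto
    show "AE v in cfg_leb N. norm (q n v) \<le> B * indicator (cfg_box N (\<bar>R\<bar> + 1)) v" for n
      using bound by (intro AE_I2) (auto simp: space_cfg_leb)
    show "AE v in cfg_leb N. (\<lambda>n. q n v) \<longlonglongrightarrow> pderiv_at i e h v"
    proof (rule AE_I2)
      fix v assume "v \<in> space (cfg_leb N)"
      then have v: "v \<in> cfgs N" by (simp add: space_cfg_leb)
      have "((\<lambda>t. (h (v(i := v i + t *\<^sub>R e)) - h v) / t) \<longlongrightarrow> pderiv_at i e h v) (at 0)"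
        using C_diff_DERIV[OF h' v i e] unfolding DERIV_def by simp
      moreover have "filterlim (\<lambda>n. 1 / real (Suc n)) (at 0) sequentially"
        unfolding filterlim_at using LIMSEQ_Suc[OF lim_1_over_n] by auto
      ultimately have "(\<lambda>n. (h (v(i := v i + (1 / real (Suc n)) *\<^sub>R e)) - h v) / (1 / real (Suc n))) \<longlonglongrightarrow> pderiv_at i e h v"
        by (rule filterlim_compose)
      then show "(\<lambda>n. q n v) \<longlonglongrightarrow> pderiv_at i e h v" by (simp add: q_def s_def)
    qed
    show "q n \<in> borel_measurable (cfg_leb N)" for n
      unfolding q_def[abs_def] using sc[of n] hc
      by (intro borel_measurable_times borel_measurable_diff measurable_cfg_leb measurable_continuous_cfg) auto
    show "pderiv_at i e h \<in> borel_measurable (cfg_leb N)"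
      using pc by (intro measurable_cfg_leb measurable_continuous_cfg)
  qed
  then have "(\<lambda>n. 0) \<longlonglongrightarrow> (\<integral>v. pderiv_at i e h v \<partial>cfg_leb N)" unfolding int_q .
  then show ?thesis using LIMSEQ_unique[OF _ tendsto_const] by metis
qed

lemma supported_mult1: "supported N R f \<Longrightarrow> supported N R (\<lambda>v. f v * g v)"
  and supported_mult2: "supported N R f \<Longrightarrow> supported N R (\<lambda>v. g v * f v)"
  by (auto simp: supported_def)

context
  fixes k N :: nat and b :: "config \<Rightarrow> config"
  assumes b: "smooth_field k b" "divergence_free k b" and k: "k \<le> N"
begin

text \<open>For a divergence-free field the coefficients can be moved inside: the derivation of
  \<open>h\<close> is the sum of the partial derivatives of \<open>h\<close> times the components of
  \<open>b\<close>, and each of these integrates to 0.\<close>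

lemma integral_derivation_eq_0:
  assumes h: "C_diff 1 N h" "supported N R h"
  shows "(\<integral>v. derivation k b h v \<partial>cfg_leb N) = 0"
proof -
  have h': "C_diff (Suc 0) N h" using h by simp
  let ?b = "\<lambda>i e v. b (restrict v {..<k}) i \<bullet> e"
  have Cb: "C_diff (Suc 0) N (?b i e)" if "i < k" "e \<in> Basis" for i e
    using that by (intro C_diff_field[OF b(1) k])
  have eq: "(\<Sum>i<k. \<Sum>e\<in>Basis. pderiv_at i e (\<lambda>v. ?b i e v * h v) v) = derivation k b h v" if v: "v \<in> cfgs N" for v
  proof -
    have "(\<Sum>i<k. \<Sum>e\<in>Basis. pderiv_at i e (\<lambda>v. ?b i e v * h v) v)
      = (\<Sum>i<k. \<Sum>e\<in>Basis. pderiv_at i e (?b i e) v * h v + ?b i e v * pderiv_at i e h v)"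
      by (intro sum.cong refl pderiv_at_mult[OF Cb h' v]) (use k in auto)
    also have "\<dots> = (\<Sum>i<k. \<Sum>e\<in>Basis. pderiv_at i e (?b i e) v) * h v + derivation k b h v"
      by (simp add: sum.distrib sum_distrib_right derivation_def)
    \<comment> \<open>The divergence of the extended field at \<open>v\<close> is that of
      \<open>b\<close> at the restriction, because the extension is constant in the other
      variables.\<close>
    also have "(\<Sum>i<k. \<Sum>e\<in>Basis. pderiv_at i e (?b i e) v)
       = (\<Sum>i<k. \<Sum>e\<in>Basis. pderiv_at i e (\<lambda>w. b w i \<bullet> e) (restrict v {..<k}))"
      unfolding restrict_eq_overlay by (intro sum.cong refl) (simp add: pderiv_at_overlay[where f = "\<lambda>w. b w _ \<bullet> _"])
    also have "\<dots> = 0"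
      using b(2) unfolding divergence_free_def by (auto simp: cfgs_iff)
    finally show ?thesis by (simp only: mult_zero_left add_0)
  qed
  have Ch: "C_diff (Suc 0) N (\<lambda>v. ?b i e v * h v)" if "i < k" "e \<in> Basis" for i e
    using that by (intro C_diff_mult Cb h')
  have sup: "supported N R (\<lambda>v. ?b i e v * h v)" for i e by (rule supported_mult2[OF h(2)])
  have int: "integrable (cfg_leb N) (pderiv_at i e (\<lambda>v. ?b i e v * h v))" if "i < k" "e \<in> Basis" for i e
    using C_diff_pderiv[OF Ch[OF that], of i e] that k
    by (intro integrable_cont_supported[OF _ supported_pderiv_at[OF sup]]) auto
  have "(\<integral>v. derivation k b h v \<partial>cfg_leb N)
      = (\<integral>v. (\<Sum>i<k. \<Sum>e\<in>Basis. pderiv_at i e (\<lambda>v. ?b i e v * h v) v) \<partial>cfg_leb N)"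
    by (intro Bochner_Integration.integral_cong refl eq[symmetric]) (simp add: space_cfg_leb)
  also have "\<dots> = (\<Sum>i<k. \<Sum>e\<in>Basis. (\<integral>v. pderiv_at i e (\<lambda>v. ?b i e v * h v) v \<partial>cfg_leb N))"
    using int by (subst Bochner_Integration.integral_sum) (auto intro!: Bochner_Integration.integrable_sum sum.cong Bochner_Integration.integral_sum)
  also have "\<dots> = 0"
    using integral_pderiv_at_eq_0[OF _ sup] Ch k by (intro sum.neutral ballI) auto
  finally show ?thesis .
qed

text \<open>The derivation of \<open>g * f\<close> has integral 0, and the product rule splits it.
  Only the product needs bounded support, so \<open>f\<close> may be a density.\<close>

lemma integral_by_parts:
  assumes f: "C_diff 1 N f" and g: "C_diff 1 N g" "supported N R g"
  shows "(\<integral>v. derivation k b g v * f v \<partial>cfg_leb N) = - (\<integral>v. g v * derivation k b f v \<partial>cfg_leb N)"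
proof -
  have f': "C_diff (Suc 0) N f" and g': "C_diff (Suc 0) N g" using f g by simp_all
  have c: "continuous_map (cfg_top N) euclideanreal (derivation k b f)" if "C_diff (Suc 0) N f" for f
    using C_diff_derivation[OF b(1) k that] by simp
  have int1: "integrable (cfg_leb N) (\<lambda>v. derivation k b g v * f v)"
    by (rule integrable_cont_supported[OF _ supported_mult1[OF supported_derivation[OF g(2) k]]])
       (intro continuous_map_real_mult c[OF g'] C_diff_cont[OF f])
  have int2: "integrable (cfg_leb N) (\<lambda>v. g v * derivation k b f v)"
    by (rule integrable_cont_supported[OF _ supported_mult1[OF g(2)]])
       (intro continuous_map_real_mult c[OF f'] C_diff_cont[OF g(1)])
  have "(\<integral>v. derivation k b (\<lambda>v. g v * f v) v \<partial>cfg_leb N) = 0"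
    by (rule integral_derivation_eq_0[OF C_diff_mult[OF g(1) f] supported_mult1[OF g(2)]])
  also have "(\<integral>v. derivation k b (\<lambda>v. g v * f v) v \<partial>cfg_leb N)
      = (\<integral>v. derivation k b g v * f v + g v * derivation k b f v \<partial>cfg_leb N)"
    by (intro Bochner_Integration.integral_cong refl derivation_mult[OF k g' f']) (simp add: space_cfg_leb)
  finally show ?thesis using int1 int2 by simp
qed

text \<open>The integral against the derivative vanishes on the zero set of \<open>g\<close> because there
  \<open>derivation k b g\<close> is the limit of the derivatives of \<open>arctan (n g) / n\<close>, which tends to 0 uniformly.\<close>

lemma integral_derivation_zero_set:
  assumes g: "C_diff 1 N g" and \<psi>: "C_diff 1 N \<psi>" "supported N R \<psi>"
  shows "(\<integral>v. (if g v = 0 then \<psi> v * derivation k b g v else 0) \<partial>cfg_leb N) = 0"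
proof -
  have g': "C_diff (Suc 0) N g" and \<psi>': "C_diff (Suc 0) N \<psi>" using g \<psi> by simp_all
  have gc: "continuous_map (cfg_top N) euclideanreal g" by (rule C_diff_cont[OF g])
  have c: "continuous_map (cfg_top N) euclideanreal (derivation k b f)" if "C_diff (Suc 0) N f" for f
    using C_diff_derivation[OF b(1) k that] by simp
  define a where "a = (\<lambda>n v. arctan (real (Suc n) * g v) / real (Suc n))"
  define r where "r = (\<lambda>n v. inverse (1 + (real (Suc n) * g v)\<^sup>2))"
  have pos: "1 + (real (Suc n) * x)\<^sup>2 \<noteq> 0" for n x
    using zero_le_power2[of "real (Suc n) * x"] by linarith
  have ca: "continuous_map (cfg_top N) euclideanreal (\<lambda>v. arctan (real (Suc n) * g v) / real (Suc n))"
    and cr: "continuous_map (cfg_top N) euclideanreal (r n)" for n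
  proof -
    have "continuous_on UNIV (\<lambda>x. arctan (real (Suc n) * x) / real (Suc n))"
      by (intro continuous_intros) auto
    then show "continuous_map (cfg_top N) euclideanreal (\<lambda>v. arctan (real (Suc n) * g v) / real (Suc n))"
      using continuous_map_compose[OF gc, of euclideanreal "\<lambda>x. arctan (real (Suc n) * x) / real (Suc n)"]
      by (simp add: o_def)
    have "continuous_on UNIV (\<lambda>x. inverse (1 + (real (Suc n) * x)\<^sup>2))"
      using pos[of n] by (intro continuous_intros) auto
    then show "continuous_map (cfg_top N) euclideanreal (r n)"
      using continuous_map_compose[OF gc, of euclideanreal "\<lambda>x. inverse (1 + (real (Suc n) * x)\<^sup>2)"]
      by (simp add: o_def r_def)
  qed
  have da: "((\<lambda>t. a n (v(i := v i + t *\<^sub>R e))) has_real_derivative r n v * pderiv_at i e g v) (at 0)"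
    if "i < N" "e \<in> Basis" "v \<in> cfgs N" for i e v n
  proof -
    have "((\<lambda>x. arctan (real (Suc n) * x) / real (Suc n)) has_real_derivative inverse (1 + (real (Suc n) * x)\<^sup>2)) (at x)" for x
      by (rule derivative_eq_intros refl | simp)+
    from DERIV_chain2[OF this C_diff_DERIV[OF g' that(3,1,2)]] show ?thesis
      by (simp add: a_def r_def)
  qed
  have Ca: "C_diff (Suc 0) N (a n)" for n
  proof (rule C_diff_SucI)
    show "C_diff 0 N (\<lambda>v. r n v * pderiv_at i e g v)" if "i < N" "e \<in> Basis" for i e
      using cr[of n] C_diff_pderiv[OF g' that] by (auto intro: continuous_map_real_mult)
  qed (use ca da in \<open>auto simp: a_def\<close>)
  have Da: "derivation k b (a n) v = r n v * derivation k b g v" if "v \<in> cfgs N" for n v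
  proof -
    have "pderiv_at i e (a n) v = r n v * pderiv_at i e g v" if "i < k" "e \<in> Basis" for i e
      unfolding pderiv_at_def[of _ _ "a n"] using that k \<open>v \<in> cfgs N\<close> by (intro DERIV_imp_deriv da) auto
    then show ?thesis by (simp add: derivation_def sum_distrib_left mult_ac)
  qed
  have parts: "(\<integral>v. \<psi> v * (r n v * derivation k b g v) \<partial>cfg_leb N) = - (\<integral>v. derivation k b \<psi> v * a n v \<partial>cfg_leb N)" for n
  proof -
    have "(\<integral>v. \<psi> v * (r n v * derivation k b g v) \<partial>cfg_leb N) = (\<integral>v. \<psi> v * derivation k b (a n) v \<partial>cfg_leb N)"
      by (intro Bochner_Integration.integral_cong refl) (simp add: Da space_cfg_leb)
    then show ?thesis using integral_by_parts[of "a n" \<psi>, OF _ \<psi>] Ca by simp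
  qed
  have ma: "a n \<in> borel_measurable (cfg_leb N)" for n
    using Ca by (intro measurable_cfg_leb C_diff_measurable)
  have i1: "integrable (cfg_leb N) (\<lambda>v. \<psi> v * derivation k b g v)"
    by (rule integrable_cont_supported[OF _ supported_mult1[OF \<psi>(2)]])
       (intro continuous_map_real_mult c[OF g'] C_diff_cont[OF \<psi>(1)])
  have i2: "integrable (cfg_leb N) (derivation k b \<psi>)"
    by (rule integrable_cont_supported[OF c[OF \<psi>'] supported_derivation[OF \<psi>(2) k]])
  have lim1: "(\<lambda>n. \<integral>v. \<psi> v * (r n v * derivation k b g v) \<partial>cfg_leb N) \<longlonglongrightarrow>
      (\<integral>v. (if g v = 0 then \<psi> v * derivation k b g v else 0) \<partial>cfg_leb N)"
  proof (rule integral_dominated_convergence[where w = "\<lambda>v. \<bar>\<psi> v * derivation k b g v\<bar>"])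
    show "AE v in cfg_leb N. norm (\<psi> v * (r n v * derivation k b g v)) \<le> \<bar>\<psi> v * derivation k b g v\<bar>" for n
    proof (intro AE_I2)
      fix v
      have r: "0 \<le> r n v" "r n v \<le> 1"
        using pos[of n "g v"] by (auto simp: r_def inverse_le_1_iff)
      have "norm (\<psi> v * (r n v * derivation k b g v)) = r n v * \<bar>\<psi> v * derivation k b g v\<bar>"
        using r by (simp add: abs_mult)
      also have "\<dots> \<le> 1 * \<bar>\<psi> v * derivation k b g v\<bar>" using r by (intro mult_right_mono) auto
      finally show "norm (\<psi> v * (r n v * derivation k b g v)) \<le> \<bar>\<psi> v * derivation k b g v\<bar>" by simp
    qed
    show "AE v in cfg_leb N. (\<lambda>n. \<psi> v * (r n v * derivation k b g v)) \<longlonglongrightarrow> (if g v = 0 then \<psi> v * derivation k b g v else 0)"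
    proof (intro AE_I2)
      fix v
      show "(\<lambda>n. \<psi> v * (r n v * derivation k b g v)) \<longlonglongrightarrow> (if g v = 0 then \<psi> v * derivation k b g v else 0)"
      proof (cases "g v = 0")
        case False
        have r: "norm (r n v) \<le> (1 / (g v)\<^sup>2) / real (Suc n)" for n
        proof -
          have "real (Suc n) * (g v)\<^sup>2 \<le> real (Suc n) * (real (Suc n) * (g v)\<^sup>2)"
            by (intro mult_left_mono) (auto simp: mult_le_cancel_right1)
          then have "real (Suc n) * (g v)\<^sup>2 \<le> 1 + (real (Suc n) * g v)\<^sup>2"
            by (simp add: power2_eq_square mult_ac)
          moreover have "0 < real (Suc n) * (g v)\<^sup>2" using False by simp
          ultimately have "inverse (1 + (real (Suc n) * g v)\<^sup>2) \<le> inverse (real (Suc n) * (g v)\<^sup>2)"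
            by (rule le_imp_inverse_le)
          moreover have "0 \<le> inverse (1 + (real (Suc n) * g v)\<^sup>2)" by simp
          ultimately show ?thesis by (simp add: r_def inverse_eq_divide mult.commute)
        qed
        have "(\<lambda>n. r n v) \<longlonglongrightarrow> 0"
          by (rule Lim_null_comparison[OF _ LIMSEQ_Suc[OF lim_const_over_n[of "1 / (g v)\<^sup>2"]]]) (use r in auto)
        then have "(\<lambda>n. \<psi> v * (r n v * derivation k b g v)) \<longlonglongrightarrow> \<psi> v * (0 * derivation k b g v)"
          by (intro tendsto_intros)
        then show ?thesis using False by simp
      qed (simp add: r_def)
    qed
    show "(\<lambda>v. \<psi> v * (r n v * derivation k b g v)) \<in> borel_measurable (cfg_leb N)" for n
      by (intro measurable_cfg_leb measurable_continuous_cfg continuous_map_real_mult cr c[OF g'] C_diff_cont[OF \<psi>(1)])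
    show "(\<lambda>v. if g v = 0 then \<psi> v * derivation k b g v else 0) \<in> borel_measurable (cfg_leb N)"
      using borel_measurable_integrable[OF i1] measurable_cfg_leb[OF measurable_continuous_cfg[OF gc]] by measurable
    show "integrable (cfg_leb N) (\<lambda>v. \<bar>\<psi> v * derivation k b g v\<bar>)" using i1 by simp
  qed
  have lim2: "(\<lambda>n. \<integral>v. derivation k b \<psi> v * a n v \<partial>cfg_leb N) \<longlonglongrightarrow> (\<integral>v. 0 \<partial>cfg_leb N)"
  proof (rule integral_dominated_convergence[where w = "\<lambda>v. \<bar>derivation k b \<psi> v\<bar> * pi"])
    have abs_a: "\<bar>a n v\<bar> \<le> pi / real (Suc n)" for n v
      using arctan_bounded[of "real (Suc n) * g v"] pi_gt_zero
      by (auto simp: a_def abs_le_iff intro!: divide_right_mono)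
    show "AE v in cfg_leb N. norm (derivation k b \<psi> v * a n v) \<le> \<bar>derivation k b \<psi> v\<bar> * pi" for n
    proof (intro AE_I2)
      fix v
      have "pi / real (Suc n) \<le> pi" by (simp add: divide_le_eq)
      then have "\<bar>a n v\<bar> \<le> pi" using abs_a[of n v] by linarith
      then show "norm (derivation k b \<psi> v * a n v) \<le> \<bar>derivation k b \<psi> v\<bar> * pi"
        by (simp add: abs_mult mult_left_mono)
    qed
    show "AE v in cfg_leb N. (\<lambda>n. derivation k b \<psi> v * a n v) \<longlonglongrightarrow> 0"
    proof (intro AE_I2)
      fix v
      have "(\<lambda>n. pi / real (Suc n)) \<longlonglongrightarrow> 0" by (rule LIMSEQ_Suc[OF lim_const_over_n])
      then have "(\<lambda>n. a n v) \<longlonglongrightarrow> 0"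
        by (rule Lim_null_comparison[rotated]) (use abs_a in auto)
      then show "(\<lambda>n. derivation k b \<psi> v * a n v) \<longlonglongrightarrow> 0" by (rule tendsto_mult_right_zero)
    qed
    show "(\<lambda>v. derivation k b \<psi> v * a n v) \<in> borel_measurable (cfg_leb N)" for n
      using borel_measurable_integrable[OF i2] ma[of n] by measurable
    show "integrable (cfg_leb N) (\<lambda>v. \<bar>derivation k b \<psi> v\<bar> * pi)" using i2 by simp
  qed auto
  have "(\<lambda>n. - (\<integral>v. derivation k b \<psi> v * a n v \<partial>cfg_leb N)) \<longlonglongrightarrow> - 0"
    using lim2 by (intro tendsto_minus) simp
  then show ?thesis using lim1 unfolding parts using LIMSEQ_unique by fastforce
qed

end

section \<open>The dual lower bound\<close>

definition cutoff :: "nat set \<Rightarrow> nat \<Rightarrow> config \<Rightarrow> real" where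
  "cutoff J n = box_bump J (\<lambda>_. (- real n) *\<^sub>R One) (\<lambda>_. real n *\<^sub>R One) (1 / real (Suc n))"

lemma inner_One_Basis: "e \<in> Basis \<Longrightarrow> (One :: 'a::euclidean_space) \<bullet> e = 1"
  using inner_sum_left_Basis[of e "\<lambda>_. 1 :: real"] by simp

lemma cyl_test_cutoff: "finite J \<Longrightarrow> m \<le> 2 \<Longrightarrow> cyl_test m J (cutoff J n)"
  unfolding cutoff_def by (intro cyl_test_box_bump) (auto simp: inner_One_Basis)

lemma cutoff_bounds: "0 \<le> cutoff J n v" "cutoff J n v \<le> 1"
  unfolding cutoff_def by (intro box_bump_bounds; simp)+

text \<open>The boxes grow while the smoothing constant shrinks, so \<open>bump_tendsto\<close>,
  which has fixed end points, is replaced by a quantitative bound.\<close>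

lemma cutoff_tendsto: "(\<lambda>n. cutoff J n v) \<longlonglongrightarrow> 1"
proof -
  have "(\<lambda>n. bump (1 / real (Suc n)) (- real n) (real n) t) \<longlonglongrightarrow> 1" for t :: real
  proof -
    obtain n0 :: nat where n0: "\<bar>t\<bar> + 1 < real n0" using reals_Archimedean2 by blast
    have "norm (bump (1 / real (Suc n)) (- real n) (real n) t - 1) \<le> 1 / real (Suc n)" if n: "n0 \<le> n" for n
    proof -
      define x where "x = (t + real n) * (real n - t)"
      \<comment> \<open>At distance at least 1 from both ends the quadratic is at least 1, and then
        the bump misses 1 by at most the smoothing constant.\<close>
      have 1: "1 \<le> t + real n" "1 \<le> real n - t" using n0 n by linarith+
      have "1 * 1 \<le> x" unfolding x_def using 1 by (intro mult_mono) auto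
      then have p: "1 \<le> pos_cube x" by (auto simp: pos_cube_eq one_le_power)
      have c: "0 < 1 / real (Suc n)" by simp
      have "bump (1 / real (Suc n)) (- real n) (real n) t - 1 = - (1 / real (Suc n)) / (1 / real (Suc n) + pos_cube x)"
      proof -
        have "q / (r + q) - 1 = - r / (r + q)" if "0 < r" "1 \<le> q" for q r :: real
          using that by (simp add: field_simps)
        from this[OF c p] show ?thesis by (simp only: bump_def x_def)
          simp
      qed
      also have "norm \<dots> = (1 / real (Suc n)) / (1 / real (Suc n) + pos_cube x)"
        using p c by (simp add: abs_of_pos)
      also have "\<dots> \<le> 1 / real (Suc n)"
      proof -
        have "r / (r + q) \<le> r" if "0 < r" "1 \<le> q" for q r :: real
          using that mult_left_mono[of 1 "r + q" r] by (simp add: divide_le_eq)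
        from this[OF c p] show ?thesis .
      qed
      finally show ?thesis .
    qed
    then have "eventually (\<lambda>n. norm (bump (1 / real (Suc n)) (- real n) (real n) t - 1) \<le> 1 / real (Suc n)) sequentially"
      by (auto simp: eventually_sequentially)
    from Lim_null_comparison[OF this LIMSEQ_Suc[OF lim_1_over_n]] show ?thesis
      by (rule LIM_zero_cancel)
  qed
  then have "(\<lambda>n. cutoff J n v) \<longlonglongrightarrow> (\<Prod>i\<in>J. \<Prod>e\<in>(Basis :: (real^3) set). 1)"
    unfolding cutoff_def box_bump_def by (intro tendsto_prod) (simp add: inner_One_Basis)
  then show ?thesis by simp
qed

text \<open>Dropping the negative part moves the left side to nonnegative integrals, where
  monotonicity also covers an infinite right side.\<close>

lemma ereal_integral_le:
  fixes g h :: "'a \<Rightarrow> real"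
  assumes "integrable M g" "\<And>v. v \<in> space M \<Longrightarrow> g v \<le> h v" "\<And>v. v \<in> space M \<Longrightarrow> 0 \<le> h v"
  shows "ereal (\<integral>v. g v \<partial>M) \<le> enn2ereal (\<integral>\<^sup>+v. ennreal (h v) \<partial>M)"
proof -
  have int: "integrable M (\<lambda>v. max 0 (g v))" using assms(1) by (intro integrable_max) auto
  have "ereal (\<integral>v. g v \<partial>M) \<le> ereal (\<integral>v. max 0 (g v) \<partial>M)"
    using assms(1) int by (auto intro: integral_mono)
  also have "\<dots> = enn2ereal (ennreal (\<integral>v. max 0 (g v) \<partial>M))"
    by (rule enn2ereal_ennreal[symmetric]) auto
  also have "\<dots> = enn2ereal (\<integral>\<^sup>+v. ennreal (max 0 (g v)) \<partial>M)"
    using nn_integral_eq_integral[OF int] by simp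
  also have "\<dots> \<le> enn2ereal (\<integral>\<^sup>+v. ennreal (h v) \<partial>M)"
    unfolding less_eq_ennreal.rep_eq[symmetric]
    using assms(2,3) by (intro nn_integral_mono ennreal_leI) auto
  finally show ?thesis .
qed

text \<open>A crude Young inequality. It trades a first-power error for a small constant plus a
  large multiple of the square, which is what approximation in L2 controls.\<close>

lemma abs_le_add_square_divide:
  fixes d \<tau> :: real
  assumes "0 < \<tau>"
  shows "\<bar>d\<bar> \<le> \<tau> + d\<^sup>2 / \<tau>"
proof (cases "\<bar>d\<bar> \<le> \<tau>")
  case True then show ?thesis using assms by (simp add: add_increasing2)
next
  case False
  then have "\<bar>d\<bar> * \<tau> \<le> \<bar>d\<bar> * \<bar>d\<bar>" by (intro mult_left_mono) auto
  then have "\<bar>d\<bar> \<le> d\<^sup>2 / \<tau>" using assms by (simp add: field_simps power2_eq_square)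
  then show ?thesis using assms by simp
qed

text \<open>Loss in the concave expression \<open>\<phi> * a - \<phi>\<^sup>2 * f / 4\<close> when
  \<open>\<phi>\<close> moves by \<open>\<eta> * d\<close>. The weight \<open>w\<close> dominates
  both \<open>\<eta> * \<bar>a\<bar>\<close> and \<open>\<eta> * f\<close>, so after integration
  only the integrals of \<open>w\<close> and \<open>w * d\<^sup>2\<close> matter.\<close>

lemma perturbation_bound:
  fixes a f \<phi> \<eta> d \<Phi> \<tau> :: real
  assumes "0 \<le> f" "0 \<le> \<eta>" "\<eta> \<le> 1" "\<bar>\<phi>\<bar> \<le> \<Phi>" "0 < \<tau>"
  defines "w \<equiv> \<eta> * (1 + f + \<bar>a\<bar>)"
  shows "(\<phi> + \<eta> * d) * a - (\<phi> + \<eta> * d)\<^sup>2 * f / 4 \<ge>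
     (\<phi> * a - \<phi>\<^sup>2 * f / 4) - (1 + \<Phi>) * \<tau> * w - ((1 + \<Phi>) / \<tau> + 1) * (w * d\<^sup>2)"
proof -
  have w: "0 \<le> w" "\<eta> * \<bar>a\<bar> \<le> w" "\<eta> * f \<le> w"
    using assms(1,2) by (auto simp: w_def intro!: mult_left_mono mult_nonneg_nonneg)
  have \<Phi>: "0 \<le> \<Phi>" using assms(4) by linarith
  have "\<bar>d\<bar> \<le> \<tau> + d\<^sup>2 / \<tau>" by (rule abs_le_add_square_divide[OF assms(5)])
  then have d: "w * \<bar>d\<bar> \<le> w * (\<tau> + d\<^sup>2 / \<tau>)" using w(1) by (rule mult_left_mono)
  have 1: "- (\<eta> * d * a) \<le> w * \<bar>d\<bar>"
  proof -
    have "- (\<eta> * d * a) \<le> \<bar>\<eta> * d * a\<bar>" by simp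
    also have "\<dots> = (\<eta> * \<bar>a\<bar>) * \<bar>d\<bar>" using assms(2) by (simp add: abs_mult)
    also have "\<dots> \<le> w * \<bar>d\<bar>" by (intro mult_right_mono w) auto
    finally show ?thesis .
  qed
  have 2: "\<phi> * \<eta> * d * f / 2 \<le> \<Phi> * (w * \<bar>d\<bar>)"
  proof -
    have "\<phi> * \<eta> * d * f / 2 \<le> \<bar>\<phi> * \<eta> * d * f\<bar>"
      using abs_ge_self[of "\<phi> * \<eta> * d * f"] abs_ge_zero[of "\<phi> * \<eta> * d * f"] by linarith
    also have "\<dots> = \<bar>\<phi>\<bar> * ((\<eta> * f) * \<bar>d\<bar>)" using assms(1,2) by (simp add: abs_mult)
    also have "\<dots> \<le> \<Phi> * (w * \<bar>d\<bar>)"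
      using w assms(1,2,4) \<Phi> by (intro mult_mono) auto
    finally show ?thesis .
  qed
  have 3: "\<eta>\<^sup>2 * d\<^sup>2 * f / 4 \<le> w * d\<^sup>2"
  proof -
    have "\<eta>\<^sup>2 * f / 4 \<le> \<eta> * f"
    proof -
      have "\<eta> * (\<eta> * f) \<le> 1 * (\<eta> * f)" using assms(1-3) by (intro mult_right_mono) auto
      moreover have "0 \<le> \<eta> * f" using assms(1,2) by simp
      ultimately show ?thesis by (simp add: power2_eq_square)
    qed
    then have "(\<eta>\<^sup>2 * f / 4) * d\<^sup>2 \<le> w * d\<^sup>2" using w(3) by (intro mult_right_mono) auto
    then show ?thesis by (simp add: mult_ac)
  qed
  have "(\<phi> + \<eta> * d) * a - (\<phi> + \<eta> * d)\<^sup>2 * f / 4 = (\<phi> * a - \<phi>\<^sup>2 * f / 4) + \<eta> * d * a - \<phi> * \<eta> * d * f / 2 - \<eta>\<^sup>2 * d\<^sup>2 * f / 4"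
    by (simp add: power2_eq_square field_simps)
  also have "\<dots> \<ge> (\<phi> * a - \<phi>\<^sup>2 * f / 4) - (1 + \<Phi>) * (w * \<bar>d\<bar>) - w * d\<^sup>2"
    using 1 2 3 by (simp add: distrib_right)
  moreover have "(1 + \<Phi>) * (w * \<bar>d\<bar>) \<le> (1 + \<Phi>) * (w * (\<tau> + d\<^sup>2 / \<tau>))"
    by (rule mult_left_mono[OF d]) (use \<Phi> in simp)
  moreover have "(1 + \<Phi>) * (w * (\<tau> + d\<^sup>2 / \<tau>)) = (1 + \<Phi>) * \<tau> * w + (1 + \<Phi>) / \<tau> * (w * d\<^sup>2)"
    by (simp add: field_simps)
  ultimately show ?thesis by (simp add: distrib_right)
qed

text \<open>Pointwise, the quadratic expression in \<psi> is maximal at 2 a / f, with value a^2 / f.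
  This optimiser is in general neither smooth nor bounded, so it is truncated to a set where all
  quantities are bounded and then approximated in a weighted L2 space. As the integral may be
  infinite, a number \<open>c\<close> below it is the target.\<close>

lemma dual_lower_bound:
  assumes m: "m \<le> 2"
    and a: "continuous_map (cfg_top N) euclideanreal a"
    and f: "continuous_map (cfg_top N) euclideanreal f" "\<And>v. v \<in> cfgs N \<Longrightarrow> 0 \<le> f v"
    and c: "ereal c < enn2ereal (\<integral>\<^sup>+v. ennreal ((a v)\<^sup>2 / f v) \<partial>cfg_leb N)"
  shows "\<exists>\<psi>\<in>test_functions m N. c < (\<integral>v. \<psi> v * a v - (\<psi> v)\<^sup>2 * f v / 4 \<partial>cfg_leb N)"
proof (cases "c < 0")
  case True
  then show ?thesis using zero_test_function by (intro bexI[of _ "\<lambda>_. 0"]) auto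
next
  case False
  let ?L = "cfg_leb N" and ?J = "{..<N}"
  \<comment> \<open>On \<open>S n\<close> the function \<open>f\<close> and the cutoff are bounded
    below, so both may be divided by, and \<open>a\<close> is bounded.\<close>
  define S where "S = (\<lambda>n v. 1 / real (Suc n) \<le> f v \<and> \<bar>a v\<bar> \<le> real n \<and> 1 / real (Suc n) \<le> cutoff ?J n v)"
  have cyl: "cyl_test m ?J (cutoff ?J n)" for n using m by (intro cyl_test_cutoff) auto
  have [measurable]: "a \<in> borel_measurable ?L" "f \<in> borel_measurable ?L"
    using a f by (auto intro!: measurable_cfg_leb measurable_continuous_cfg)
  have mcut: "cutoff ?J n \<in> borel_measurable (pborel ?J)" for n
    using C_diff_measurable[OF cyl_test_C_diff[OF cyl]] .
  have [measurable]: "cutoff ?J n \<in> borel_measurable ?L" for n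
    by (rule measurable_cfg_leb[OF mcut])
  have Sm: "Measurable.pred ?L (S n)" for n unfolding S_def by measurable
  have "ennreal c < (\<integral>\<^sup>+v. ennreal ((a v)\<^sup>2 / f v) \<partial>?L)"
    using c False by (simp add: less_ennreal.rep_eq enn2ereal_ennreal)
  also have "\<dots> = (\<integral>\<^sup>+v. liminf (\<lambda>n. ennreal (if S n v then (a v)\<^sup>2 / f v else 0)) \<partial>?L)"
  proof (intro nn_integral_cong)
    fix v assume "v \<in> space ?L"
    then have v: "0 \<le> f v" using f(2) by (simp add: space_cfg_leb)
    have "(\<lambda>n. ennreal (if S n v then (a v)\<^sup>2 / f v else 0)) \<longlonglongrightarrow> ennreal ((a v)\<^sup>2 / f v)"
    proof (cases "f v = 0")
      case False
      have 0: "(\<lambda>n. 1 / real (Suc n)) \<longlonglongrightarrow> 0" by (rule LIMSEQ_Suc[OF lim_1_over_n])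
      have "eventually (\<lambda>n. 1 / real (Suc n) < min (f v) (1/2)) sequentially"
        using False v by (intro order_tendstoD(2)[OF 0]) auto
      moreover have "eventually (\<lambda>n. 1 / 2 < cutoff ?J n v) sequentially"
        by (rule order_tendstoD(1)[OF cutoff_tendsto]) auto
      moreover have "eventually (\<lambda>n. \<bar>a v\<bar> \<le> real n) sequentially"
        using filterlim_real_sequentially unfolding filterlim_at_top by blast
      ultimately have "eventually (\<lambda>n. S n v) sequentially"
      proof eventually_elim
        case (elim n)
        then have "1 / real (Suc n) < f v" "1 / real (Suc n) < 1 / 2" by simp_all
        then show ?case using elim unfolding S_def by linarith
      qed
      then have "eventually (\<lambda>n. ennreal (if S n v then (a v)\<^sup>2 / f v else 0) = ennreal ((a v)\<^sup>2 / f v)) sequentially"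
        by eventually_elim simp
      then show ?thesis by (rule tendsto_eventually)
    next
      \<comment> \<open>Division by zero gives 0 for the truncated and for the full quotient
        alike.\<close>
      case True
      then show ?thesis by (simp cong: if_cong)
    qed
    then show "ennreal ((a v)\<^sup>2 / f v) = liminf (\<lambda>n. ennreal (if S n v then (a v)\<^sup>2 / f v else 0))"
      by (intro lim_imp_Liminf[symmetric]) auto
  qed
  \<comment> \<open>Fatou's lemma suffices, since the goal is only that some truncated integral
    exceeds \<open>c\<close>.\<close>
  also have "\<dots> \<le> liminf (\<lambda>n. \<integral>\<^sup>+v. ennreal (if S n v then (a v)\<^sup>2 / f v else 0) \<partial>?L)"
    using Sm by (intro nn_integral_liminf) measurable
  finally have "eventually (\<lambda>n. ennreal c < (\<integral>\<^sup>+v. ennreal (if S n v then (a v)\<^sup>2 / f v else 0) \<partial>?L)) sequentially"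
    by (rule less_LiminfD)
  then obtain n where n: "ennreal c < (\<integral>\<^sup>+v. ennreal (if S n v then (a v)\<^sup>2 / f v else 0) \<partial>?L)"
    by (auto simp: eventually_sequentially)

  define \<eta> where "\<eta> = cutoff ?J n"
  \<comment> \<open>\<open>\<phi>\<close> below is the truncated optimiser, but what gets
    approximated is \<open>u\<close>, its quotient by the cutoff. The test function is
    \<open>\<eta>\<close> times the approximation, so the error carries the factor
    \<open>\<eta>\<close> and is confined to a bounded set.\<close>
  define u where "u = (\<lambda>v. if S n v then 2 * a v / (f v * \<eta> v) else 0)"
  define \<phi> where "\<phi> = (\<lambda>v. if S n v then 2 * a v / f v else 0)"
  define w where "w = (\<lambda>v. \<eta> v * (1 + f v + \<bar>a v\<bar>))"
  define g0 where "g0 = (\<lambda>v. if S n v then (a v)\<^sup>2 / f v else 0)"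
  define \<Phi> where "\<Phi> = 2 * real n * real (Suc n)"
  have \<eta>: "0 \<le> \<eta> v" "\<eta> v \<le> 1" for v unfolding \<eta>_def by (rule cutoff_bounds)+
  obtain R where R: "\<And>v i. i \<in> ?J \<Longrightarrow> R < norm (v i) \<Longrightarrow> \<eta> v = 0"
    using cyl_test_support[OF cyl[of n]] unfolding \<eta>_def by blast
  have \<eta>s: "supported N R \<eta>" using R by (auto simp: supported_def)
  have \<eta>C: "C_diff m N \<eta>" unfolding \<eta>_def by (rule cyl_test_C_diff[OF cyl])
  have \<eta>c: "continuous_map (cfg_top N) euclideanreal \<eta>" by (rule C_diff_cont[OF \<eta>C])
  have u_bound: "\<bar>u v\<bar> \<le> \<Phi> * real (Suc n)" and \<phi>_bound: "\<bar>\<phi> v\<bar> \<le> \<Phi>" and \<phi>_eq: "\<phi> v = \<eta> v * u v"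
    and g0_bound: "\<bar>g0 v\<bar> \<le> real n * real n * real (Suc n)" for v
  proof -
    have *: "1 / f v \<le> real (Suc n)" "1 / \<eta> v \<le> real (Suc n)" "\<bar>a v\<bar> \<le> real n" "0 < f v" "0 < \<eta> v" if "S n v"
    proof -
      have S: "1 / real (Suc n) \<le> f v" "1 / real (Suc n) \<le> \<eta> v" "\<bar>a v\<bar> \<le> real n"
        using that by (auto simp: S_def \<eta>_def)
      have "0 < 1 / real (Suc n)" by simp
      then show pos: "0 < f v" "0 < \<eta> v" using S by linarith+
      show "1 / f v \<le> real (Suc n)" "1 / \<eta> v \<le> real (Suc n)" using S(1,2) pos by (simp_all add: field_simps)
      show "\<bar>a v\<bar> \<le> real n" by fact
    qed
    show "\<bar>\<phi> v\<bar> \<le> \<Phi>"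
    proof (cases "S n v")
      case True
      have "\<bar>\<phi> v\<bar> = 2 * \<bar>a v\<bar> * (1 / f v)" using *[OF True] True by (simp add: \<phi>_def abs_mult)
      also have "\<dots> \<le> 2 * real n * real (Suc n)" using *[OF True] by (intro mult_mono) auto
      finally show ?thesis by (simp add: \<Phi>_def)
    qed (simp add: \<phi>_def \<Phi>_def)
    show "\<phi> v = \<eta> v * u v" using *(5) by (auto simp: \<phi>_def u_def)
    show "\<bar>u v\<bar> \<le> \<Phi> * real (Suc n)"
    proof (cases "S n v")
      case True
      have "\<bar>u v\<bar> = \<bar>\<phi> v\<bar> * (1 / \<eta> v)" using *[OF True] True by (simp add: u_def \<phi>_def abs_mult)
      also have "\<dots> \<le> \<Phi> * real (Suc n)" using *[OF True] \<open>\<bar>\<phi> v\<bar> \<le> \<Phi>\<close> by (intro mult_mono) auto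
      finally show ?thesis .
    qed (simp add: u_def \<Phi>_def)
    show "\<bar>g0 v\<bar> \<le> real n * real n * real (Suc n)"
    proof (cases "S n v")
      case True
      have "\<bar>g0 v\<bar> = \<bar>a v\<bar> * \<bar>a v\<bar> * (1 / f v)"
        using *[OF True] True by (simp add: g0_def power2_eq_square)
      also have "\<dots> \<le> real n * real n * real (Suc n)" using *[OF True] by (intro mult_mono) auto
      finally show ?thesis .
    qed (simp add: g0_def)
  qed
  have g0_eq: "g0 v = \<phi> v * a v - (\<phi> v)\<^sup>2 * f v / 4" for v
  proof (cases "S n v")
    case True
    have "0 < 1 / real (Suc n)" by simp
    then have "0 < f v" using True unfolding S_def by linarith
    then show ?thesis using True by (simp add: g0_def \<phi>_def field_simps power2_eq_square)
  qed (simp add: g0_def \<phi>_def)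
  have g0s: "supported N R g0"
    unfolding supported_def
  proof (intro ballI impI)
    fix v assume "v \<in> cfgs N" "\<exists>i<N. R < norm (v i)"
    then have "\<eta> v = 0" using \<eta>s by (simp add: supported_def)
    then have "\<not> S n v" by (auto simp: S_def \<eta>_def[symmetric])
    then show "g0 v = 0" by (simp add: g0_def)
  qed
  have g0_int: "integrable ?L g0"
    by (rule integrable_supported[OF _ g0s g0_bound]) (use Sm[of n] in \<open>simp add: g0_def\<close>)
  have g0_nn: "0 \<le> g0 v" if "v \<in> space ?L" for v
    using f(2) that by (auto simp: g0_def space_cfg_leb)
  have "ennreal c < ennreal (\<integral>v. g0 v \<partial>?L)"
    using n nn_integral_eq_integral[OF g0_int] g0_nn by (simp add: g0_def)
  then have cI: "c < (\<integral>v. g0 v \<partial>?L)" using False by (simp add: ennreal_less_iff)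
  define \<delta> where "\<delta> = (\<integral>v. g0 v \<partial>?L) - c"
  have \<delta>: "0 < \<delta>" using cI by (simp add: \<delta>_def)

  have w_c: "continuous_map (cfg_top N) euclideanreal w"
    unfolding w_def by (intro continuous_map_real_mult continuous_map_add \<eta>c f(1) continuous_map_real_abs a) simp
  have w_nn: "0 \<le> w v" if "v \<in> cfgs N" for v using f(2)[OF that] \<eta>(1) by (simp add: w_def)
  have w_int: "integrable ?L w"
    by (rule integrable_cont_supported[OF w_c]) (unfold w_def, rule supported_mult1[OF \<eta>s])
  define W where "W = (\<integral>v. w v \<partial>?L)"
  have W: "0 \<le> W" unfolding W_def by (rule integral_nonneg_AE) (use w_nn in \<open>auto simp: space_cfg_leb\<close>)
  have \<Phi>: "0 \<le> \<Phi>" by (simp add: \<Phi>_def)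
  \<comment> \<open>\<open>\<tau>\<close> and \<open>\<epsilon>\<close> make each of the two error
    terms at most \<open>\<delta> / 4\<close>; the 1 added to \<open>W\<close> guards against
    \<open>W = 0\<close>.\<close>
  define \<tau> where "\<tau> = \<delta> / (4 * (1 + \<Phi>) * (W + 1))"
  have \<tau>: "0 < \<tau>" using \<delta> \<Phi> W by (simp add: \<tau>_def)
  define \<epsilon> where "\<epsilon> = \<delta> / (4 * ((1 + \<Phi>) / \<tau> + 1))"
  have C: "0 < (1 + \<Phi>) / \<tau> + 1" using \<Phi> \<tau> by (simp add: add_pos_pos)
  have \<epsilon>: "0 < \<epsilon>" unfolding \<epsilon>_def by (rule divide_pos_pos[OF \<delta> mult_pos_pos[OF _ C]]) simp

  \<comment> \<open>The cutoff makes the weight integrable, so the density theorem for finite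
    measures applies to \<open>\<mu>\<close>.\<close>
  define \<mu> where "\<mu> = density ?L (\<lambda>v. ennreal (w v))"
  have [measurable]: "w \<in> borel_measurable ?L" using w_int by auto
  have fin: "finite_measure \<mu>"
  proof
    have "emeasure \<mu> (space \<mu>) = (\<integral>\<^sup>+v. ennreal (w v) \<partial>?L)"
      by (simp add: \<mu>_def emeasure_density cong: nn_integral_cong)
    also have "\<dots> = ennreal W"
      unfolding W_def by (rule nn_integral_eq_integral[OF w_int]) (use w_nn in \<open>auto simp: space_cfg_leb\<close>)
    finally show "emeasure \<mu> (space \<mu>) \<noteq> \<infinity>" by simp
  qed
  have sets_\<mu>: "sets \<mu> = sets (pborel {..<N})" by (simp add: \<mu>_def sets_cfg_leb)
  have um: "u \<in> borel_measurable ?L"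
    using Sm[of n] unfolding u_def \<eta>_def by measurable
  then have um': "u \<in> borel_measurable (pborel ?J)"
    by (simp add: measurable_cong_sets[OF sets_cfg_leb refl])
  from approximable_bounded[OF fin sets_\<mu> order_refl m um' u_bound]
  obtain \<chi>' where \<chi>': "cyl_test m ?J \<chi>'" "(\<integral>\<^sup>+v. ennreal ((\<chi>' v - u (restrict v ?J))\<^sup>2) \<partial>\<mu>) < ennreal \<epsilon>"
    using \<epsilon> unfolding approximable_def by blast
  define d where "d = (\<lambda>v. \<chi>' v - u v)"
  have \<chi>m[measurable]: "\<chi>' \<in> borel_measurable ?L"
    by (rule measurable_cfg_leb[OF C_diff_measurable[OF cyl_test_C_diff[OF \<chi>'(1)]]])
  have [measurable]: "d \<in> borel_measurable ?L" using um unfolding d_def by measurable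
  have "(\<integral>\<^sup>+v. ennreal (w v * (d v)\<^sup>2) \<partial>?L) = (\<integral>\<^sup>+v. ennreal ((d v)\<^sup>2) \<partial>\<mu>)"
    unfolding \<mu>_def
    by (subst nn_integral_density) (auto intro!: nn_integral_cong simp: ennreal_mult w_nn space_cfg_leb)
  also have "\<dots> = (\<integral>\<^sup>+v. ennreal ((\<chi>' v - u (restrict v ?J))\<^sup>2) \<partial>\<mu>)"
    by (intro nn_integral_cong)
       (auto simp: d_def \<mu>_def space_cfg_leb cfgs_iff extensional_restrict)
  finally have wd: "(\<integral>\<^sup>+v. ennreal (w v * (d v)\<^sup>2) \<partial>?L) < ennreal \<epsilon>" using \<chi>'(2) by simp
  have wd_int: "integrable ?L (\<lambda>v. w v * (d v)\<^sup>2)"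
  proof (rule integrableI_nonneg)
    show "AE v in ?L. 0 \<le> w v * (d v)\<^sup>2" using w_nn by (auto simp: space_cfg_leb)
    show "(\<integral>\<^sup>+v. ennreal (w v * (d v)\<^sup>2) \<partial>?L) < \<infinity>"
      using wd by (rule order_less_trans) simp
  qed measurable
  have wd_less: "(\<integral>v. w v * (d v)\<^sup>2 \<partial>?L) < \<epsilon>"
  proof -
    have "AE v in ?L. 0 \<le> w v * (d v)\<^sup>2" using w_nn by (intro AE_I2) (simp add: space_cfg_leb)
    then have "ennreal (\<integral>v. w v * (d v)\<^sup>2 \<partial>?L) < ennreal \<epsilon>"
      using wd nn_integral_eq_integral[OF wd_int] by simp
    moreover have "0 \<le> (\<integral>v. w v * (d v)\<^sup>2 \<partial>?L)"
      by (rule integral_nonneg_AE) (use w_nn in \<open>auto simp: space_cfg_leb\<close>)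
    ultimately show ?thesis by (simp add: ennreal_less_iff)
  qed

  define \<psi> where "\<psi> = (\<lambda>v. \<eta> v * \<chi>' v)"
  have \<psi>C: "C_diff m N \<psi>" unfolding \<psi>_def by (intro C_diff_mult \<eta>C cyl_test_C_diff[OF \<chi>'(1)])
  have \<psi>s: "supported N R \<psi>" unfolding \<psi>_def by (rule supported_mult1[OF \<eta>s])
  have \<psi>c: "continuous_map (cfg_top N) euclideanreal \<psi>" by (rule C_diff_cont[OF \<psi>C])
  have G_int: "integrable ?L (\<lambda>v. \<psi> v * a v - (\<psi> v)\<^sup>2 * f v / 4)"
  proof (rule Bochner_Integration.integrable_diff)
    show "integrable ?L (\<lambda>v. \<psi> v * a v)"
      by (rule integrable_cont_supported[OF _ supported_mult1[OF \<psi>s]]) (intro continuous_map_real_mult \<psi>c a)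
    have "integrable ?L (\<lambda>v. \<psi> v * (\<psi> v * f v))"
      by (rule integrable_cont_supported[OF _ supported_mult1[OF \<psi>s]]) (intro continuous_map_real_mult \<psi>c f)
    then show "integrable ?L (\<lambda>v. (\<psi> v)\<^sup>2 * f v / 4)" by (simp add: power2_eq_square mult.assoc)
  qed
  have "(\<integral>v. g0 v - (1 + \<Phi>) * \<tau> * w v - ((1 + \<Phi>) / \<tau> + 1) * (w v * (d v)\<^sup>2) \<partial>?L)
      \<le> (\<integral>v. \<psi> v * a v - (\<psi> v)\<^sup>2 * f v / 4 \<partial>?L)"
  proof (rule integral_mono[OF _ G_int])
    show "integrable ?L (\<lambda>v. g0 v - (1 + \<Phi>) * \<tau> * w v - ((1 + \<Phi>) / \<tau> + 1) * (w v * (d v)\<^sup>2))"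
      by (intro Bochner_Integration.integrable_diff integrable_mult_right g0_int w_int wd_int)
    fix v assume "v \<in> space ?L"
    then have v: "v \<in> cfgs N" by (simp add: space_cfg_leb)
    have "\<psi> v = \<phi> v + \<eta> v * d v" by (simp add: \<psi>_def \<phi>_eq d_def algebra_simps)
    then show "g0 v - (1 + \<Phi>) * \<tau> * w v - ((1 + \<Phi>) / \<tau> + 1) * (w v * (d v)\<^sup>2) \<le> \<psi> v * a v - (\<psi> v)\<^sup>2 * f v / 4"
      using perturbation_bound[OF f(2)[OF v] \<eta>(1)[of v] \<eta>(2)[of v] \<phi>_bound[of v] \<tau>, of "a v" "d v"]
      by (simp add: g0_eq w_def)
  qed
  also have "(\<integral>v. g0 v - (1 + \<Phi>) * \<tau> * w v - ((1 + \<Phi>) / \<tau> + 1) * (w v * (d v)\<^sup>2) \<partial>?L)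
     = (\<integral>v. g0 v \<partial>?L) - (1 + \<Phi>) * \<tau> * W - ((1 + \<Phi>) / \<tau> + 1) * (\<integral>v. w v * (d v)\<^sup>2 \<partial>?L)"
    using g0_int w_int wd_int by (simp add: W_def)
  finally have le: "(\<integral>v. g0 v \<partial>?L) - (1 + \<Phi>) * \<tau> * W - ((1 + \<Phi>) / \<tau> + 1) * (\<integral>v. w v * (d v)\<^sup>2 \<partial>?L)
      \<le> (\<integral>v. \<psi> v * a v - (\<psi> v)\<^sup>2 * f v / 4 \<partial>?L)" .
  have "(1 + \<Phi>) * \<tau> * W = \<delta> / 4 * (W / (W + 1))"
  proof -
    have "x * (\<delta> / (4 * x * y)) * W = \<delta> / 4 * (W / y)" if "0 < x" "0 < y" for x y :: real
      using that by (simp add: field_simps)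
    from this[of "1 + \<Phi>" "W + 1"] show ?thesis using \<Phi> W by (simp add: \<tau>_def)
  qed
  also have "\<dots> \<le> \<delta> / 4 * 1" using \<delta> W by (intro mult_left_mono) (auto simp: divide_simps)
  finally have e1: "(1 + \<Phi>) * \<tau> * W \<le> \<delta> / 4" by simp
  have "((1 + \<Phi>) / \<tau> + 1) * (\<integral>v. w v * (d v)\<^sup>2 \<partial>?L) \<le> ((1 + \<Phi>) / \<tau> + 1) * \<epsilon>"
    using wd_less C by (intro mult_left_mono) auto
  also have "\<dots> = \<delta> / 4"
  proof -
    have "x * (\<delta> / (4 * x)) = \<delta> / 4" if "0 < x" for x :: real using that by simp
    from this[OF C] show ?thesis by (simp only: \<epsilon>_def)
  qed
  finally have e2: "((1 + \<Phi>) / \<tau> + 1) * (\<integral>v. w v * (d v)\<^sup>2 \<partial>?L) \<le> \<delta> / 4" .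
  have "c < (\<integral>v. \<psi> v * a v - (\<psi> v)\<^sup>2 * f v / 4 \<partial>?L)"
  proof -
    have "c < x" if "p \<le> (g - c) / 4" "g - q - p \<le> x" "q \<le> (g - c) / 4" "0 < g - c" for p q x g :: real
      using that by argo
    from this[OF _ le] show ?thesis
      using e2 e1 \<delta>
      unfolding \<delta>_def by blast
  qed
  then show ?thesis using \<psi>C \<psi>s by (intro bexI[of _ \<psi>]) (auto simp: test_functions_iff)
qed

section \<open>Regular densities and super-additivity\<close>

text \<open>A zero of a nonnegative function is a minimum along every coordinate line.\<close>

lemma derivation_eq_0_at_zero:
  assumes "C_diff 1 N f" "\<And>v. v \<in> cfgs N \<Longrightarrow> 0 \<le> f v" "v \<in> cfgs N" "f v = 0" "k \<le> N"
  shows "derivation k b f v = 0"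
proof -
  have "pderiv_at i e f v = 0" if "i < k" "e \<in> Basis" for i e
  proof (rule DERIV_local_min)
    show "((\<lambda>t. f (v(i := v i + t *\<^sub>R e))) has_real_derivative pderiv_at i e f v) (at 0)"
      by (rule C_diff_DERIV[of 0 N]) (use assms that in auto)
    show "\<forall>y. \<bar>0 - y\<bar> < 1 \<longrightarrow> f (v(i := v i + 0 *\<^sub>R e)) \<le> f (v(i := v i + y *\<^sub>R e))"
      using assms cfgs_upd[OF assms(3)] that by auto
  qed simp
  then show ?thesis by (simp add: derivation_def)
qed

context
  fixes k N :: nat and b :: "config \<Rightarrow> config"
  assumes b: "smooth_field k b" "divergence_free k b" and k: "k \<le> N"
begin

text \<open>\<open>a\<close> stands for the adjoint of the \<open>m\<close>-th power of the
  derivation applied to \<open>f\<close>, which is that power itself up to the sign (-1)^m;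
  \<open>parts\<close> is the integration by parts.\<close>

lemma integral_integrand_density:
  assumes f: "continuous_map (cfg_top N) euclideanreal f" "\<And>v. v \<in> cfgs N \<Longrightarrow> 0 \<le> f v"
    and \<psi>: "C_diff m N \<psi>" "supported N R \<psi>" and a: "continuous_map (cfg_top N) euclideanreal a"
    and parts: "(\<integral>v. (derivation k b ^^ m) \<psi> v * f v \<partial>cfg_leb N) = (\<integral>v. \<psi> v * a v \<partial>cfg_leb N)"
  shows "integrable (cfg_leb N) (\<lambda>v. \<psi> v * a v - (\<psi> v)\<^sup>2 * f v / 4)"
    and "(\<integral>v. integrand k b m \<psi> v \<partial>density (cfg_leb N) (\<lambda>v. ennreal (f v)))
      = (\<integral>v. \<psi> v * a v - (\<psi> v)\<^sup>2 * f v / 4 \<partial>cfg_leb N)"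
proof -
  have \<psi>c: "continuous_map (cfg_top N) euclideanreal \<psi>" by (rule C_diff_cont[OF \<psi>(1)])
  have Dc: "continuous_map (cfg_top N) euclideanreal ((derivation k b ^^ m) \<psi>)"
    using C_diff_derivation_pow[OF b(1) k, of m 0 \<psi>] \<psi>(1) by simp
  have i1: "integrable (cfg_leb N) (\<lambda>v. \<psi> v * a v)"
    by (rule integrable_cont_supported[OF _ supported_mult1[OF \<psi>(2)]]) (intro continuous_map_real_mult \<psi>c a)
  have "integrable (cfg_leb N) (\<lambda>v. \<psi> v * (\<psi> v * f v))"
    by (rule integrable_cont_supported[OF _ supported_mult1[OF \<psi>(2)]]) (intro continuous_map_real_mult \<psi>c f)
  then have i2: "integrable (cfg_leb N) (\<lambda>v. (\<psi> v)\<^sup>2 * f v / 4)" by (simp add: power2_eq_square mult.assoc)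
  have i3: "integrable (cfg_leb N) (\<lambda>v. (derivation k b ^^ m) \<psi> v * f v)"
    by (rule integrable_cont_supported[OF _ supported_mult1[OF supported_derivation_pow[OF \<psi>(2) k]]])
       (intro continuous_map_real_mult Dc f)
  show "integrable (cfg_leb N) (\<lambda>v. \<psi> v * a v - (\<psi> v)\<^sup>2 * f v / 4)"
    using i1 i2 by (rule Bochner_Integration.integrable_diff)
  have "(\<integral>v. integrand k b m \<psi> v \<partial>density (cfg_leb N) (\<lambda>v. ennreal (f v))) = (\<integral>v. f v *\<^sub>R integrand k b m \<psi> v \<partial>cfg_leb N)"
    using f(2) by (intro integral_density measurable_cfg_leb measurable_continuous_cfg f(1) integrand_continuous[OF b(1) k \<psi>(1)] AE_I2)
      (auto simp: space_cfg_leb)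
  also have "\<dots> = (\<integral>v. (derivation k b ^^ m) \<psi> v * f v - (\<psi> v)\<^sup>2 * f v / 4 \<partial>cfg_leb N)"
    by (intro Bochner_Integration.integral_cong refl) (simp add: integrand_def algebra_simps)
  also have "\<dots> = (\<integral>v. \<psi> v * a v - (\<psi> v)\<^sup>2 * f v / 4 \<partial>cfg_leb N)"
    using i1 i2 i3 parts by simp
  finally show "(\<integral>v. integrand k b m \<psi> v \<partial>density (cfg_leb N) (\<lambda>v. ennreal (f v)))
      = (\<integral>v. \<psi> v * a v - (\<psi> v)\<^sup>2 * f v / 4 \<partial>cfg_leb N)" .
qed

text \<open>Completing the square gives the upper bound where \<open>f\<close> is positive. Where
  \<open>f\<close> vanishes the quotient is 0 by convention, so the term \<open>\<psi> * a\<close>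
  has to disappear. Its integral is known to vanish over the zero set of an auxiliary
  \<open>g\<close>, which contains that of \<open>f\<close> and may be larger; this is harmless,
  since what remains of the integrand there is nonpositive.\<close>

lemma J_ext_density:
  assumes m: "m \<le> 2"
    and f: "continuous_map (cfg_top N) euclideanreal f" "\<And>v. v \<in> cfgs N \<Longrightarrow> 0 \<le> f v"
    and a: "continuous_map (cfg_top N) euclideanreal a"
    and parts: "\<And>\<psi> R. C_diff m N \<psi> \<Longrightarrow> supported N R \<psi> \<Longrightarrow>
      (\<integral>v. (derivation k b ^^ m) \<psi> v * f v \<partial>cfg_leb N) = (\<integral>v. \<psi> v * a v \<partial>cfg_leb N)"
    and zero: "\<And>\<psi> R. C_diff m N \<psi> \<Longrightarrow> supported N R \<psi> \<Longrightarrow>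
      (\<integral>v. (if g v = 0 then \<psi> v * a v else 0) \<partial>cfg_leb N) = 0"
    and g: "continuous_map (cfg_top N) euclideanreal g" "\<And>v. v \<in> cfgs N \<Longrightarrow> f v = 0 \<Longrightarrow> g v = 0"
  shows "J_ext k b m N (density (cfg_leb N) (\<lambda>v. ennreal (f v)))
    = enn2ereal (\<integral>\<^sup>+v. ennreal ((a v)\<^sup>2 / f v) \<partial>cfg_leb N)" (is "?J = ?I")
proof (rule antisym)
  show "?J \<le> ?I"
    unfolding J_ext_def
  proof (rule SUP_least)
    fix \<psi> assume "\<psi> \<in> test_functions m N"
    then obtain R where \<psi>: "C_diff m N \<psi>" "supported N R \<psi>" by (auto simp: test_functions_iff)
    note T = integral_integrand_density[OF f \<psi> a parts[OF \<psi>]]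
    have \<psi>c: "continuous_map (cfg_top N) euclideanreal \<psi>" by (rule C_diff_cont[OF \<psi>(1)])
    have i1: "integrable (cfg_leb N) (\<lambda>v. \<psi> v * a v)"
      by (rule integrable_cont_supported[OF _ supported_mult1[OF \<psi>(2)]]) (intro continuous_map_real_mult \<psi>c a)
    have [measurable]: "g \<in> borel_measurable (cfg_leb N)" by (intro measurable_cfg_leb measurable_continuous_cfg g(1))
    have iz: "integrable (cfg_leb N) (\<lambda>v. if g v = 0 then \<psi> v * a v else 0)"
      by (rule Bochner_Integration.integrable_bound[OF i1]) (use borel_measurable_integrable[OF i1] in auto)
    have "(\<integral>v. integrand k b m \<psi> v \<partial>density (cfg_leb N) (\<lambda>v. ennreal (f v)))
      = (\<integral>v. (\<psi> v * a v - (\<psi> v)\<^sup>2 * f v / 4) - (if g v = 0 then \<psi> v * a v else 0) \<partial>cfg_leb N)"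
      using T iz zero[OF \<psi>] by simp
    also have "ereal \<dots> \<le> ?I"
    proof (rule ereal_integral_le)
      show "integrable (cfg_leb N) (\<lambda>v. (\<psi> v * a v - (\<psi> v)\<^sup>2 * f v / 4) - (if g v = 0 then \<psi> v * a v else 0))"
        using T(1) iz by (rule Bochner_Integration.integrable_diff)
      fix v assume "v \<in> space (cfg_leb N)"
      then have v: "v \<in> cfgs N" "0 \<le> f v" using f(2) by (auto simp: space_cfg_leb)
      show "0 \<le> (a v)\<^sup>2 / f v" using v by simp
      show "\<psi> v * a v - (\<psi> v)\<^sup>2 * f v / 4 - (if g v = 0 then \<psi> v * a v else 0) \<le> (a v)\<^sup>2 / f v"
      proof (cases "g v = 0")
        case True
        have "0 \<le> (\<psi> v)\<^sup>2 * f v / 4" "0 \<le> (a v)\<^sup>2 / f v" using v by simp_all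
        then show ?thesis using True by simp
      next
        case False
        then have "0 < f v" using g(2)[OF v(1)] v(2) by (metis order_le_less)
        \<comment> \<open>Expanding this square and dividing by \<open>f v\<close> yields the
          inequality.\<close>
        moreover have "0 \<le> (a v - \<psi> v * f v / 2)\<^sup>2" by simp
        ultimately show ?thesis using False by (simp add: field_simps power2_eq_square)
      qed
    qed
    finally show "ereal (\<integral>v. integrand k b m \<psi> v \<partial>density (cfg_leb N) (\<lambda>v. ennreal (f v))) \<le> ?I" .
  qed
  show "?I \<le> ?J"
  proof (rule dense_le)
    fix y assume y: "y < ?I"
    show "y \<le> ?J"
    proof (cases y)
      case (real c)
      from dual_lower_bound[OF m a f, of c] y real
      obtain \<psi> where \<psi>: "\<psi> \<in> test_functions m N" "c < (\<integral>v. \<psi> v * a v - (\<psi> v)\<^sup>2 * f v / 4 \<partial>cfg_leb N)"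
        by auto
      then obtain R where \<psi>': "C_diff m N \<psi>" "supported N R \<psi>" by (auto simp: test_functions_iff)
      note T = integral_integrand_density[OF f \<psi>' a parts[OF \<psi>']]
      have "y \<le> ereal (\<integral>v. integrand k b m \<psi> v \<partial>density (cfg_leb N) (\<lambda>v. ennreal (f v)))"
        using \<psi>(2) real T by simp
      also have "\<dots> \<le> ?J" by (rule J_ext_upper[OF \<psi>(1)])
      finally show ?thesis .
    qed (use y in auto)
  qed
qed

text \<open>Here \<open>g = f\<close>: the first derivative vanishes pointwise at the zeros of a
  nonnegative density.\<close>

lemma I_ext_density:
  assumes "regular_density 1 N f"
  shows "I_ext k b N (density (cfg_leb N) (\<lambda>v. ennreal (f v))) = enn2ereal (I_formula k b N f)"
proof -
  have f: "C_diff 1 N f" "C_diff (Suc 0) N f" "\<And>v. v \<in> cfgs N \<Longrightarrow> 0 \<le> f v"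
    using assms by (auto simp: regular_density_def simp del: C_diff.simps)
  have Dc: "continuous_map (cfg_top N) euclideanreal (derivation k b f)"
    using C_diff_derivation[OF b(1) k f(2)] by simp
  have "continuous_map (cfg_top N) euclideanreal (\<lambda>v. - derivation k b f v)"
    using Dc by (rule continuous_map_minus)
  moreover have "(\<integral>v. (derivation k b ^^ 1) \<psi> v * f v \<partial>cfg_leb N) = (\<integral>v. \<psi> v * (- derivation k b f v) \<partial>cfg_leb N)"
    if "C_diff 1 N \<psi>" "supported N R \<psi>" for \<psi> R
    using integral_by_parts[OF b k f(1) that] by simp
  moreover have "(\<integral>v. (if f v = 0 then \<psi> v * (- derivation k b f v) else 0) \<partial>cfg_leb N) = 0" for \<psi>
  proof -
    have "(\<integral>v. (if f v = 0 then \<psi> v * (- derivation k b f v) else 0) \<partial>cfg_leb N) = (\<integral>v. 0 \<partial>cfg_leb N)"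
      by (rule Bochner_Integration.integral_cong[OF refl])
         (use derivation_eq_0_at_zero[OF f(1,3) _ _ k] in \<open>auto simp: space_cfg_leb\<close>)
    then show ?thesis by simp
  qed
  ultimately show ?thesis
    unfolding I_ext_eq I_formula_def
    by (subst J_ext_density[where a = "\<lambda>v. - derivation k b f v" and g = f])
       (use f C_diff_cont[OF f(1)] in auto)
qed

text \<open>The second derivative need not vanish at a zero of \<open>f\<close>. But such a zero is
  also one of \<open>derivation k b f\<close>, and over the zero set of a function its derivation
  integrates to 0 against test functions; hence \<open>g\<close> is the first derivative. Two
  integrations by parts leave no sign.\<close>

lemma K_ext_density:
  assumes "regular_density 2 N f"
  shows "K_ext k b N (density (cfg_leb N) (\<lambda>v. ennreal (f v))) = enn2ereal (K_formula k b N f)"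
proof -
  have f: "C_diff 2 N f" "C_diff (Suc (Suc 0)) N f" "\<And>v. v \<in> cfgs N \<Longrightarrow> 0 \<le> f v"
    using assms by (auto simp: regular_density_def numeral_2_eq_2 simp del: C_diff.simps)
  have f1: "C_diff 1 N f" using C_diff_mono[OF f(1), of 1] by simp
  have Df: "C_diff (Suc 0) N (derivation k b f)" "C_diff 1 N (derivation k b f)"
    using C_diff_derivation[OF b(1) k f(2)] by simp_all
  have D2c: "continuous_map (cfg_top N) euclideanreal (derivation k b (derivation k b f))"
    using C_diff_derivation[OF b(1) k Df(1)] by simp
  have parts: "(\<integral>v. (derivation k b ^^ 2) \<psi> v * f v \<partial>cfg_leb N) = (\<integral>v. \<psi> v * derivation k b (derivation k b f) v \<partial>cfg_leb N)"
    if "C_diff 2 N \<psi>" "supported N R \<psi>" for \<psi> R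
  proof -
    have "C_diff (Suc (Suc 0)) N \<psi>" using that by (simp add: numeral_2_eq_2 del: C_diff.simps)
    then have D\<psi>: "C_diff 1 N (derivation k b \<psi>)" using C_diff_derivation[OF b(1) k] by (simp del: C_diff.simps)
    have \<psi>1: "C_diff 1 N \<psi>" using C_diff_mono[OF that(1), of 1] by simp
    show ?thesis
      using integral_by_parts[OF b k f1 D\<psi> supported_derivation[OF that(2) k]]
        integral_by_parts[OF b k Df(2) \<psi>1 that(2)] by (simp add: numeral_2_eq_2)
  qed
  have zero: "(\<integral>v. (if derivation k b f v = 0 then \<psi> v * derivation k b (derivation k b f) v else 0) \<partial>cfg_leb N) = 0"
    if "C_diff 2 N \<psi>" "supported N R \<psi>" for \<psi> R
    using integral_derivation_zero_set[OF b k Df(2) C_diff_mono[OF that(1), of 1] that(2)] by simp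
  show ?thesis
    unfolding K_ext_eq K_formula_def
    by (rule J_ext_density[where g = "derivation k b f", OF _ C_diff_cont[OF f(1)] f(3) D2c parts zero
          C_diff_cont[OF Df(1)]])
       (use derivation_eq_0_at_zero[OF f1 f(3) _ _ k] in auto)
qed

end

section \<open>Super-additivity by cutoffs in the additional variables\<close>

lemma test_functions_product:
  assumes "j \<le> N" "\<psi> \<in> test_functions m j" "cyl_test m {j..<N} \<eta>"
  shows "(\<lambda>v. \<eta> v * \<psi> (restrict v {..<j})) \<in> test_functions m N"
proof -
  obtain R where \<psi>: "C_diff m j \<psi>" "supported j R \<psi>" using assms(2) by (auto simp: test_functions_iff)
  obtain R' where R': "\<And>v i. i \<in> {j..<N} \<Longrightarrow> R' < norm (v i) \<Longrightarrow> \<eta> v = 0"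
    using cyl_test_support[OF assms(3)] by blast
  have "C_diff m N (\<lambda>v. \<psi> (restrict v {..<j}))"
    unfolding restrict_eq_overlay by (rule C_diff_overlay[OF order_refl assms(1) undefined_in_cfgs \<psi>(1)])
  then have "C_diff m N (\<lambda>v. \<eta> v * \<psi> (restrict v {..<j}))"
    by (intro C_diff_mult cyl_test_C_diff[OF assms(3)])
  moreover have "supported N (max R R') (\<lambda>v. \<eta> v * \<psi> (restrict v {..<j}))"
    unfolding supported_def
  proof safe
    fix v i assume v: "v \<in> cfgs N" "i < N" "max R R' < norm (v i)"
    show "\<eta> v * \<psi> (restrict v {..<j}) = 0"
    proof (cases "i < j")
      case True
      have "restrict v {..<j} \<in> cfgs j" by (simp add: cfgs_iff)
      moreover have "R < norm (restrict v {..<j} i)" using True v(3) by simp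
      ultimately have "\<psi> (restrict v {..<j}) = 0" using \<psi>(2) True unfolding supported_def by blast
      then show ?thesis by simp
    next
      case False
      then have "\<eta> v = 0" using v by (intro R'[of i]) auto
      then show ?thesis by simp
    qed
  qed
  ultimately show ?thesis by (auto simp: test_functions_iff simp del: C_diff.simps)
qed

text \<open>\<open>\<eta>\<close> depends only on variables with index at least \<open>j\<close>,
  hence at least \<open>k\<close>, and is a constant for the derivation; the other factor lives on
  the first \<open>j\<close> variables.\<close>

lemma derivation_pow_product:
  assumes "smooth_field k b" "k \<le> j" "j \<le> N" "\<psi> \<in> test_functions m j" "cyl_test m {j..<N} \<eta>" "v \<in> cfgs N"
  shows "(derivation k b ^^ m) (\<lambda>v. \<eta> v * \<psi> (restrict v {..<j})) v
     = \<eta> v * (derivation k b ^^ m) \<psi> (restrict v {..<j})"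
proof -
  have \<psi>: "C_diff m j \<psi>" using assms(4) by (auto simp: test_functions_iff)
  have C: "C_diff m N (\<lambda>v. \<psi> (restrict v {..<j}))"
    unfolding restrict_eq_overlay by (rule C_diff_overlay[OF order_refl assms(3) undefined_in_cfgs \<psi>])
  have "(derivation k b ^^ m) (\<lambda>v. \<eta> v * \<psi> (restrict v {..<j})) v
      = \<eta> v * (derivation k b ^^ m) (\<lambda>v. \<psi> (restrict v {..<j})) v"
  proof (rule derivation_pow_mult_const[OF assms(1) _ C assms(6)])
    show "\<eta> (v(i := x)) = \<eta> v" if "i < k" for v i x
      by (rule cyl_test_local[OF assms(5)]) (use that assms(2) in auto)
  qed (use assms in simp)
  then show ?thesis
    unfolding restrict_eq_overlay by (simp add: derivation_pow_overlay[OF assms(2)])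
qed

lemma measurable_restrict_cfg: "j \<le> N \<Longrightarrow> (\<lambda>v. restrict v {..<j}) \<in> measurable (pborel {..<N}) (pborel {..<j})"
  by (rule measurable_restrict_subset) auto

lemma prob_measures_cfg_iff: "F \<in> prob_measures (cfg_top N) \<longleftrightarrow> prob_space F \<and> sets F = sets (pborel {..<N})"
  by (simp add: prob_measures_iff sets_borel_of_cfg)

lemma integrable_integrand:
  assumes "smooth_field k b" "k \<le> N" "\<psi> \<in> test_functions m N" "F \<in> prob_measures (cfg_top N)"
  shows "integrable F (integrand k b m \<psi>)"
proof -
  obtain B where B: "\<And>v. v \<in> cfgs N \<Longrightarrow> \<bar>integrand k b m \<psi> v\<bar> \<le> B"
    using integrand_bounded[OF assms(1-3)] by blast
  have F: "prob_space F" "sets F = sets (pborel {..<N})"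
    using assms(4) by (auto simp: prob_measures_cfg_iff)
  show ?thesis
    by (rule integral_bounded(1)[OF F(1)])
       (use integrand_measurable[OF assms(1-3)] B space_prob_measures[OF assms(4)]
        in \<open>auto simp: measurable_cong_sets[OF F(2) refl]\<close>)
qed

text \<open>A cutoff with values between 0 and 1 multiplies the linear term, while the quadratic
  term gets its square, which is smaller. So the new integrand dominates the cutoff times the old
  one, and the cutoff tends to 1.\<close>

lemma J_ext_marginal:
  assumes "smooth_field k b" "k \<le> j" "j \<le> N" "m \<le> 2" "F \<in> prob_measures (cfg_top N)"
  shows "J_ext k b m j (marginal j F) \<le> J_ext k b m N F"
  unfolding J_ext_def[of k b m j]
proof (rule SUP_least)
  fix \<psi> assume \<psi>: "\<psi> \<in> test_functions m j"
  interpret F: prob_space F using assms(5) by (simp add: prob_measures_iff)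
  have sF: "sets F = sets (pborel {..<N})" using assms(5) by (simp add: prob_measures_cfg_iff)
  have spF: "space F = cfgs N" using sets_eq_imp_space_eq[OF sF] by (simp add: space_pborel)
  let ?\<theta> = "\<lambda>v. integrand k b m \<psi> (restrict v {..<j})"
  have \<theta>m: "integrand k b m \<psi> \<in> borel_measurable (pborel {..<j})"
    by (rule integrand_measurable[OF assms(1,2) \<psi>])
  have rm: "(\<lambda>v. restrict v {..<j}) \<in> measurable F (pborel {..<j})"
    using measurable_restrict_cfg[OF assms(3)] by (simp add: measurable_cong_sets[OF sF refl])
  have rm': "(\<lambda>v. restrict v {..<j}) \<in> measurable F (borel_of (cfg_top j))"
    using rm by (simp add: measurable_cong_sets[OF refl sets_borel_of_cfg])
  have \<theta>m': "integrand k b m \<psi> \<in> borel_measurable (borel_of (cfg_top j))"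
    using \<theta>m by (simp add: measurable_cong_sets[OF sets_borel_of_cfg refl])
  obtain B where B: "0 \<le> B" "\<And>v. v \<in> cfgs j \<Longrightarrow> \<bar>integrand k b m \<psi> v\<bar> \<le> B"
    using integrand_bounded[OF assms(1,2) \<psi>] by blast
  have B': "\<bar>?\<theta> v\<bar> \<le> B" for v by (rule B) (simp add: cfgs_iff)
  have cyl: "cyl_test m {j..<N} (cutoff {j..<N} n)" for n using assms(4) by (intro cyl_test_cutoff) auto
  have cm: "cutoff {j..<N} n \<in> borel_measurable F" for n
    using C_diff_measurable[OF cyl_test_C_diff[OF cyl]] by (simp add: measurable_cong_sets[OF sF refl])
  have \<theta>F: "?\<theta> \<in> borel_measurable F" by (rule measurable_compose[OF rm \<theta>m])
  have le: "ereal (\<integral>v. cutoff {j..<N} n v * ?\<theta> v \<partial>F) \<le> J_ext k b m N F" for n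
  proof -
    let ?\<psi> = "\<lambda>v. cutoff {j..<N} n v * \<psi> (restrict v {..<j})"
    have t: "?\<psi> \<in> test_functions m N" by (rule test_functions_product[OF assms(3) \<psi> cyl])
    have kN: "k \<le> N" using assms by simp
    have "(\<integral>v. cutoff {j..<N} n v * ?\<theta> v \<partial>F) \<le> (\<integral>v. integrand k b m ?\<psi> v \<partial>F)"
    proof (rule integral_mono)
      show "integrable F (\<lambda>v. cutoff {j..<N} n v * ?\<theta> v)"
      proof (rule F.integrable_const_bound[where B = B])
        show "AE v in F. norm (cutoff {j..<N} n v * ?\<theta> v) \<le> B"
        proof (rule AE_I2)
          fix v
          have "\<bar>cutoff {j..<N} n v\<bar> * \<bar>?\<theta> v\<bar> \<le> 1 * B"
            using cutoff_bounds[of "{j..<N}" n v] B' B(1) by (intro mult_mono) auto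
          then show "norm (cutoff {j..<N} n v * ?\<theta> v) \<le> B" by (simp add: abs_mult)
        qed
      qed (intro borel_measurable_times cm \<theta>F)
      show "integrable F (integrand k b m ?\<psi>)"
        by (rule integrable_integrand[OF assms(1) kN t assms(5)])
      fix v assume "v \<in> space F"
      then have v: "v \<in> cfgs N" by (simp add: spF)
      have "(cutoff {j..<N} n v)\<^sup>2 * (\<psi> (restrict v {..<j}))\<^sup>2 \<le> cutoff {j..<N} n v * (\<psi> (restrict v {..<j}))\<^sup>2"
        using cutoff_bounds[of "{j..<N}" n v]
        by (intro mult_right_mono) (auto simp: power2_eq_square mult_left_le)
      then show "cutoff {j..<N} n v * ?\<theta> v \<le> integrand k b m ?\<psi> v"
        unfolding integrand_def derivation_pow_product[OF assms(1-3) \<psi> cyl v]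
        by (simp add: right_diff_distrib power_mult_distrib)
    qed
    also have "ereal \<dots> \<le> J_ext k b m N F" by (rule J_ext_upper[OF t])
    finally show ?thesis by simp
  qed
  have "(\<lambda>n. \<integral>v. cutoff {j..<N} n v * ?\<theta> v \<partial>F) \<longlonglongrightarrow> (\<integral>v. ?\<theta> v \<partial>F)"
  proof (rule integral_dominated_convergence[where w = "\<lambda>_. B"])
    show "AE v in F. (\<lambda>n. cutoff {j..<N} n v * ?\<theta> v) \<longlonglongrightarrow> ?\<theta> v"
    proof (rule AE_I2)
      fix v
      have "(\<lambda>n. cutoff {j..<N} n v * ?\<theta> v) \<longlonglongrightarrow> 1 * ?\<theta> v" by (intro tendsto_intros cutoff_tendsto)
      then show "(\<lambda>n. cutoff {j..<N} n v * ?\<theta> v) \<longlonglongrightarrow> ?\<theta> v" by simp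
    qed
    show "AE v in F. norm (cutoff {j..<N} n v * ?\<theta> v) \<le> B" for n
    proof (rule AE_I2)
      fix v
      have "\<bar>cutoff {j..<N} n v\<bar> * \<bar>?\<theta> v\<bar> \<le> 1 * B"
        using cutoff_bounds[of "{j..<N}" n v] B' B(1) by (intro mult_mono) auto
      then show "norm (cutoff {j..<N} n v * ?\<theta> v) \<le> B" by (simp add: abs_mult)
    qed
  qed (use cm \<theta>F in auto)
  then have "(\<integral>v. integrand k b m \<psi> v \<partial>marginal j F) = (\<integral>v. ?\<theta> v \<partial>F)"
    unfolding marginal_def using integral_distr[OF rm' \<theta>m'] by simp
  moreover have "(\<lambda>n. ereal (\<integral>v. cutoff {j..<N} n v * ?\<theta> v \<partial>F)) \<longlonglongrightarrow> ereal (\<integral>v. ?\<theta> v \<partial>F)"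
    by (rule tendsto_ereal) fact
  then have "ereal (\<integral>v. ?\<theta> v \<partial>F) \<le> J_ext k b m N F"
    by (rule LIMSEQ_le_const2) (use le in auto)
  ultimately show "ereal (\<integral>v. integrand k b m \<psi> v \<partial>marginal j F) \<le> J_ext k b m N F" by simp
qed

section \<open>Measurable selection of test functions\<close>

text \<open>\<open>cfg_top N\<close> embeds in the space of all sequences by the identity, with
  \<open>restrict\<close> as a continuous retraction, so the traces of a countable basis form a
  basis.\<close>

lemma second_countable_cfg_top: "second_countable (cfg_top N)"
proof -
  obtain \<B> :: "config set set" where \<B>: "countable \<B>" "topological_basis \<B>"
    using ex_countable_basis by blast
  have id: "continuous_map (cfg_top N) euclidean (\<lambda>v. v)"
    unfolding euclidean_product_topology[symmetric] continuous_map_componentwise_UNIV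
  proof
    fix i
    show "continuous_map (cfg_top N) euclidean (\<lambda>v. v i)"
    proof (cases "i < N")
      case True
      then show ?thesis unfolding cfg_top_def by (intro continuous_map_product_projection) auto
    next
      case False
      show ?thesis
        by (rule continuous_map_eq[of _ _ "\<lambda>_. undefined"]) (use False in \<open>auto simp: cfgs_iff extensional_def\<close>)
    qed
  qed
  show ?thesis
    unfolding second_countable_def
  proof (intro exI[of _ "(\<lambda>U. {v \<in> cfgs N. v \<in> U}) ` \<B>"] conjI ballI allI impI)
    show "countable ((\<lambda>U. {v \<in> cfgs N. v \<in> U}) ` \<B>)" using \<B>(1) by simp
    fix V assume "V \<in> (\<lambda>U. {v \<in> cfgs N. v \<in> U}) ` \<B>"
    then obtain U where U: "U \<in> \<B>" "V = {v \<in> cfgs N. v \<in> U}" by auto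
    then have "openin euclidean U" using topological_basis_open[OF \<B>(2)] by simp
    from openin_continuous_map_preimage[OF id this] show "openin (cfg_top N) V" unfolding U(2) .
  next
    fix U x assume U: "openin (cfg_top N) U \<and> x \<in> U"
    then have x: "x \<in> cfgs N" using openin_subset by blast
    have "open {v :: config. restrict v {..<N} \<in> U}"
      using openin_continuous_map_preimage[OF continuous_map_restrict_cfg, of N U] U by simp
    moreover have "restrict x {..<N} = x" using x by (simp add: cfgs_iff extensional_restrict)
    ultimately obtain V where V: "V \<in> \<B>" "x \<in> V" "V \<subseteq> {v. restrict v {..<N} \<in> U}"
      using topological_basisE[OF \<B>(2), of "{v. restrict v {..<N} \<in> U}" x] U by auto
    have "{v \<in> cfgs N. v \<in> V} \<subseteq> U"
    proof
      fix v assume "v \<in> {v \<in> cfgs N. v \<in> V}"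
      then have "restrict v {..<N} \<in> U" "restrict v {..<N} = v"
        using V(3) by (auto simp: cfgs_iff extensional_restrict)
      then show "v \<in> U" by simp
    qed
    then show "\<exists>V\<in>(\<lambda>U. {v \<in> cfgs N. v \<in> U}) ` \<B>. x \<in> V \<and> V \<subseteq> U"
      using V x by (intro bexI[of _ "{v \<in> cfgs N. v \<in> V}"]) auto
  qed
qed

text \<open>A function is encoded, up to the accuracy \<open>1 / (m + 1)\<close>, by finitely many pairs of a basic
  open set and a rational value. There are only countably many codes.\<close>

lemma countable_uniformly_dense_subset:
  fixes \<theta> :: "'a \<Rightarrow> config \<Rightarrow> real"
  assumes "\<And>a. a \<in> A \<Longrightarrow> continuous_map (cfg_top N) euclideanreal (\<theta> a)"
    and "\<And>a. a \<in> A \<Longrightarrow> \<exists>R. supported N R (\<theta> a)"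
  obtains A0 where "countable A0" "A0 \<subseteq> A"
    "\<And>a \<epsilon>. a \<in> A \<Longrightarrow> 0 < \<epsilon> \<Longrightarrow> \<exists>a'\<in>A0. \<forall>v\<in>cfgs N. \<bar>\<theta> a v - \<theta> a' v\<bar> < \<epsilon>"
proof -
  obtain \<B> where "countable \<B> \<and> (\<forall>V\<in>\<B>. openin (cfg_top N) V) \<and>
      (\<forall>U x. openin (cfg_top N) U \<and> x \<in> U \<longrightarrow> (\<exists>V\<in>\<B>. x \<in> V \<and> V \<subseteq> U))"
    using second_countable_cfg_top[of N] unfolding second_countable_def ..
  then have \<B>: "countable \<B>" "\<And>V. V \<in> \<B> \<Longrightarrow> openin (cfg_top N) V"
    "\<And>U x. openin (cfg_top N) U \<Longrightarrow> x \<in> U \<Longrightarrow> \<exists>V \<in> \<B>. x \<in> V \<and> V \<subseteq> U"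
    by simp_all
  define code where "code = (\<lambda>(m::nat, P) a. (\<forall>(U, q)\<in>P. \<forall>v\<in>U. \<bar>\<theta> a v - q\<bar> < 1 / real (Suc m)) \<and>
     (\<forall>v\<in>cfgs N. v \<notin> \<Union>(fst ` P) \<longrightarrow> \<theta> a v = 0))"
  define Codes :: "(nat \<times> (config set \<times> real) set) set" where
    "Codes = UNIV \<times> {P. finite P \<and> P \<subseteq> \<B> \<times> \<rat>}"
  have cC: "countable Codes"
    unfolding Codes_def using \<B>(1) countable_rat
    by (intro countable_SIGMA countable_Collect_finite_subset) auto
  \<comment> \<open>One function is picked for every code that occurs; sharing a code makes two
    functions uniformly close.\<close>
  define A0 where "A0 = (\<lambda>c. SOME a. a \<in> A \<and> code c a) ` {c \<in> Codes. \<exists>a\<in>A. code c a}"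
  have some: "(SOME a. a \<in> A \<and> code c a) \<in> A \<and> code c (SOME a. a \<in> A \<and> code c a)" if "\<exists>a\<in>A. code c a" for c
    using someI_ex[of "\<lambda>a. a \<in> A \<and> code c a"] that by blast
  have ex: "\<exists>P. (m, P) \<in> Codes \<and> code (m, P) a" if a: "a \<in> A" for m a
  proof -
    obtain R where R: "supported N R (\<theta> a)" using assms(2)[OF a] by blast
    have "\<exists>U q. U \<in> \<B> \<and> q \<in> \<rat> \<and> x \<in> U \<and> (\<forall>v\<in>U. \<bar>\<theta> a v - q\<bar> < 1 / real (Suc m))" if x: "x \<in> cfg_box N R" for x
    proof -
      have xN: "x \<in> cfgs N" using x cfg_box_subset by blast
      \<comment> \<open>A rational number strictly within the tolerance of
        \<open>\<theta> a x\<close> leaves room for a whole neighbourhood of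
        \<open>x\<close>.\<close>
      obtain q where q: "q \<in> \<rat>" "\<theta> a x - 1 / real (Suc m) < q" "q < \<theta> a x"
        using Rats_dense_in_real[of "\<theta> a x - 1 / real (Suc m)" "\<theta> a x"] by auto
      have "openin (cfg_top N) {v \<in> cfgs N. \<theta> a v \<in> ball q (1 / real (Suc m))}"
        by (rule openin_continuous_map_preimage[OF assms(1)[OF a]]) simp
      moreover have "x \<in> {v \<in> cfgs N. \<theta> a v \<in> ball q (1 / real (Suc m))}"
        using xN q by (simp add: dist_real_def)
      ultimately obtain U where "U \<in> \<B>" "x \<in> U" "U \<subseteq> {v \<in> cfgs N. \<theta> a v \<in> ball q (1 / real (Suc m))}"
        using \<B>(3) by blast
      then show ?thesis using q(1)
        by (intro exI[of _ U] exI[of _ q]) (auto simp: dist_real_def abs_minus_commute subset_iff)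
    qed
    then obtain U q where Uq: "\<And>x. x \<in> cfg_box N R \<Longrightarrow> U x \<in> \<B> \<and> q x \<in> \<rat> \<and> x \<in> U x \<and>
        (\<forall>v\<in>U x. \<bar>\<theta> a v - q x\<bar> < 1 / real (Suc m))" by metis
    have "\<exists>\<F>. finite \<F> \<and> \<F> \<subseteq> U ` cfg_box N R \<and> cfg_box N R \<subseteq> \<Union>\<F>"
      by (rule compactinD[OF compactin_cfg_box]) (use Uq \<B>(2) in auto)
    then obtain X where X: "X \<subseteq> cfg_box N R" "finite X" "cfg_box N R \<subseteq> \<Union>(U ` X)"
      by (metis finite_subset_image)
    let ?P = "(\<lambda>x. (U x, q x)) ` X"
    have "(m, ?P) \<in> Codes" using X Uq by (auto simp: Codes_def)
    moreover have "code (m, ?P) a"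
      using X Uq R by (auto simp: code_def supported_iff_box image_image)
    ultimately show ?thesis by blast
  qed
  show ?thesis
  proof
    show "countable A0" unfolding A0_def by (intro countable_image countable_subset[OF _ cC]) auto
    show "A0 \<subseteq> A" unfolding A0_def using some by blast
    fix a and \<epsilon> :: real assume a: "a \<in> A" and \<epsilon>: "0 < \<epsilon>"
    \<comment> \<open>Both functions lie within \<open>1 / real (Suc m)\<close> of the same rational
      value, which costs half of \<open>\<epsilon>\<close> each.\<close>
    obtain m where m: "1 / real (Suc m) < \<epsilon> / 2" using \<epsilon> nat_approx_posE[of "\<epsilon> / 2"] by auto
    obtain P where P: "(m, P) \<in> Codes" "code (m, P) a" using ex[OF a] by blast
    define a' where "a' = (SOME a. a \<in> A \<and> code (m, P) a)"
    have a': "a' \<in> A0" "code (m, P) a'"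
      using P a some[of "(m, P)"] unfolding A0_def a'_def by blast+
    have "\<bar>\<theta> a v - \<theta> a' v\<bar> < \<epsilon>" if v: "v \<in> cfgs N" for v
    proof (cases "v \<in> \<Union>(fst ` P)")
      case True
      then obtain U q where "(U, q) \<in> P" "v \<in> U" by auto
      then have "\<bar>\<theta> a v - q\<bar> < 1 / real (Suc m)" "\<bar>\<theta> a' v - q\<bar> < 1 / real (Suc m)"
        using P(2) a'(2) unfolding code_def by blast+
      then show ?thesis using m by linarith
    next
      case False
      then have "\<theta> a v = 0" "\<theta> a' v = 0" using P(2) a'(2) v unfolding code_def by blast+
      then show ?thesis using \<epsilon> by simp
    qed
    then show "\<exists>a'\<in>A0. \<forall>v\<in>cfgs N. \<bar>\<theta> a v - \<theta> a' v\<bar> < \<epsilon>" using a'(1) by blast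
  qed
qed

text \<open>Density is taken among the integrands rather than the test functions, so no topology
  involving derivatives enters; under a probability measure the integrals differ by at most the
  uniform distance. The zero function comes first, which later makes maxima over initial segments
  nonnegative.\<close>

lemma J_ext_countable:
  assumes "smooth_field k b" "k \<le> N"
  obtains \<Psi> :: "nat \<Rightarrow> config \<Rightarrow> real" where "\<And>n. \<Psi> n \<in> test_functions m N" "\<Psi> 0 = (\<lambda>_. 0)"
    "\<And>F. F \<in> prob_measures (cfg_top N) \<Longrightarrow> J_ext k b m N F = (SUP n. ereal (\<integral>v. integrand k b m (\<Psi> n) v \<partial>F))"
proof -
  obtain A0 where A0: "countable A0" "A0 \<subseteq> test_functions m N"
    "\<And>\<psi> \<epsilon>. \<psi> \<in> test_functions m N \<Longrightarrow> 0 < \<epsilon> \<Longrightarrow>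
       \<exists>\<psi>'\<in>A0. \<forall>v\<in>cfgs N. \<bar>integrand k b m \<psi> v - integrand k b m \<psi>' v\<bar> < \<epsilon>"
  proof (rule countable_uniformly_dense_subset[of "test_functions m N" N "integrand k b m"])
    fix \<psi> assume "\<psi> \<in> test_functions m N"
    then obtain R where \<psi>: "C_diff m N \<psi>" "supported N R \<psi>" by (auto simp: test_functions_iff)
    show "continuous_map (cfg_top N) euclideanreal (integrand k b m \<psi>)" by (rule integrand_continuous[OF assms \<psi>(1)])
    show "\<exists>R. supported N R (integrand k b m \<psi>)" using supported_integrand[OF \<psi>(2) assms(2)] by blast
  qed blast
  \<comment> \<open>Inserting 0 keeps the set nonempty, as its enumeration requires.\<close>
  define \<Psi> where "\<Psi> = from_nat_into (insert (\<lambda>_. 0) A0)"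
  define \<Phi> where "\<Phi> = case_nat (\<lambda>_. 0) \<Psi>"
  have rng: "range \<Psi> = insert (\<lambda>_. 0) A0"
    unfolding \<Psi>_def using A0(1) by (intro range_from_nat_into) auto
  have \<Psi>: "\<Psi> n \<in> test_functions m N" for n
    using rng A0(2) zero_test_function by (metis insert_iff rangeI subsetD)
  show ?thesis
  proof (rule that[of \<Phi>])
    show \<Phi>: "\<Phi> n \<in> test_functions m N" for n
      using \<Psi> zero_test_function by (auto simp: \<Phi>_def split: nat.split)
    show "\<Phi> 0 = (\<lambda>_. 0)" by (simp add: \<Phi>_def)
    fix F assume F: "F \<in> prob_measures (cfg_top N)"
    then interpret F: prob_space F by (simp add: prob_measures_iff)
    have sF: "sets F = sets (pborel {..<N})" using F by (simp add: prob_measures_cfg_iff)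
    have spF: "space F = cfgs N" using sets_eq_imp_space_eq[OF sF] by (simp add: space_pborel)
    note int = integrable_integrand[OF assms _ F]
    show "J_ext k b m N F = (SUP n. ereal (\<integral>v. integrand k b m (\<Phi> n) v \<partial>F))"
    proof (rule antisym)
      show "J_ext k b m N F \<le> (SUP n. ereal (\<integral>v. integrand k b m (\<Phi> n) v \<partial>F))"
        unfolding J_ext_def
      proof (rule SUP_least)
        fix \<psi> assume \<psi>: "\<psi> \<in> test_functions m N"
        show "ereal (\<integral>v. integrand k b m \<psi> v \<partial>F) \<le> (SUP n. ereal (\<integral>v. integrand k b m (\<Phi> n) v \<partial>F))"
        proof (rule ereal_le_epsilon2)
          fix \<epsilon> :: real assume \<epsilon>: "0 < \<epsilon>"
          obtain \<psi>' where \<psi>': "\<psi>' \<in> A0" "\<And>v. v \<in> cfgs N \<Longrightarrow> \<bar>integrand k b m \<psi> v - integrand k b m \<psi>' v\<bar> < \<epsilon>"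
            using A0(3)[OF \<psi> \<epsilon>] by blast
          obtain n where n: "\<psi>' = \<Phi> (Suc n)" using \<psi>'(1) rng unfolding \<Phi>_def by fastforce
          have "(\<integral>v. integrand k b m \<psi> v \<partial>F) \<le> (\<integral>v. integrand k b m \<psi>' v + \<epsilon> \<partial>F)"
          proof (rule integral_mono)
            fix v assume "v \<in> space F"
            then show "integrand k b m \<psi> v \<le> integrand k b m \<psi>' v + \<epsilon>" using \<psi>'(2)[of v] by (simp add: spF abs_less_iff)
          qed (use int[OF \<psi>] int[OF \<Phi>] n in auto)
          also have "\<dots> = (\<integral>v. integrand k b m \<psi>' v \<partial>F) + \<epsilon>"
            using int[OF \<Phi>] n by (simp add: F.prob_space)
          finally have "ereal (\<integral>v. integrand k b m \<psi> v \<partial>F) \<le> ereal (\<integral>v. integrand k b m (\<Phi> (Suc n)) v \<partial>F) + ereal \<epsilon>"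
            by (simp add: n)
          also have "\<dots> \<le> (SUP n. ereal (\<integral>v. integrand k b m (\<Phi> n) v \<partial>F)) + ereal \<epsilon>"
            by (intro add_right_mono SUP_upper) auto
          finally show "ereal (\<integral>v. integrand k b m \<psi> v \<partial>F) \<le> (SUP n. ereal (\<integral>v. integrand k b m (\<Phi> n) v \<partial>F)) + ereal \<epsilon>" .
        qed
      qed
      show "(SUP n. ereal (\<integral>v. integrand k b m (\<Phi> n) v \<partial>F)) \<le> J_ext k b m N F"
        by (intro SUP_least J_ext_upper \<Phi>)
    qed
  qed
qed

text \<open>At a fixed configuration, \<open>i\<close> is the indicator of the selected index
  \<open>s\<close>, \<open>d\<close> the error of its smooth approximation, and \<open>D n\<close>
  and \<open>P n\<close> are the values of the derivative of the \<open>n\<close>-th candidate and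
  of the candidate. All errors are bounded through the sum of the \<open>\<bar>d n\<bar>\<close>,
  and this through the sum of squares by the inequalities of Young and Cauchy-Schwarz.\<close>

lemma selection_bound:
  fixes i d D P :: "nat \<Rightarrow> real"
  assumes "s \<le> L" "\<And>n. i n = (if n = s then 1 else 0)" "0 < \<tau>" "0 \<le> C"
    and "\<And>n. n \<le> L \<Longrightarrow> \<bar>D n\<bar> \<le> C" "\<And>n. n \<le> L \<Longrightarrow> \<bar>P n\<bar> \<le> C"
  defines "K \<equiv> C + C\<^sup>2"
  shows "(D s - (P s)\<^sup>2 / 4) - K * real (Suc L) * \<tau> - (K / \<tau> + K * real (Suc L)) * (\<Sum>n\<le>L. (d n)\<^sup>2)
    \<le> (\<Sum>n\<le>L. (i n + d n) * D n) - (\<Sum>n\<le>L. (i n + d n) * P n)\<^sup>2 / 4"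
proof -
  define S where "S = (\<Sum>n\<le>L. \<bar>d n\<bar>)"
  define Q where "Q = (\<Sum>n\<le>L. (d n)\<^sup>2)"
  have S: "0 \<le> S" unfolding S_def by (intro sum_nonneg) auto
  have sel: "(\<Sum>n\<le>L. (i n + d n) * X n) = X s + (\<Sum>n\<le>L. d n * X n)" for X :: "nat \<Rightarrow> real"
  proof -
    have "(\<Sum>n\<le>L. i n * X n) = X s" using assms(1,2) by (simp add: if_distrib[of "\<lambda>x. x * _"] sum.delta cong: if_cong)
    then show ?thesis by (simp add: distrib_right sum.distrib)
  qed
  have err: "\<bar>\<Sum>n\<le>L. d n * X n\<bar> \<le> C * S" if "\<And>n. n \<le> L \<Longrightarrow> \<bar>X n\<bar> \<le> C" for X :: "nat \<Rightarrow> real"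
  proof -
    have "\<bar>\<Sum>n\<le>L. d n * X n\<bar> \<le> (\<Sum>n\<le>L. \<bar>d n * X n\<bar>)" by (rule sum_abs)
    also have "\<dots> \<le> (\<Sum>n\<le>L. C * \<bar>d n\<bar>)"
    proof (rule sum_mono)
      fix n assume "n \<in> {..L}"
      then have "\<bar>d n\<bar> * \<bar>X n\<bar> \<le> \<bar>d n\<bar> * C" using that by (intro mult_left_mono) auto
      then show "\<bar>d n * X n\<bar> \<le> C * \<bar>d n\<bar>" by (simp add: abs_mult mult.commute)
    qed
    finally show ?thesis by (simp add: S_def sum_distrib_left)
  qed
  define E where "E = (\<Sum>n\<le>L. d n * P n)"
  have E: "\<bar>E\<bar> \<le> C * S" unfolding E_def by (rule err[OF assms(6)])
  have D: "\<bar>\<Sum>n\<le>L. d n * D n\<bar> \<le> C * S" by (rule err[OF assms(5)])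
  have PE: "P s * E \<le> C * (C * S)"
  proof -
    have "P s * E \<le> \<bar>P s\<bar> * \<bar>E\<bar>" by (metis abs_ge_self abs_mult)
    also have "\<dots> \<le> C * (C * S)" using E assms(1,4,6) by (intro mult_mono) auto
    finally show ?thesis .
  qed
  have EE: "E\<^sup>2 \<le> (C * S)\<^sup>2" using E by (metis abs_ge_zero power2_abs power_mono)
  have "S \<le> (\<Sum>n\<le>L. \<tau> + (d n)\<^sup>2 / \<tau>)"
    unfolding S_def by (intro sum_mono abs_le_add_square_divide assms(3))
  then have S1: "S \<le> real (Suc L) * \<tau> + Q / \<tau>" by (simp add: sum.distrib Q_def sum_divide_distrib)
  have S2: "S\<^sup>2 \<le> Q * real (Suc L)"
    using sum_squared_le_sum_of_squares[of "\<lambda>n. \<bar>d n\<bar>" "{..L}"] by (simp add: S_def Q_def)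
  have K: "0 \<le> K" "C\<^sup>2 \<le> K" using assms(4) by (auto simp: K_def)
  have "(P s + E)\<^sup>2 = (P s)\<^sup>2 + 2 * (P s * E) + E\<^sup>2" by (simp add: power2_sum)
  then have "(D s - (P s)\<^sup>2 / 4) - C * S - C * (C * S) - (C * S)\<^sup>2 \<le> D s + (\<Sum>n\<le>L. d n * D n) - (P s + E)\<^sup>2 / 4"
  proof -
    assume eq: "(P s + E)\<^sup>2 = (P s)\<^sup>2 + 2 * (P s * E) + E\<^sup>2"
    have "0 \<le> C * (C * S)" "0 \<le> (C * S)\<^sup>2" using assms(4) S by simp_all
    moreover have "t - u / 4 - x - y - z \<le> t + e - (u + 2 * p + q) / 4"
      if "\<bar>e\<bar> \<le> x" "p \<le> y" "q \<le> z" "0 \<le> y" "0 \<le> z" for t u x y z e p q :: real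
    proof -
      have "- x \<le> e" using that(1) by simp
      then show ?thesis using that(2-) by (simp add: field_simps)
    qed
    ultimately show ?thesis using D PE EE unfolding eq by blast
  qed
  note B1 = this
  have B2: "C * S + C * (C * S) = K * S" by (simp add: K_def power2_eq_square algebra_simps)
  have B3: "(C * S)\<^sup>2 \<le> K * S\<^sup>2" using K by (simp add: power_mult_distrib mult_right_mono)
  have B4: "K * S \<le> K * (real (Suc L) * \<tau> + Q / \<tau>)" using S1 K by (intro mult_left_mono)
  have B5: "K * S\<^sup>2 \<le> K * (Q * real (Suc L))" using S2 K by (intro mult_left_mono)
  have B6: "K * (real (Suc L) * \<tau> + Q / \<tau>) + K * (Q * real (Suc L))
      = K * real (Suc L) * \<tau> + (K / \<tau> + K * real (Suc L)) * Q"
    by (simp add: algebra_simps)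
  have "a - t \<le> b" if "a - p - q - r \<le> b" "p + q = x" "r \<le> y" "x \<le> u" "y \<le> w" "u + w = t"
    for a b p q r x y u w t :: real using that by linarith
  from this[OF B1 B2 B3 B4 B5 B6]
  have "(D s - (P s)\<^sup>2 / 4) - (K * real (Suc L) * \<tau> + (K / \<tau> + K * real (Suc L)) * Q)
      \<le> D s + (\<Sum>n\<le>L. d n * D n) - (P s + E)\<^sup>2 / 4" .
  then show ?thesis unfolding sel E_def[symmetric] Q_def[symmetric] by (simp add: diff_diff_eq)
qed

lemma test_functions_add:
  assumes "f \<in> test_functions m N" "g \<in> test_functions m N"
  shows "(\<lambda>v. f v + g v) \<in> test_functions m N"
proof -
  obtain R R' where R: "C_diff m N f" "supported N R f" "C_diff m N g" "supported N R' g"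
    using assms by (auto simp: test_functions_iff)
  have "supported N (max R R') f" "supported N (max R R') g"
    by (auto intro: supported_mono[OF R(2)] supported_mono[OF R(4)])
  then have "supported N (max R R') (\<lambda>v. f v + g v)" unfolding supported_def by simp
  then show ?thesis using C_diff_add[OF R(1,3)] by (auto simp: test_functions_iff simp del: C_diff.simps)
qed

lemma test_functions_sum:
  "(\<And>a. a \<in> A \<Longrightarrow> f a \<in> test_functions m N) \<Longrightarrow> (\<lambda>v. \<Sum>a\<in>A. f a v) \<in> test_functions m N"
  by (induction A rule: infinite_finite_induct) (auto intro: test_functions_add zero_test_function)

text \<open>The selected function may be discontinuous in the variables that enter \<open>s\<close>,
  but these are not differentiated. The indicators of the finitely many level sets of
  \<open>s\<close> are replaced by cylindrical functions close to them in L2 of \<open>F\<close>;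
  the resulting combination of the candidates is a genuine test function.\<close>

lemma J_ext_selection:
  fixes \<Psi> :: "nat \<Rightarrow> config \<Rightarrow> real"
  assumes "smooth_field k b" "k \<le> j" "m \<le> 2" and F: "F \<in> prob_measures (cfg_top j)"
    and \<Psi>: "\<And>n. \<Psi> n \<in> test_functions m k"
    and s: "s \<in> measurable (pborel {k..<j}) (count_space UNIV)" "\<And>w. s w \<le> L"
  shows "ereal (\<integral>v. integrand k b m (\<Psi> (s (restrict v {k..<j}))) (restrict v {..<k}) \<partial>F) \<le> J_ext k b m j F"
proof -
  interpret F: prob_space F using F by (simp add: prob_measures_iff)
  have sF: "sets F = sets (pborel {..<j})" using F by (simp add: prob_measures_cfg_iff)
  have spF: "space F = cfgs j" using sets_eq_imp_space_eq[OF sF] by (simp add: space_pborel)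
  have rk[measurable]: "(\<lambda>v. restrict v {..<k}) \<in> measurable F (pborel {..<k})"
    using measurable_restrict_cfg[OF assms(2)] by (simp add: measurable_cong_sets[OF sF refl])
  have rJ[measurable]: "(\<lambda>v. restrict v {k..<j}) \<in> measurable F (pborel {k..<j})"
    using measurable_restrict_subset[of "{k..<j}" "{..<j}" "\<lambda>_. borel"]
    by (simp add: measurable_cong_sets[OF sF refl] subset_iff)
  let ?D = "\<lambda>n v. (derivation k b ^^ m) (\<Psi> n) (restrict v {..<k})"
  let ?P = "\<lambda>n v. \<Psi> n (restrict v {..<k})"
  let ?X = "\<lambda>v. integrand k b m (\<Psi> (s (restrict v {k..<j}))) (restrict v {..<k})"
  have "\<exists>C. (\<forall>v. \<bar>?D n v\<bar> \<le> C) \<and> (\<forall>v. \<bar>?P n v\<bar> \<le> C)" for n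
  proof -
    obtain R where R: "C_diff m k (\<Psi> n)" "supported k R (\<Psi> n)" using \<Psi>[of n] by (auto simp: test_functions_iff)
    obtain C1 where C1: "\<And>v. v \<in> cfgs k \<Longrightarrow> \<bar>\<Psi> n v\<bar> \<le> C1"
      using supported_bounded[OF C_diff_cont[OF R(1)] R(2)] by blast
    have "C_diff 0 k ((derivation k b ^^ m) (\<Psi> n))"
      using C_diff_derivation_pow[OF assms(1) order_refl, of m 0 "\<Psi> n"] R(1) by simp
    then obtain C2 where C2: "\<And>v. v \<in> cfgs k \<Longrightarrow> \<bar>(derivation k b ^^ m) (\<Psi> n) v\<bar> \<le> C2"
      using supported_bounded[OF C_diff_cont supported_derivation_pow[OF R(2) order_refl]] by blast
    show ?thesis
      using C1 C2 by (intro exI[of _ "max C1 C2"]) (auto simp: cfgs_iff le_max_iff_disj)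
  qed
  then have "\<forall>n. \<exists>C. (\<forall>v. \<bar>?D n v\<bar> \<le> C) \<and> (\<forall>v. \<bar>?P n v\<bar> \<le> C)" by blast
  then obtain C0 where "\<forall>n. (\<forall>v. \<bar>?D n v\<bar> \<le> C0 n) \<and> (\<forall>v. \<bar>?P n v\<bar> \<le> C0 n)"
    unfolding choice_iff by blast
  then have C0: "\<bar>?D n v\<bar> \<le> C0 n" "\<bar>?P n v\<bar> \<le> C0 n" for n v by blast+
  define C where "C = (\<Sum>n\<le>L. \<bar>C0 n\<bar>)"
  have "C0 n \<le> C" if "n \<le> L" for n
  proof -
    have "\<bar>C0 n\<bar> \<le> (\<Sum>n\<le>L. \<bar>C0 n\<bar>)" by (rule member_le_sum) (use that in auto)
    then show ?thesis unfolding C_def by linarith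
  qed
  then have C: "\<bar>?D n v\<bar> \<le> C" "\<bar>?P n v\<bar> \<le> C" if "n \<le> L" for n v
    using C0[of n v] order_trans that by blast+
  have C_nn: "0 \<le> C" unfolding C_def by (intro sum_nonneg) auto
  have Dm: "?D n \<in> borel_measurable F" "?P n \<in> borel_measurable F" for n
  proof -
    have t: "C_diff m k (\<Psi> n)" using \<Psi>[of n] by (auto simp: test_functions_iff)
    have "C_diff 0 k ((derivation k b ^^ m) (\<Psi> n))"
      using C_diff_derivation_pow[OF assms(1) order_refl, of m 0 "\<Psi> n"] t by simp
    then show "?D n \<in> borel_measurable F" by (rule measurable_compose[OF rk C_diff_measurable])
    show "?P n \<in> borel_measurable F" by (rule measurable_compose[OF rk C_diff_measurable[OF t]])
  qed
  have sm: "(\<lambda>v. s (restrict v {k..<j})) \<in> measurable F (count_space UNIV)"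
    by (rule measurable_compose[OF rJ s(1)])
  have Xeq: "?X v = (\<Sum>n\<le>L. (if s (restrict v {k..<j}) = n then ?D n v - (?P n v)\<^sup>2 / 4 else 0))" for v
    using s(2) by (simp add: sum.delta integrand_def)
  have Xm: "?X \<in> borel_measurable F"
  proof -
    have "Measurable.pred F (\<lambda>v. s (restrict v {k..<j}) = n)" for n using sm by measurable
    then have "(\<lambda>v. \<Sum>n\<le>L. (if s (restrict v {k..<j}) = n then ?D n v - (?P n v)\<^sup>2 / 4 else 0)) \<in> borel_measurable F"
      using Dm by (intro borel_measurable_sum measurable_If borel_measurable_diff borel_measurable_divide
        borel_measurable_power) auto
    then show ?thesis using Xeq by presburger
  qed
  have Xb: "\<bar>?X v\<bar> \<le> C + C\<^sup>2" for v
  proof -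
    let ?n = "s (restrict v {k..<j})"
    have "\<bar>?P ?n v\<bar>\<^sup>2 \<le> C\<^sup>2" by (intro power_mono C(2)[OF s(2)] abs_ge_zero)
    then have p: "(?P ?n v)\<^sup>2 \<le> C\<^sup>2" by (simp only: power2_abs)
    have "\<bar>x - y / 4\<bar> \<le> C + z" if "\<bar>x\<bar> \<le> C" "y \<le> z" "0 \<le> y" for x y z :: real using that by linarith
    from this[OF C(1)[OF s(2)] p zero_le_power2] show ?thesis unfolding integrand_def .
  qed
  have Xi: "integrable F ?X" using Xm Xb by (intro F.integrable_const_bound[where B = "C + C\<^sup>2"]) auto
  define A where "A = (\<lambda>n. {w \<in> space (pborel {k..<j}). s w = n})"
  have Am: "A n \<in> sets (pborel {k..<j})" for n unfolding A_def using s(1) by measurable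
  have approx: "ereal ((\<integral>v. ?X v \<partial>F) - \<delta>) \<le> J_ext k b m j F" if \<delta>: "0 < \<delta>" for \<delta>
  proof -
    define K where "K = C + C\<^sup>2"
    have K: "0 \<le> K" using C_nn by (simp add: K_def)
    \<comment> \<open>\<open>\<tau>\<close> and \<open>\<epsilon>\<close> make the two error terms
      of \<open>selection_bound\<close> at most \<open>\<delta> / 2\<close> each; the 1 added to
      \<open>K\<close> and in \<open>M\<close> avoids division by 0.\<close>
    define \<tau> where "\<tau> = \<delta> / (2 * ((K + 1) * real (Suc L)))"
    have \<tau>: "0 < \<tau>" using \<delta> K by (simp add: \<tau>_def)
    define M where "M = K / \<tau> + K * real (Suc L) + 1"
    have M: "0 < M" using K \<tau> by (simp add: M_def add_nonneg_pos)
    define \<epsilon> where "\<epsilon> = \<delta> / (2 * (M * real (Suc L)))"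
    have \<epsilon>: "0 < \<epsilon>" using \<delta> M by (simp add: \<epsilon>_def)
    have "\<exists>\<eta>. cyl_test m {k..<j} \<eta> \<and>
        (\<integral>\<^sup>+v. ennreal ((\<eta> v - indicator (A n) (restrict v {k..<j}))\<^sup>2) \<partial>F) < ennreal \<epsilon>" for n
      using approximable_indicator[OF F.finite_measure_axioms sF _ assms(3) Am, of n] \<epsilon>
      unfolding approximable_def by force
    then have "\<forall>n. \<exists>\<eta>. cyl_test m {k..<j} \<eta> \<and>
        (\<integral>\<^sup>+v. ennreal ((\<eta> v - indicator (A n) (restrict v {k..<j}))\<^sup>2) \<partial>F) < ennreal \<epsilon>" ..
    from choice[OF this] obtain \<eta> where \<eta>0: "\<forall>n. cyl_test m {k..<j} (\<eta> n) \<and>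
        (\<integral>\<^sup>+v. ennreal ((\<eta> n v - indicator (A n) (restrict v {k..<j}))\<^sup>2) \<partial>F) < ennreal \<epsilon>" ..
    have \<eta>: "cyl_test m {k..<j} (\<eta> n)"
      "(\<integral>\<^sup>+v. ennreal ((\<eta> n v - indicator (A n) (restrict v {k..<j}))\<^sup>2) \<partial>F) < ennreal \<epsilon>" for n
      using spec[OF \<eta>0, of n] by simp_all
    define d where "d = (\<lambda>n v. \<eta> n v - indicator (A n) (restrict v {k..<j}))"
    have \<eta>m: "\<eta> n \<in> borel_measurable F" for n
      using C_diff_measurable[OF cyl_test_C_diff[OF \<eta>(1)]] by (simp add: measurable_cong_sets[OF sF refl])
    have dm: "d n \<in> borel_measurable F" for n
      unfolding d_def using \<eta>m[of n] Am[of n] by measurable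
    have d2: "integrable F (\<lambda>v. (d n v)\<^sup>2)" "(\<integral>v. (d n v)\<^sup>2 \<partial>F) \<le> \<epsilon>" for n
    proof -
      have lt: "(\<integral>\<^sup>+v. ennreal ((d n v)\<^sup>2) \<partial>F) < ennreal \<epsilon>" using \<eta>(2)[of n] by (simp add: d_def)
      show i: "integrable F (\<lambda>v. (d n v)\<^sup>2)"
      proof (rule integrableI_nonneg)
        show "(\<integral>\<^sup>+v. ennreal ((d n v)\<^sup>2) \<partial>F) < \<infinity>" using lt by (rule order_less_trans) simp
      qed (use dm in auto)
      have "ennreal (\<integral>v. (d n v)\<^sup>2 \<partial>F) < ennreal \<epsilon>"
        using lt nn_integral_eq_integral[OF i] by simp
      then show "(\<integral>v. (d n v)\<^sup>2 \<partial>F) \<le> \<epsilon>" using \<epsilon> by (simp add: ennreal_less_iff less_imp_le)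
    qed
    let ?\<psi> = "\<lambda>v. \<Sum>n\<le>L. \<eta> n v * ?P n v"
    have t1: "(\<lambda>v. \<eta> n v * ?P n v) \<in> test_functions m j" for n
      by (rule test_functions_product[OF assms(2) \<Psi> \<eta>(1)])
    have t: "?\<psi> \<in> test_functions m j" by (intro test_functions_sum t1)
    have th: "integrand k b m ?\<psi> v = (\<Sum>n\<le>L. \<eta> n v * ?D n v) - (\<Sum>n\<le>L. \<eta> n v * ?P n v)\<^sup>2 / 4" if v: "v \<in> cfgs j" for v
    proof -
      have "(derivation k b ^^ m) ?\<psi> v = (\<Sum>n\<le>L. (derivation k b ^^ m) (\<lambda>v. \<eta> n v * ?P n v) v)"
        using t1 by (intro derivation_pow_sum[OF assms(1,2) _ v]) (auto simp: test_functions_iff)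
      also have "\<dots> = (\<Sum>n\<le>L. \<eta> n v * ?D n v)"
        by (intro sum.cong refl derivation_pow_product[OF assms(1) order_refl assms(2) \<Psi> \<eta>(1) v])
      finally show ?thesis by (simp add: integrand_def)
    qed
    have ti: "integrable F (integrand k b m ?\<psi>)" by (rule integrable_integrand[OF assms(1,2) t F])
    have Qi: "integrable F (\<lambda>v. \<Sum>n\<le>L. (d n v)\<^sup>2)" by (intro Bochner_Integration.integrable_sum d2)
    have "(\<integral>v. ?X v - K * real (Suc L) * \<tau> - (M - 1) * (\<Sum>n\<le>L. (d n v)\<^sup>2) \<partial>F) \<le> (\<integral>v. integrand k b m ?\<psi> v \<partial>F)"
    proof (rule integral_mono[OF _ ti])
      show "integrable F (\<lambda>v. ?X v - K * real (Suc L) * \<tau> - (M - 1) * (\<Sum>n\<le>L. (d n v)\<^sup>2))"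
        using Xi Qi by (intro Bochner_Integration.integrable_diff integrable_mult_right) auto
      fix v assume "v \<in> space F"
      then have v: "v \<in> cfgs j" by (simp add: spF)
      let ?s = "s (restrict v {k..<j})"
      have "indicator (A n) (restrict v {k..<j}) = (if n = ?s then 1 else (0::real))" for n
        by (auto simp: A_def indicator_def restrict_in_space)
      from selection_bound[where i = "\<lambda>n. indicator (A n) (restrict v {k..<j})" and d = "\<lambda>n. d n v"
          and D = "\<lambda>n. ?D n v" and P = "\<lambda>n. ?P n v", OF s(2) this \<tau> C_nn C]
      have "?X v - K * real (Suc L) * \<tau> - (M - 1) * (\<Sum>n\<le>L. (d n v)\<^sup>2)
          \<le> (\<Sum>n\<le>L. (indicator (A n) (restrict v {k..<j}) + d n v) * ?D n v)
            - (\<Sum>n\<le>L. (indicator (A n) (restrict v {k..<j}) + d n v) * ?P n v)\<^sup>2 / 4"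
        by (simp add: integrand_def K_def M_def)
      then show "?X v - K * real (Suc L) * \<tau> - (M - 1) * (\<Sum>n\<le>L. (d n v)\<^sup>2) \<le> integrand k b m ?\<psi> v"
        unfolding th[OF v] by (simp add: d_def)
    qed
    also have "(\<integral>v. ?X v - K * real (Suc L) * \<tau> - (M - 1) * (\<Sum>n\<le>L. (d n v)\<^sup>2) \<partial>F)
       = (\<integral>v. ?X v \<partial>F) - K * real (Suc L) * \<tau> - (M - 1) * (\<Sum>n\<le>L. (\<integral>v. (d n v)\<^sup>2 \<partial>F))"
      using Xi Qi d2(1) by (simp add: F.prob_space)
    finally have le: "(\<integral>v. ?X v \<partial>F) - K * real (Suc L) * \<tau> - (M - 1) * (\<Sum>n\<le>L. (\<integral>v. (d n v)\<^sup>2 \<partial>F))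
      \<le> (\<integral>v. integrand k b m ?\<psi> v \<partial>F)" .
    have e1: "K * real (Suc L) * \<tau> \<le> \<delta> / 2"
    proof -
      have "K * x * (\<delta> / (2 * (y * x))) = \<delta> / 2 * (K / y)" if "0 < x" "0 < y" for x y
        using that by (simp add: field_simps)
      from this[of "real (Suc L)" "K + 1"] K have "K * real (Suc L) * \<tau> = \<delta> / 2 * (K / (K + 1))" by (simp add: \<tau>_def)
      also have "\<dots> \<le> \<delta> / 2 * 1" using \<delta> K by (intro mult_left_mono) auto
      finally show ?thesis by simp
    qed
    have "(\<Sum>n\<le>L. (\<integral>v. (d n v)\<^sup>2 \<partial>F)) \<le> (\<Sum>n\<le>L. \<epsilon>)" by (intro sum_mono d2)
    then have "(M - 1) * (\<Sum>n\<le>L. (\<integral>v. (d n v)\<^sup>2 \<partial>F)) \<le> M * (\<Sum>n\<le>L. \<epsilon>)"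
      using M K \<tau> by (intro mult_mono sum_nonneg) (auto simp: M_def)
    also have "\<dots> = \<delta> / 2"
    proof -
      have "x * (y * (\<delta> / (2 * (x * y)))) = \<delta> / 2" if "0 < x" "0 < y" for x y :: real using that by simp
      from this[of M "real (Suc L)"] M show ?thesis by (simp add: \<epsilon>_def)
    qed
    finally have e2: "(M - 1) * (\<Sum>n\<le>L. (\<integral>v. (d n v)\<^sup>2 \<partial>F)) \<le> \<delta> / 2" .
    have "x - \<delta> \<le> y" if "p \<le> \<delta> / 2" "q \<le> \<delta> / 2" "x - p - q \<le> y" for p q x y using that by linarith
    from this[OF e1 e2 le] have "ereal ((\<integral>v. ?X v \<partial>F) - \<delta>) \<le> ereal (\<integral>v. integrand k b m ?\<psi> v \<partial>F)" by simp
    also have "\<dots> \<le> J_ext k b m j F" by (rule J_ext_upper[OF t])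
    finally show ?thesis .
  qed
  show ?thesis
  proof (rule ereal_le_epsilon2)
    fix \<delta> :: real assume "0 < \<delta>"
    from approx[OF this] show "ereal (\<integral>v. ?X v \<partial>F) \<le> J_ext k b m j F + ereal \<delta>"
      by (cases "J_ext k b m j F") auto
  qed
qed

section \<open>Mixtures of tensor powers\<close>

abbreviation weak_borel :: "(real^3) measure measure" where
  "weak_borel \<equiv> borel_of (weak_topology (euclidean :: (real^3) topology))"

lemma space_weak_borel: "space weak_borel = prob_measures (euclidean :: (real^3) topology)"
  by (simp add: topspace_weak_topology)

lemma prob_measures_euclidean_iff:
  "\<rho> \<in> prob_measures (euclidean :: 'a::topological_space topology) \<longleftrightarrow> prob_space \<rho> \<and> sets \<rho> = sets borel"
  by (simp add: prob_measures_iff borel_of_euclidean)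

section \<open>Measurable dependence of tensor powers on the random measure\<close>

lemma measurable_weak_borel_integral:
  fixes f :: "real^3 \<Rightarrow> real"
  assumes "continuous_on UNIV f" "\<And>x. \<bar>f x\<bar> \<le> B"
  shows "(\<lambda>\<rho>. \<integral>x. f x \<partial>\<rho>) \<in> borel_measurable weak_borel"
proof (rule borel_measurableI)
  fix U :: "real set" assume "open U"
  then have "openin (weak_topology euclidean) {\<rho> \<in> prob_measures (euclidean :: (real^3) topology). (\<integral>x. f x \<partial>\<rho>) \<in> U}"
    using assms by (intro openin_weak_topology[where B = B]) auto
  moreover have "(\<lambda>\<rho>. \<integral>x. f x \<partial>\<rho>) -` U \<inter> space weak_borel =
      {\<rho> \<in> prob_measures (euclidean :: (real^3) topology). (\<integral>x. f x \<partial>\<rho>) \<in> U}"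
    by (auto simp: topspace_weak_topology)
  ultimately show "(\<lambda>\<rho>. \<integral>x. f x \<partial>\<rho>) -` U \<inter> space weak_borel \<in> sets weak_borel"
    by (auto simp: sets_borel_of)
qed

text \<open>The weak topology directly yields measurability only for integrals of bounded continuous
  functions. For an open set, truncated multiples of the distance to the complement increase to its
  indicator, and open sets form an intersection-stable generator.\<close>

lemma measurable_weak_borel_prob_algebra:
  "(\<lambda>\<rho>. \<rho>) \<in> weak_borel \<rightarrow>\<^sub>M prob_algebra (borel :: (real^3) measure)"
proof (rule measurable_prob_algebra_generated[where G = "{U. open U}" and \<Omega> = UNIV])
  show "sets (borel :: (real^3) measure) = sigma_sets UNIV {U. open U}"
    using sets_borel_of[of "euclidean :: (real^3) topology"] by (simp add: borel_of_euclidean)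
  show "Int_stable {U :: (real^3) set. open U}" by (auto simp: Int_stable_def)
  show "prob_space a" "sets a = sets borel" if "a \<in> space weak_borel" for a
    using that unfolding space_weak_borel prob_measures_euclidean_iff by auto
  fix A :: "(real^3) set" assume "A \<in> {U. open U}"
  then have A: "open A" by simp
  show "(\<lambda>\<rho>. emeasure \<rho> A) \<in> borel_measurable weak_borel"
  proof (cases "A = UNIV")
    \<comment> \<open>The distance to an empty complement is 0 by convention, so the whole space is
      treated apart.\<close>
    case True
    have "(\<lambda>\<rho>. emeasure \<rho> A) \<in> borel_measurable weak_borel \<longleftrightarrow> (\<lambda>\<rho>. 1 :: ennreal) \<in> borel_measurable weak_borel"
    proof (rule measurable_cong)
      fix \<rho> assume "\<rho> \<in> space weak_borel"
      then have "prob_space \<rho>" "sets \<rho> = sets borel" by (auto simp: space_weak_borel prob_measures_euclidean_iff simp del: space_borel_of)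
      then show "emeasure \<rho> A = 1"
        using prob_space.emeasure_space_1[of \<rho>] sets_eq_imp_space_eq[of \<rho> borel] True by simp
    qed
    then show ?thesis by simp
  next
    case False
    define f where "f = (\<lambda>n x. min 1 (real n * infdist x (- A)))"
    have fc: "continuous_on UNIV (f n)" for n
      unfolding f_def by (intro continuous_intros continuous_on_min continuous_on_infdist)
    have fb: "\<bar>f n x\<bar> \<le> 1" for n x
      using infdist_nonneg[of x "- A"] by (auto simp: f_def min_def)
    have lim: "(\<lambda>n. f n x) \<longlonglongrightarrow> indicator A x" for x
    proof (cases "x \<in> A")
      case True
      have "infdist x (- A) \<noteq> 0"
        using in_closed_iff_infdist_zero[of "- A" x] A False True by auto
      then have pos: "0 < infdist x (- A)" using infdist_nonneg[of x "- A"] by simp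
      obtain n0 :: nat where n0: "1 / infdist x (- A) < real n0" using reals_Archimedean2 by blast
      have "f n x = 1" if "n0 \<le> n" for n
      proof -
        have "1 / infdist x (- A) \<le> real n" using n0 that by linarith
        then have "1 \<le> real n * infdist x (- A)" using pos by (simp add: field_simps)
        then show ?thesis by (simp add: f_def)
      qed
      then have "eventually (\<lambda>n. f n x = 1) sequentially" by (auto simp: eventually_sequentially)
      then show ?thesis using True by (simp add: tendsto_eventually)
    next
      case False
      then show ?thesis by (simp add: f_def)
    qed
    have "(\<lambda>\<rho>. measure \<rho> A) \<in> borel_measurable weak_borel"
    proof (rule borel_measurable_LIMSEQ_real)
      show "(\<lambda>\<rho>. \<integral>x. f n x \<partial>\<rho>) \<in> borel_measurable weak_borel" for n
        by (rule measurable_weak_borel_integral[OF fc fb])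
      fix \<rho> assume "\<rho> \<in> space weak_borel"
      then have \<rho>: "prob_space \<rho>" "sets \<rho> = sets borel"
        unfolding space_weak_borel prob_measures_euclidean_iff by auto
      interpret \<rho>: prob_space \<rho> by fact
      have "(\<lambda>n. \<integral>x. f n x \<partial>\<rho>) \<longlonglongrightarrow> (\<integral>x. indicator A x \<partial>\<rho>)"
      proof (rule integral_dominated_convergence[where w = "\<lambda>_. 1"])
        show "f n \<in> borel_measurable \<rho>" for n
          using borel_measurable_continuous_onI[OF fc[of n]] by (simp add: measurable_cong_sets[OF \<rho>(2) refl])
        show "indicator A \<in> borel_measurable \<rho>" using A \<rho>(2) by (intro borel_measurable_indicator) auto
      qed (use lim fb in auto)
      moreover have "A \<inter> space \<rho> = A" using sets_eq_imp_space_eq[OF \<rho>(2)] by simp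
      ultimately show "(\<lambda>n. \<integral>x. f n x \<partial>\<rho>) \<longlonglongrightarrow> measure \<rho> A" by simp
    qed
    then have "(\<lambda>\<rho>. ennreal (measure \<rho> A)) \<in> borel_measurable weak_borel" by simp
    moreover have "(\<lambda>\<rho>. emeasure \<rho> A) \<in> borel_measurable weak_borel \<longleftrightarrow> (\<lambda>\<rho>. ennreal (measure \<rho> A)) \<in> borel_measurable weak_borel"
    proof (rule measurable_cong)
      fix \<rho> assume "\<rho> \<in> space weak_borel"
      then interpret prob_space \<rho> unfolding space_weak_borel prob_measures_euclidean_iff by simp
      show "emeasure \<rho> A = ennreal (measure \<rho> A)" by (rule emeasure_eq_measure)
    qed
    ultimately show ?thesis by simp
  qed
qed auto

text \<open>On cylinders, which generate the product and are stable under intersection, the product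
  measure is a finite product of evaluations of \<open>\<rho>\<close>.\<close>

lemma measurable_PiM_prob_algebra:
  "(\<lambda>\<rho>. Pi\<^sub>M I (\<lambda>_. \<rho>)) \<in> prob_algebra N \<rightarrow>\<^sub>M prob_algebra (Pi\<^sub>M I (\<lambda>_. N))"
proof (rule measurable_prob_algebra_generated[OF sets_PiM Int_stable_prod_algebra prod_algebra_sets_into_space])
  fix \<rho> assume "\<rho> \<in> space (prob_algebra N)"
  then have \<rho>: "prob_space \<rho>" "sets \<rho> = sets N" by (auto simp: space_prob_algebra)
  show "prob_space (Pi\<^sub>M I (\<lambda>_. \<rho>))" by (intro prob_space_PiM \<rho>)
  show "sets (Pi\<^sub>M I (\<lambda>_. \<rho>)) = sets (Pi\<^sub>M I (\<lambda>_. N))" by (intro sets_PiM_cong refl \<rho>)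
next
  fix A assume "A \<in> prod_algebra I (\<lambda>_. N)"
  from prod_algebraE[OF this] obtain J X where X: "A = prod_emb I (\<lambda>_. N) J (Pi\<^sub>E J X)" "finite J" "J \<subseteq> I"
    "\<And>i. i \<in> J \<Longrightarrow> X i \<in> sets N" by metis
  have "(\<lambda>\<rho>. emeasure (Pi\<^sub>M I (\<lambda>_. \<rho>)) A) \<in> borel_measurable (prob_algebra N) \<longleftrightarrow>
      (\<lambda>\<rho>. \<Prod>i\<in>J. emeasure \<rho> (X i)) \<in> borel_measurable (prob_algebra N)"
  proof (rule measurable_cong)
    fix \<rho> assume "\<rho> \<in> space (prob_algebra N)"
    then have \<rho>: "prob_space \<rho>" "sets \<rho> = sets N" by (auto simp: space_prob_algebra)
    interpret P: product_prob_space "\<lambda>_. \<rho>" by (intro product_prob_spaceI \<rho>)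
    have "A = prod_emb I (\<lambda>_. \<rho>) J (Pi\<^sub>E J X)"
      unfolding X(1) prod_emb_def using sets_eq_imp_space_eq[OF \<rho>(2)] by simp
    then show "emeasure (Pi\<^sub>M I (\<lambda>_. \<rho>)) A = (\<Prod>i\<in>J. emeasure \<rho> (X i))"
      using X \<rho>(2) by (simp add: P.emeasure_PiM_emb)
  qed
  moreover have "(\<lambda>\<rho>. emeasure \<rho> (X i)) \<in> borel_measurable (prob_algebra N)" if "i \<in> J" for i
    using X(4)[OF that] unfolding prob_algebra_def by (intro measurable_restrict_space1 measurable_emeasure_subprob_algebra)
  ultimately show "(\<lambda>\<rho>. emeasure (Pi\<^sub>M I (\<lambda>_. \<rho>)) A) \<in> borel_measurable (prob_algebra N)"
    by (simp add: borel_measurable_prod_ennreal)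
qed

lemma measurable_tensor_power:
  "tensor_power j \<in> weak_borel \<rightarrow>\<^sub>M prob_algebra (pborel {..<j})"
  using measurable_compose[OF measurable_weak_borel_prob_algebra measurable_PiM_prob_algebra[of "{..<j}"]]
  by (simp add: tensor_power_def[abs_def])

context
  fixes \<nu> :: "(real^3) measure measure"
  assumes \<nu>: "\<nu> \<in> prob_measures (weak_topology (euclidean :: (real^3) topology))"
begin

lemma nu_in_prob_algebra: "\<nu> \<in> space (prob_algebra weak_borel)"
  using \<nu> by (simp add: prob_measures_def)

lemma nu_prob_space: "prob_space \<nu>" and sets_nu: "sets \<nu> = sets weak_borel"
  using \<nu> by (auto simp: prob_measures_iff)

lemma space_nu: "space \<nu> = prob_measures euclidean"
  using sets_eq_imp_space_eq[OF sets_nu] space_weak_borel by simp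

lemma mixture_prob_measures: "mixture \<nu> j \<in> prob_measures (cfg_top j)"
  unfolding mixture_def prob_measures_cfg_iff
  using prob_space_bind'[OF nu_in_prob_algebra measurable_tensor_power] sets_bind'[OF nu_in_prob_algebra measurable_tensor_power]
  by blast

lemma integral_mixture:
  fixes f :: "config \<Rightarrow> real"
  assumes "f \<in> borel_measurable (pborel {..<j})" "\<And>v. v \<in> cfgs j \<Longrightarrow> \<bar>f v\<bar> \<le> B"
  shows "(\<integral>v. f v \<partial>mixture \<nu> j) = (\<integral>\<rho>. (\<integral>v. f v \<partial>tensor_power j \<rho>) \<partial>\<nu>)"
  unfolding mixture_def
  by (rule integral_bind_bounded[OF nu_in_prob_algebra measurable_tensor_power assms(1)])
     (use assms(2) in \<open>simp add: space_pborel\<close>)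

lemma measurable_integral_tensor_power:
  fixes f :: "config \<Rightarrow> real"
  assumes "f \<in> borel_measurable (pborel {..<j})"
  shows "(\<lambda>\<rho>. \<integral>v. f v \<partial>tensor_power j \<rho>) \<in> borel_measurable \<nu>"
  using measurable_compose[OF measurable_prob_algebraD[OF measurable_tensor_power] integral_measurable_subprob_algebra[OF assms]]
  by (simp add: measurable_cong_sets[OF sets_nu refl])

end

section \<open>Consistency of the mixtures and the upper bound\<close>

lemma tensor_power_prob_measures:
  assumes "\<rho> \<in> prob_measures (euclidean :: (real^3) topology)"
  shows "tensor_power j \<rho> \<in> prob_measures (cfg_top j)"
  using measurable_space[OF measurable_tensor_power, of \<rho> j] assms
  unfolding space_weak_borel prob_measures_cfg_iff space_prob_algebra by blast

lemma marginal_tensor_power: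
  assumes "\<rho> \<in> prob_measures (euclidean :: (real^3) topology)" "i \<le> j"
  shows "marginal i (tensor_power j \<rho>) = tensor_power i \<rho>"
proof -
  have \<rho>: "prob_space \<rho>" "sets \<rho> = sets borel" using assms(1) by (auto simp: prob_measures_euclidean_iff)
  interpret P: product_prob_space "\<lambda>_::nat. \<rho>" by (intro product_prob_spaceI \<rho>)
  have sets: "sets (borel_of (cfg_top i)) = sets (Pi\<^sub>M {..<i} (\<lambda>_. \<rho>))"
    unfolding sets_borel_of_cfg by (intro sets_PiM_cong refl \<rho>(2)[symmetric])
  show ?thesis
    unfolding marginal_def tensor_power_def
    using P.distr_restrict[of "{..<i}" "{..<j}"] assms(2) distr_cong[OF refl sets, of "Pi\<^sub>M {..<j} (\<lambda>_. \<rho>)"]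
    by simp
qed

text \<open>Taking marginals commutes with averaging over \<open>\<nu>\<close>. This consistency
  turns super-additivity into monotonicity in the number of particles.\<close>

lemma marginal_mixture:
  assumes \<nu>: "\<nu> \<in> prob_measures (weak_topology (euclidean :: (real^3) topology))" and "i \<le> j"
  shows "marginal i (mixture \<nu> j) = mixture \<nu> i"
proof -
  have T: "tensor_power j \<in> \<nu> \<rightarrow>\<^sub>M subprob_algebra (pborel {..<j})"
    using measurable_prob_algebraD[OF measurable_tensor_power]
    by (simp add: measurable_cong_sets[OF sets_nu[OF \<nu>] refl])
  have r: "(\<lambda>v. restrict v {..<i}) \<in> measurable (pborel {..<j}) (borel_of (cfg_top i))"
    using measurable_restrict_cfg[OF assms(2)] by (simp add: measurable_cong_sets[OF refl sets_borel_of_cfg])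
  have "marginal i (mixture \<nu> j) = \<nu> \<bind> (\<lambda>\<rho>. marginal i (tensor_power j \<rho>))"
    unfolding marginal_def mixture_def
    by (rule distr_bind[OF T prob_space.not_empty[OF nu_prob_space[OF \<nu>]] r])
  also have "\<dots> = mixture \<nu> i"
    unfolding mixture_def
    by (rule bind_cong[OF refl marginal_tensor_power[OF _ assms(2)]]) (simp add: space_nu[OF \<nu>])
  finally show ?thesis .
qed

text \<open>Freezing the variables with index at least \<open>k\<close> turns a test function of
  \<open>j\<close> particles into one of \<open>k\<close> particles with the same integrand. By
  Fubini the integral is an average of values bounded by the supremum for \<open>k\<close>
  particles.\<close>

lemma J_ext_tensor_power_le:
  assumes b: "smooth_field k b" and kj: "k \<le> j" and \<rho>: "\<rho> \<in> prob_measures (euclidean :: (real^3) topology)"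
  shows "J_ext k b m j (tensor_power j \<rho>) \<le> J_ext k b m k (tensor_power k \<rho>)"
  unfolding J_ext_def[of k b m j]
proof (rule SUP_least)
  fix \<psi> assume \<psi>: "\<psi> \<in> test_functions m j"
  have \<rho>': "prob_space \<rho>" "sets \<rho> = sets borel" using \<rho> by (auto simp: prob_measures_euclidean_iff)
  interpret P: product_prob_space "\<lambda>_::nat. \<rho>" by (intro product_prob_spaceI \<rho>')
  have Pprob: "prob_space (Pi\<^sub>M I (\<lambda>_. \<rho>))" for I by (intro prob_space_PiM \<rho>')
  have un: "{k..<j} \<union> {..<k} = {..<j}" using kj by auto
  obtain R where R: "C_diff m j \<psi>" "supported j R \<psi>" using \<psi> by (auto simp: test_functions_iff)
  have "space \<rho> = UNIV" using sets_eq_imp_space_eq[OF \<rho>'(2)] by simp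
  then have spj: "space (Pi\<^sub>M I (\<lambda>_. \<rho>)) = I \<rightarrow>\<^sub>E UNIV" for I by (simp add: space_PiM)
  have int: "integrable (Pi\<^sub>M {..<j} (\<lambda>_. \<rho>)) (integrand k b m \<psi>)"
    using integrable_integrand[OF b kj \<psi> tensor_power_prob_measures[OF \<rho>]] by (simp only: tensor_power_def)
  have eq: "(\<integral>v. integrand k b m \<psi> v \<partial>tensor_power j \<rho>) =
     (\<integral>x. (\<integral>y. integrand k b m \<psi> (merge {k..<j} {..<k} (x, y)) \<partial>Pi\<^sub>M {..<k} (\<lambda>_. \<rho>)) \<partial>Pi\<^sub>M {k..<j} (\<lambda>_. \<rho>))"
  proof -
    have "integrable (Pi\<^sub>M ({k..<j} \<union> {..<k}) (\<lambda>_. \<rho>)) (integrand k b m \<psi>)" using int by (simp only: un)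
    moreover have "{k..<j} \<inter> {..<k} = {}" by auto
    ultimately have "(\<integral>v. integrand k b m \<psi> v \<partial>Pi\<^sub>M ({k..<j} \<union> {..<k}) (\<lambda>_. \<rho>)) =
       (\<integral>x. (\<integral>y. integrand k b m \<psi> (merge {k..<j} {..<k} (x, y)) \<partial>Pi\<^sub>M {..<k} (\<lambda>_. \<rho>)) \<partial>Pi\<^sub>M {k..<j} (\<lambda>_. \<rho>))"
      by (intro P.product_integral_fold) auto
    then show ?thesis by (simp only: un tensor_power_def)
  qed
  have inner: "ereal (\<integral>y. integrand k b m \<psi> (merge {k..<j} {..<k} (x, y)) \<partial>Pi\<^sub>M {..<k} (\<lambda>_. \<rho>)) \<le> J_ext k b m k (tensor_power k \<rho>)"
    if x: "x \<in> space (Pi\<^sub>M {k..<j} (\<lambda>_. \<rho>))" for x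
  proof -
    have x': "x \<in> cfgs j" using x by (auto simp: spj cfgs_iff PiE_iff extensional_def)
    have mo: "merge {k..<j} {..<k} (x, y) = overlay k x y" for y
      using x by (auto simp: merge_def overlay_def spj PiE_iff extensional_def fun_eq_iff)
    have t: "(\<lambda>y. \<psi> (overlay k x y)) \<in> test_functions m k"
    proof -
      have "supported k R (\<lambda>y. \<psi> (overlay k x y))"
        unfolding supported_def
      proof safe
        fix v i assume v: "v \<in> cfgs k" "i < k" "R < norm (v i)"
        have "overlay k x v \<in> cfgs j" by (rule overlay_in_cfgs[OF kj x'])
        moreover have "R < norm (overlay k x v i)" using v by (simp add: overlay_def)
        ultimately show "\<psi> (overlay k x v) = 0" using R(2) v(2) kj unfolding supported_def by force
      qed
      then show ?thesis
        using C_diff_overlay[OF kj order_refl x' R(1)] by (auto simp: test_functions_iff simp del: C_diff.simps)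
    qed
    have "integrand k b m \<psi> (overlay k x y) = integrand k b m (\<lambda>y. \<psi> (overlay k x y)) y" for y
      by (simp add: integrand_def derivation_pow_overlay)
    then show ?thesis
      using J_ext_upper[OF t, of "tensor_power k \<rho>" k b] by (simp add: mo tensor_power_def)
  qed
  show "ereal (\<integral>v. integrand k b m \<psi> v \<partial>tensor_power j \<rho>) \<le> J_ext k b m k (tensor_power k \<rho>)"
  proof (cases "J_ext k b m k (tensor_power k \<rho>)")
    case (real c)
    have c: "0 \<le> c" using J_ext_nonneg[of k b m k "tensor_power k \<rho>"] real by simp
    let ?g = "\<lambda>x. \<integral>y. integrand k b m \<psi> (merge {k..<j} {..<k} (x, y)) \<partial>Pi\<^sub>M {..<k} (\<lambda>_. \<rho>)"
    have "(\<integral>x. ?g x \<partial>Pi\<^sub>M {k..<j} (\<lambda>_. \<rho>)) \<le> c"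
    \<comment> \<open>A non-integrable function has integral 0 by convention, and \<open>c\<close>
      is nonnegative.\<close>
    proof (cases "integrable (Pi\<^sub>M {k..<j} (\<lambda>_. \<rho>)) ?g")
      case True
      interpret Q: prob_space "Pi\<^sub>M {k..<j} (\<lambda>_. \<rho>)" by (rule Pprob)
      show ?thesis
        by (rule Q.integral_le_const[OF True]) (use inner real in auto)
    qed (simp add: not_integrable_integral_eq c)
    then show ?thesis unfolding eq real by simp
  qed (use J_ext_nonneg[of k b m k "tensor_power k \<rho>"] in auto)
qed

text \<open>For a fixed test function, the integral against the mixture averages the integrals
  against the tensor powers, each at most the supremum for \<open>k\<close> particles. As these
  suprema are nonnegative, the negative part of the integrals may be dropped.\<close>

lemma J_ext_mixture_le:
  assumes b: "smooth_field k b" and kj: "k \<le> j" and \<nu>: "\<nu> \<in> prob_measures (weak_topology (euclidean :: (real^3) topology))"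
  shows "J_ext k b m j (mixture \<nu> j) \<le> enn2ereal (\<integral>\<^sup>+\<rho>. e2ennreal (J_ext k b m k (tensor_power k \<rho>)) \<partial>\<nu>)"
  unfolding J_ext_def[of k b m j]
proof (rule SUP_least)
  fix \<psi> assume \<psi>: "\<psi> \<in> test_functions m j"
  interpret \<nu>: prob_space \<nu> by (rule nu_prob_space[OF \<nu>])
  obtain B where B: "\<And>v. v \<in> cfgs j \<Longrightarrow> \<bar>integrand k b m \<psi> v\<bar> \<le> B" using integrand_bounded[OF b kj \<psi>] by blast
  note m = integrand_measurable[OF b kj \<psi>]
  let ?g = "\<lambda>\<rho>. \<integral>v. integrand k b m \<psi> v \<partial>tensor_power j \<rho>"
  have gb: "\<bar>?g \<rho>\<bar> \<le> B" if "\<rho> \<in> space \<nu>" for \<rho>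
  proof -
    have T: "prob_space (tensor_power j \<rho>)" "sets (tensor_power j \<rho>) = sets (pborel {..<j})"
      using tensor_power_prob_measures[of \<rho> j] that unfolding space_nu[OF \<nu>] prob_measures_cfg_iff by auto
    show ?thesis
      by (rule integral_bounded(2)[OF T(1)])
         (use m B sets_eq_imp_space_eq[OF T(2)] in \<open>auto simp: measurable_cong_sets[OF T(2) refl] space_pborel\<close>)
  qed
  have gi: "integrable \<nu> ?g"
    using gb by (intro \<nu>.integrable_const_bound[where B = B] measurable_integral_tensor_power[OF \<nu> m]) auto
  have "ereal (\<integral>v. integrand k b m \<psi> v \<partial>mixture \<nu> j) = ereal (\<integral>\<rho>. ?g \<rho> \<partial>\<nu>)"
    by (simp add: integral_mixture[OF \<nu> m B])
  also have "\<dots> \<le> enn2ereal (\<integral>\<^sup>+\<rho>. ennreal (max 0 (?g \<rho>)) \<partial>\<nu>)"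
    by (rule ereal_integral_le[OF gi]) auto
  also have "\<dots> \<le> enn2ereal (\<integral>\<^sup>+\<rho>. e2ennreal (J_ext k b m k (tensor_power k \<rho>)) \<partial>\<nu>)"
    unfolding less_eq_ennreal.rep_eq[symmetric]
  proof (rule nn_integral_mono)
    fix \<rho> assume "\<rho> \<in> space \<nu>"
    then have \<rho>: "\<rho> \<in> prob_measures euclidean" by (simp add: space_nu[OF \<nu>])
    have "ereal (?g \<rho>) \<le> J_ext k b m k (tensor_power k \<rho>)"
      using J_ext_upper[OF \<psi>, of "tensor_power j \<rho>" k b] J_ext_tensor_power_le[OF b kj \<rho>, of m] by (rule order_trans)
    then have "ereal (max 0 (?g \<rho>)) \<le> J_ext k b m k (tensor_power k \<rho>)"
      using J_ext_nonneg[of k b m k "tensor_power k \<rho>"] by (auto simp: max_def zero_ereal_def)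
    then have "e2ennreal (ereal (max 0 (?g \<rho>))) \<le> e2ennreal (J_ext k b m k (tensor_power k \<rho>))" by (rule e2ennreal_mono)
    then show "ennreal (max 0 (?g \<rho>)) \<le> e2ennreal (J_ext k b m k (tensor_power k \<rho>))" by (simp only: e2ennreal_ereal)
  qed
  finally show "ereal (\<integral>v. integrand k b m \<psi> v \<partial>mixture \<nu> j) \<le>
     enn2ereal (\<integral>\<^sup>+\<rho>. e2ennreal (J_ext k b m k (tensor_power k \<rho>)) \<partial>\<nu>)" .
qed

section \<open>Averages over blocks of variables\<close>

lemma mult_add_le_mult:
  fixes l p k :: nat
  assumes "l < p"
  shows "l * k + k \<le> p * k"
proof -
  have "Suc l * k \<le> p * k" using assms by (intro mult_le_mono1) simp
  then show ?thesis by simp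
qed

text \<open>The first \<open>k\<close> variables are reserved for the test function, so the blocks
  start at index \<open>k\<close>; those with \<open>l < p\<close> fill
  \<open>{k..<k + p * k}\<close> without overlap.\<close>

definition block :: "nat \<Rightarrow> nat \<Rightarrow> config \<Rightarrow> config" where
  "block k l v = (\<lambda>i\<in>{..<k}. v (k + l * k + i))"

lemma measurable_block:
  assumes "l < p"
  shows "block k l \<in> measurable (pborel {k..<k + p * k}) (pborel {..<k})"
  unfolding block_def[abs_def]
proof (rule measurable_restrict)
  fix i assume i: "i \<in> {..<k}"
  have "l * k + k \<le> p * k" using assms by (rule mult_add_le_mult)
  then show "(\<lambda>v. v (k + l * k + i)) \<in> borel_measurable (pborel {k..<k + p * k})"
    using i by (intro measurable_component_singleton) auto
qed

context
  fixes \<rho> :: "(real^3) measure" and k p :: nat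
  assumes \<rho>: "prob_space \<rho>" "sets \<rho> = sets borel" and k: "1 \<le> k"
begin

abbreviation (input) "prod_rho \<equiv> Pi\<^sub>M {..<k + p * k} (\<lambda>_. \<rho>)"

interpretation prob_space prod_rho by (intro prob_space_PiM \<rho>)

interpretation P: product_prob_space "\<lambda>_::nat. \<rho>" "{..<k + p * k}" by (intro product_prob_spaceI \<rho>)

lemma sets_PiM_rho: "sets (Pi\<^sub>M I (\<lambda>_. \<rho>)) = sets (pborel I)"
  by (intro sets_PiM_cong refl \<rho>)

text \<open>Coordinates are independent under a product measure, hence so are groups of them over
  disjoint index sets; boundedness supplies the integrability for the product formula.\<close>

lemma indep_restrict:
  fixes f g :: "config \<Rightarrow> real"
  assumes "K1 \<inter> K2 = {}" "K1 \<subseteq> {..<k + p * k}" "K2 \<subseteq> {..<k + p * k}"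
    and f: "f \<in> borel_measurable (pborel K1)" "\<And>w. w \<in> space (pborel K1) \<Longrightarrow> \<bar>f w\<bar> \<le> B"
    and g: "g \<in> borel_measurable (pborel K2)" "\<And>w. w \<in> space (pborel K2) \<Longrightarrow> \<bar>g w\<bar> \<le> B'"
  shows "(\<integral>v. f (restrict v K1) * g (restrict v K2) \<partial>prod_rho) = (\<integral>v. f (restrict v K1) \<partial>prod_rho) * (\<integral>v. g (restrict v K2) \<partial>prod_rho)"
proof -
  \<comment> \<open>Independence is characterised by the joint law for a nonempty index set, which
    \<open>1 \<le> k\<close> guarantees.\<close>
  have "0 \<in> {..<k + p * k}" using k by simp
  then have ne: "{..<k + p * k} \<noteq> {}" by blast
  have "indep_vars (\<lambda>_. \<rho>) (\<lambda>i v. v i) {..<k + p * k}"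
  proof (subst indep_vars_iff_distr_eq_PiM'[OF ne])
    show "random_variable \<rho> (\<lambda>v. v i)" if "i \<in> {..<k + p * k}" for i
      using that by (rule measurable_component_singleton)
    have "distr prod_rho prod_rho (\<lambda>x. \<lambda>i\<in>{..<k + p * k}. x i) = distr prod_rho prod_rho (\<lambda>x. x)"
      by (rule distr_cong[OF refl refl]) (auto simp: space_PiM PiE_restrict)
    also have "\<dots> = prod_rho" by (rule distr_id)
    also have "\<dots> = Pi\<^sub>M {..<k + p * k} (\<lambda>i. distr prod_rho \<rho> (\<lambda>v. v i))"
    proof (rule PiM_cong[OF refl])
      fix i assume "i \<in> {..<k + p * k}"
      then have "distr prod_rho \<rho> (\<lambda>v. v i) = \<rho>" by (rule P.PiM_component)
      then show "\<rho> = distr prod_rho \<rho> (\<lambda>v. v i)" by (rule sym)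
    qed
    finally show "distr prod_rho prod_rho (\<lambda>x. \<lambda>i\<in>{..<k + p * k}. x i) = Pi\<^sub>M {..<k + p * k} (\<lambda>i. distr prod_rho \<rho> (\<lambda>v. v i))" .
  qed
  from indep_var_restrict[OF this assms(1-3)]
  have ind: "indep_var (Pi\<^sub>M K1 (\<lambda>_. \<rho>)) (\<lambda>v. restrict v K1) (Pi\<^sub>M K2 (\<lambda>_. \<rho>)) (\<lambda>v. restrict v K2)" .
  have fm: "f \<in> borel_measurable (Pi\<^sub>M K1 (\<lambda>_. \<rho>))" and gm: "g \<in> borel_measurable (Pi\<^sub>M K2 (\<lambda>_. \<rho>))"
    using f g by (simp_all add: measurable_cong_sets[OF sets_PiM_rho refl])
  have ind': "indep_var borel (\<lambda>v. f (restrict v K1)) borel (\<lambda>v. g (restrict v K2))"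
    using indep_var_compose[OF ind fm gm] by (simp add: o_def)
  have "integrable prod_rho (\<lambda>v. f (restrict v K1))"
    using measurable_compose[OF measurable_restrict_subset[OF assms(2)] fm] f(2)[OF restrict_in_space]
    by (intro integrable_const_bound[where B = B]) auto
  moreover have "integrable prod_rho (\<lambda>v. g (restrict v K2))"
    using measurable_compose[OF measurable_restrict_subset[OF assms(3)] gm] g(2)[OF restrict_in_space]
    by (intro integrable_const_bound[where B = B']) auto
  ultimately show ?thesis by (rule indep_var_lebesgue_integral[OF ind'])
qed

text \<open>The shift of indices is injective, so reindexing the product measure gives the law of a
  block.\<close>

lemma integral_block:
  fixes f :: "config \<Rightarrow> real"
  assumes f: "f \<in> borel_measurable (pborel {..<k})" and l: "l < p"
  shows "(\<integral>v. f (block k l v) \<partial>prod_rho) = (\<integral>v. f v \<partial>tensor_power k \<rho>)"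
proof -
  have le: "l * k + k \<le> p * k" using l by (rule mult_add_le_mult)
  have d: "distr prod_rho (Pi\<^sub>M {..<k} (\<lambda>_. \<rho>)) (block k l) = Pi\<^sub>M {..<k} (\<lambda>_. \<rho>)"
    using distr_PiM_reindex[where K = "{..<k + p * k}" and I = "{..<k}" and f = "\<lambda>i. k + l * k + i" and M = "\<lambda>_. \<rho>"] \<rho> le
    by (auto simp: block_def[abs_def] inj_on_def)
  have m: "block k l \<in> measurable prod_rho (Pi\<^sub>M {..<k} (\<lambda>_. \<rho>))"
    unfolding block_def[abs_def]
    by (intro measurable_restrict measurable_component_singleton) (use le in auto)
  have fm: "f \<in> borel_measurable (Pi\<^sub>M {..<k} (\<lambda>_. \<rho>))"
    using f by (simp add: measurable_cong_sets[OF sets_PiM_rho refl])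
  show ?thesis
    using integral_distr[OF m fm] unfolding d tensor_power_def ..
qed

lemma integral_first_block:
  fixes f :: "config \<Rightarrow> real"
  assumes f: "f \<in> borel_measurable (pborel {..<k})"
  shows "(\<integral>v. f (restrict v {..<k}) \<partial>prod_rho) = (\<integral>v. f v \<partial>tensor_power k \<rho>)"
proof -
  have fm: "f \<in> borel_measurable (Pi\<^sub>M {..<k} (\<lambda>_. \<rho>))"
    using f by (simp add: measurable_cong_sets[OF sets_PiM_rho refl])
  have d: "Pi\<^sub>M {..<k} (\<lambda>_. \<rho>) = distr prod_rho (Pi\<^sub>M {..<k} (\<lambda>_. \<rho>)) (\<lambda>v. restrict v {..<k})"
    by (rule P.distr_restrict) auto
  have m: "(\<lambda>v. restrict v {..<k}) \<in> measurable prod_rho (Pi\<^sub>M {..<k} (\<lambda>_. \<rho>))"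
    by (rule measurable_restrict_subset) auto
  show ?thesis
    unfolding tensor_power_def using integral_distr[OF m fm] d by simp
qed

text \<open>Weak law of large numbers in mean. Centred values on disjoint blocks are uncorrelated
  and bounded by \<open>2 * B\<close>, so their average has variance at most
  \<open>4 * B\<^sup>2 / p\<close>. Taking \<open>p\<close> to be a square avoids roots in the
  passage to first moments.\<close>

lemma block_average_deviation:
  fixes f :: "config \<Rightarrow> real"
  assumes f: "f \<in> borel_measurable (pborel {..<k})" "\<And>w. w \<in> cfgs k \<Longrightarrow> \<bar>f w\<bar> \<le> B" and p: "p = q * q" "1 \<le> q"
  defines "T \<equiv> \<integral>v. f v \<partial>tensor_power k \<rho>"
  shows "(\<integral>v. \<bar>(\<Sum>l<p. f (block k l v)) / real p - T\<bar> \<partial>prod_rho) \<le> (1 + 4 * B\<^sup>2) / real q"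
proof -
  define Y where "Y = (\<lambda>l v. f (block k l v) - T)"
  have block_space: "block k l v \<in> cfgs k" for l v by (simp add: block_def cfgs_iff)
  have T: "\<bar>T\<bar> \<le> B"
  proof -
    have tp: "prob_space (tensor_power k \<rho>)" "sets (tensor_power k \<rho>) = sets (pborel {..<k})"
      unfolding tensor_power_def by (auto intro!: prob_space_PiM \<rho> sets_PiM_rho)
    show ?thesis unfolding T_def
      by (rule integral_bounded(2)[OF tp(1)])
         (use f sets_eq_imp_space_eq[OF tp(2)] in \<open>auto simp: measurable_cong_sets[OF tp(2) refl] space_pborel\<close>)
  qed
  have Yb: "\<bar>Y l v\<bar> \<le> 2 * B" for l v
    using f(2)[OF block_space, of l v] T unfolding Y_def by linarith
  have B: "0 \<le> B" using T by linarith
  let ?K = "\<lambda>l. {k + l * k..<k + l * k + k}"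
  define y where "y = (\<lambda>l w. f (\<lambda>i\<in>{..<k}. w (k + l * k + i)) - T)"
  have Yy: "Y l v = y l (restrict v (?K l))" for l v
    unfolding Y_def y_def block_def by (intro arg_cong2[where f = "(-)"] arg_cong[where f = f] refl) auto
  have ym: "y l \<in> borel_measurable (pborel (?K l))" for l
  proof -
    have "(\<lambda>w. \<lambda>i\<in>{..<k}. w (k + l * k + i)) \<in> measurable (pborel (?K l)) (pborel {..<k})"
      by (intro measurable_restrict measurable_component_singleton) auto
    from measurable_compose[OF this f(1)] show ?thesis unfolding y_def by measurable
  qed
  have yb: "\<bar>y l w\<bar> \<le> 2 * B" for l w
  proof -
    have "(\<lambda>i\<in>{..<k}. w (k + l * k + i)) \<in> cfgs k" by (simp add: cfgs_iff)
    from f(2)[OF this] T show ?thesis unfolding y_def by linarith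
  qed
  have le: "l * k + k \<le> p * k" if "l < p" for l using that by (rule mult_add_le_mult)
  have Ym: "Y l \<in> borel_measurable prod_rho" if "l < p" for l
  proof -
    have "(\<lambda>v. y l (restrict v (?K l))) \<in> borel_measurable prod_rho"
      using le[OF that] ym by (intro measurable_compose[OF measurable_restrict_subset])
        (auto simp: measurable_cong_sets[OF sets_PiM_rho refl])
    then show ?thesis by (simp add: Yy[abs_def])
  qed
  have Yi: "integrable prod_rho (Y l)" if "l < p" for l
    using Ym[OF that] Yb by (intro integrable_const_bound[where B = "2 * B"]) auto
  have YYb: "\<bar>Y l v * Y l' v\<bar> \<le> 4 * B\<^sup>2" for l l' v
  proof -
    have "\<bar>Y l v\<bar> * \<bar>Y l' v\<bar> \<le> (2 * B) * (2 * B)" using Yb B by (intro mult_mono) auto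
    then show ?thesis by (simp add: abs_mult power2_eq_square)
  qed
  have YYi: "integrable prod_rho (\<lambda>v. Y l v * Y l' v)" if "l < p" "l' < p" for l l'
    using Ym that YYb by (intro integrable_const_bound[where B = "4 * B\<^sup>2"]) auto
  have Y0: "(\<integral>v. Y l v \<partial>prod_rho) = 0" if "l < p" for l
  proof -
    have "integrable prod_rho (\<lambda>v. Y l v + T)"
      using Yi[OF that] integrable_const[of T] by (rule Bochner_Integration.integrable_add)
    then have "integrable prod_rho (\<lambda>v. f (block k l v))" by (simp add: Y_def)
    then show ?thesis using integral_block[OF f(1) that] by (simp add: Y_def T_def prob_space)
  qed
  have cross: "(\<integral>v. Y l v * Y l' v \<partial>prod_rho) \<le> (if l = l' then 4 * B\<^sup>2 else 0)" if "l < p" "l' < p" for l l'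
  proof (cases "l = l'")
    case True
    have "(\<integral>v. Y l v * Y l' v \<partial>prod_rho) \<le> 4 * B\<^sup>2"
      by (rule integral_le_const[OF YYi[OF that]]) (use YYb abs_le_D1 in blast)
    then show ?thesis using True by simp
  next
    case False
    have disj: "?K l \<inter> ?K l' = {}"
    proof (cases "l < l'")
      case True
      then have "l * k + k \<le> l' * k" by (rule mult_add_le_mult)
      then show ?thesis by auto
    next
      case False
      with \<open>l \<noteq> l'\<close> have "l' < l" by simp
      then have "l' * k + k \<le> l * k" by (rule mult_add_le_mult)
      then show ?thesis by auto
    qed
    have "(\<integral>v. Y l v * Y l' v \<partial>prod_rho) = (\<integral>v. Y l v \<partial>prod_rho) * (\<integral>v. Y l' v \<partial>prod_rho)"
      unfolding Yy using le[OF that(1)] le[OF that(2)] ym yb by (intro indep_restrict[OF disj]) auto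
    then show ?thesis using Y0 that False by simp
  qed
  define Z where "Z = (\<lambda>v. (\<Sum>l<p. Y l v) / real p)"
  have p0: "0 < real p" "real p = real q * real q" "0 < real q" using p by auto
  have Zeq: "(\<Sum>l<p. f (block k l v)) / real p - T = Z v" for v
    using p0 by (simp add: Z_def Y_def sum_subtractf diff_divide_distrib)
  have Z2eq: "(Z v)\<^sup>2 = (\<Sum>l<p. \<Sum>l'<p. Y l v * Y l' v) / (real p)\<^sup>2" for v
    by (simp add: Z_def power_divide power2_eq_square sum_product)
  have Z2i: "integrable prod_rho (\<lambda>v. (Z v)\<^sup>2)"
    unfolding Z2eq by (intro integrable_divide Bochner_Integration.integrable_sum YYi) auto
  have "(\<integral>v. (Z v)\<^sup>2 \<partial>prod_rho) = (\<Sum>l<p. \<Sum>l'<p. (\<integral>v. Y l v * Y l' v \<partial>prod_rho)) / (real p)\<^sup>2"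
  proof -
    have "(\<integral>v. (\<Sum>l<p. \<Sum>l'<p. Y l v * Y l' v) \<partial>prod_rho) = (\<Sum>l<p. \<integral>v. (\<Sum>l'<p. Y l v * Y l' v) \<partial>prod_rho)"
      by (intro Bochner_Integration.integral_sum Bochner_Integration.integrable_sum YYi) auto
    also have "\<dots> = (\<Sum>l<p. \<Sum>l'<p. (\<integral>v. Y l v * Y l' v \<partial>prod_rho))"
      by (intro sum.cong refl Bochner_Integration.integral_sum YYi) auto
    finally show ?thesis unfolding Z2eq by simp
  qed
  also have "\<dots> \<le> (\<Sum>l<p. \<Sum>l'<p. (if l = l' then 4 * B\<^sup>2 else 0)) / (real p)\<^sup>2"
    by (intro divide_right_mono sum_mono cross) auto
  also have "\<dots> = 4 * B\<^sup>2 / real p"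
    using p0 by (simp add: sum.delta' sum.delta power2_eq_square)
  finally have Z2: "(\<integral>v. (Z v)\<^sup>2 \<partial>prod_rho) \<le> 4 * B\<^sup>2 / real p" .
  have Zi: "integrable prod_rho (\<lambda>v. \<bar>Z v\<bar>)"
  proof (intro integrable_abs)
    show "integrable prod_rho Z" unfolding Z_def using Yi by (intro integrable_divide Bochner_Integration.integrable_sum) auto
  qed
  have "(\<integral>v. \<bar>Z v\<bar> \<partial>prod_rho) \<le> (\<integral>v. 1 / real q + real q * (Z v)\<^sup>2 \<partial>prod_rho)"
  proof (rule integral_mono[OF Zi])
    show "integrable prod_rho (\<lambda>v. 1 / real q + real q * (Z v)\<^sup>2)"
      using Z2i by (intro Bochner_Integration.integrable_add integrable_mult_right) auto
    fix v
    show "\<bar>Z v\<bar> \<le> 1 / real q + real q * (Z v)\<^sup>2"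
      \<comment> \<open>The choice of \<open>1 / q\<close> balances the two terms, as the variance
        is of order \<open>1 / q\<^sup>2\<close>.\<close>
      using abs_le_add_square_divide[of "1 / real q" "Z v"] p0(3) by (simp add: mult.commute)
  qed
  also have "\<dots> = 1 / real q + real q * (\<integral>v. (Z v)\<^sup>2 \<partial>prod_rho)"
    using Z2i by (simp add: prob_space)
  also have "\<dots> \<le> 1 / real q + real q * (4 * B\<^sup>2 / real p)"
    using Z2 by (intro add_left_mono mult_left_mono) auto
  also have "\<dots> = (1 + 4 * B\<^sup>2) / real q" using p0 by (simp add: add_divide_distrib)
  finally show ?thesis unfolding Zeq .
qed

end

text \<open>The empirically best of the candidates 0 to \<open>L\<close>: block averages estimate
  the integrals against the unknown \<open>\<rho>\<close>. Taking the least maximiser resolves ties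
  measurably.\<close>

definition best :: "nat \<Rightarrow> nat \<Rightarrow> nat \<Rightarrow> (nat \<Rightarrow> config \<Rightarrow> real) \<Rightarrow> config \<Rightarrow> nat" where
  "best k p L f w = (LEAST n. n \<le> L \<and>
     (\<forall>n'\<le>L. (\<Sum>l<p. f n' (block k l w)) / real p \<le> (\<Sum>l<p. f n (block k l w)) / real p))"

lemma best:
  shows "best k p L f w \<le> L"
    and "n \<le> L \<Longrightarrow> (\<Sum>l<p. f n (block k l w)) / real p \<le> (\<Sum>l<p. f (best k p L f w) (block k l w)) / real p"
proof -
  let ?G = "\<lambda>n. (\<Sum>l<p. f n (block k l w)) / real p"
  have "finite (?G ` {..L})" "?G ` {..L} \<noteq> {}" by auto
  from Max_in[OF this] obtain n' where "Max (?G ` {..L}) = ?G n'" "n' \<in> {..L}" by (rule imageE)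
  then have n': "n' \<le> L" "Max (?G ` {..L}) = ?G n'" by simp_all
  have "?G n'' \<le> ?G n'" if "n'' \<le> L" for n''
    unfolding n'(2)[symmetric] using that by (intro Max_ge) auto
  then have "\<exists>n. n \<le> L \<and> (\<forall>n'\<le>L. ?G n' \<le> ?G n)" using n'(1) by blast
  from LeastI_ex[OF this] have b: "best k p L f w \<le> L \<and> (\<forall>n'\<le>L. ?G n' \<le> ?G (best k p L f w))"
    unfolding best_def .
  then show "best k p L f w \<le> L" by blast
  show "n \<le> L \<Longrightarrow> ?G n \<le> ?G (best k p L f w)" using b by blast
qed

lemma measurable_best:
  assumes "\<And>n. f n \<in> borel_measurable (pborel {..<k})"
  shows "best k p L f \<in> measurable (pborel {k..<k + p * k}) (count_space UNIV)"
proof -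
  have G: "(\<lambda>w. (\<Sum>l<p. f n (block k l w)) / real p) \<in> borel_measurable (pborel {k..<k + p * k})" for n
    by (intro borel_measurable_divide borel_measurable_sum measurable_compose[OF measurable_block assms]) auto
  have "Measurable.pred (pborel {k..<k + p * k}) (\<lambda>w. (\<Sum>l<p. f n' (block k l w)) / real p \<le> (\<Sum>l<p. f n (block k l w)) / real p)" for n n'
    unfolding pred_def by (rule borel_measurable_le[OF G G])
  then show ?thesis unfolding best_def[abs_def] by measurable
qed

text \<open>The choice uses only variables independent of the first \<open>k\<close>, so the chosen
  integrand has as expectation the mean of its true integral. That integral falls short of the one
  for \<open>n0\<close> by at most two estimation errors, one for \<open>n0\<close> and one for the
  chosen index; the sum of the errors over all candidates bounds either.\<close>

lemma integral_best_ge: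
  assumes \<rho>: "\<rho> \<in> prob_measures (euclidean :: (real^3) topology)" and k: "1 \<le> k" and p: "p = q * q" "1 \<le> q"
    and f: "\<And>n. f n \<in> borel_measurable (pborel {..<k})" "\<And>n w. n \<le> L \<Longrightarrow> w \<in> cfgs k \<Longrightarrow> \<bar>f n w\<bar> \<le> B"
    and n0: "n0 \<le> L"
  shows "(\<integral>v. f n0 v \<partial>tensor_power k \<rho>) - 2 * real (Suc L) * ((1 + 4 * B\<^sup>2) / real q)
    \<le> (\<integral>v. f (best k p L f (restrict v {k..<k + p * k})) (restrict v {..<k}) \<partial>tensor_power (k + p * k) \<rho>)"
proof -
  have \<rho>': "prob_space \<rho>" "sets \<rho> = sets borel" using \<rho> by (auto simp: prob_measures_euclidean_iff)
  let ?j = "k + p * k"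
  let ?P = "Pi\<^sub>M {..<?j} (\<lambda>_. \<rho>)"
  let ?J = "{k..<?j}"
  interpret prob_space ?P by (intro prob_space_PiM \<rho>')
  have sP: "sets ?P = sets (pborel {..<?j})" by (intro sets_PiM_cong refl \<rho>')
  define T where "T = (\<lambda>n. \<integral>v. f n v \<partial>tensor_power k \<rho>)"
  define G where "G = (\<lambda>n w. (\<Sum>l<p. f n (block k l w)) / real p)"
  define s where "s = (\<lambda>v. best k p L f (restrict v ?J))"
  have sL: "s v \<le> L" for v unfolding s_def by (rule best(1))
  define A where "A = (\<lambda>n. {w \<in> space (pborel ?J). best k p L f w = n})"
  have Am: "A n \<in> sets (pborel ?J)" for n
    unfolding A_def using measurable_best[OF f(1), of p L] by measurable
  have Aind: "indicator (A n) (restrict v ?J) = (if s v = n then 1 else (0::real))" for n v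
    by (simp add: A_def indicator_def restrict_in_space s_def)
  have rJ: "(\<lambda>v. restrict v ?J) \<in> measurable ?P (pborel ?J)"
    using measurable_restrict_subset[of ?J "{..<?j}" "\<lambda>_. borel"] by (simp add: measurable_cong_sets[OF sP refl] subset_iff)
  have rk: "(\<lambda>v. restrict v {..<k}) \<in> measurable ?P (pborel {..<k})"
    using measurable_restrict_subset[of "{..<k}" "{..<?j}" "\<lambda>_. borel"] by (simp add: measurable_cong_sets[OF sP refl] subset_iff)
  have im: "(\<lambda>v. indicator (A n) (restrict v ?J) :: real) \<in> borel_measurable ?P" for n
    by (rule measurable_compose[OF rJ borel_measurable_indicator[OF Am]])
  have fm: "(\<lambda>v. f n (restrict v {..<k})) \<in> borel_measurable ?P" for n
    by (rule measurable_compose[OF rk f(1)])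
  have fb: "\<bar>f n (restrict v {..<k})\<bar> \<le> B" if "n \<le> L" for n v by (rule f(2)[OF that]) (simp add: cfgs_iff)
  have fi: "integrable ?P (\<lambda>v. indicator (A n) (restrict v ?J) * f n (restrict v {..<k}))" if "n \<le> L" for n
  proof (rule integrable_const_bound[where B = B])
    have "\<bar>indicator (A n) (restrict v ?J) * f n (restrict v {..<k})\<bar> \<le> B" for v
      using fb[OF that, of v] by (auto simp: indicator_def)
    then show "AE v in ?P. norm (indicator (A n) (restrict v ?J) * f n (restrict v {..<k})) \<le> B" by simp
  qed (intro borel_measurable_times im fm)
  have ii: "integrable ?P (\<lambda>v. indicator (A n) (restrict v ?J) :: real)" for n
    by (rule integrable_const_bound[where B = 1]) (use im in \<open>auto simp: indicator_def\<close>)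
  have split: "f (s v) (restrict v {..<k}) = (\<Sum>n\<le>L. indicator (A n) (restrict v ?J) * f n (restrict v {..<k}))" for v
    unfolding Aind using sL[of v] by (simp add: if_distrib[of "\<lambda>x. x * _"] sum.delta cong: if_cong)
  have splitT: "T (s v) = (\<Sum>n\<le>L. indicator (A n) (restrict v ?J) * T n)" for v
    unfolding Aind using sL[of v] by (simp add: if_distrib[of "\<lambda>x. x * _"] sum.delta cong: if_cong)
  \<comment> \<open>By independence the candidate, evaluated at the first \<open>k\<close>
    variables, may be replaced by its integral on the event that it is chosen.\<close>
  have prod: "(\<integral>v. indicator (A n) (restrict v ?J) * f n (restrict v {..<k}) \<partial>?P) = (\<integral>v. indicator (A n) (restrict v ?J) * T n \<partial>?P)"
    if "n \<le> L" for n
  proof -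
    have "(\<integral>v. indicator (A n) (restrict v ?J) * f n (restrict v {..<k}) \<partial>?P)
      = (\<integral>v. indicator (A n) (restrict v ?J) \<partial>?P) * (\<integral>v. f n (restrict v {..<k}) \<partial>?P)"
      by (rule indep_restrict[OF \<rho>' k, where B = 1 and B' = B])
         (use Am f(1) f(2)[OF that] in \<open>auto simp: indicator_def space_pborel\<close>)
    then show ?thesis unfolding integral_first_block[OF \<rho>' k f(1)] by (simp add: T_def)
  qed
  have Grestr: "G n (restrict v ?J) = G n v" for n v
  proof -
    have "block k l (restrict v ?J) = block k l v" if "l < p" for l
    proof -
      have "l * k + k \<le> p * k" using that by (rule mult_add_le_mult)
      then show ?thesis by (auto simp: block_def)
    qed
    then show ?thesis by (simp add: G_def)
  qed
  have Gm: "(\<lambda>v. G n v) \<in> borel_measurable ?P" for n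
  proof -
    have "(\<lambda>w. G n w) \<in> borel_measurable (pborel ?J)" unfolding G_def
      by (intro borel_measurable_divide borel_measurable_sum measurable_compose[OF measurable_block f(1)]) auto
    from measurable_compose[OF rJ this] have "(\<lambda>v. G n (restrict v ?J)) \<in> borel_measurable ?P" .
    then show ?thesis unfolding Grestr .
  qed
  have p0: "0 < real p" using p by auto
  have Gb: "\<bar>G n v\<bar> \<le> B" if "n \<le> L" for n v
  proof -
    have "\<bar>\<Sum>l<p. f n (block k l v)\<bar> \<le> (\<Sum>l<p. B)"
      by (rule order_trans[OF sum_abs sum_mono]) (rule f(2)[OF that], simp add: block_def cfgs_iff)
    then show ?thesis using p0 by (simp add: G_def divide_le_eq mult.commute)
  qed
  have devi: "integrable ?P (\<lambda>v. \<bar>G n v - T n\<bar>)" if "n \<le> L" for n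
  proof (rule integrable_const_bound[where B = "B + \<bar>T n\<bar>"])
    have "\<bar>G n v - T n\<bar> \<le> B + \<bar>T n\<bar>" for v using Gb[OF that, of v] by linarith
    then show "AE v in ?P. norm \<bar>G n v - T n\<bar> \<le> B + \<bar>T n\<bar>" by simp
  qed (use Gm[of n] in measurable)
  have dev: "(\<integral>v. \<bar>G n v - T n\<bar> \<partial>?P) \<le> (1 + 4 * B\<^sup>2) / real q" if "n \<le> L" for n
    unfolding G_def T_def using block_average_deviation[OF \<rho>' k f(1) f(2)[OF that] p] by simp
  let ?e = "\<lambda>v. \<Sum>n\<le>L. \<bar>G n v - T n\<bar>"
  have pt: "T n0 - 2 * ?e v \<le> T (s v)" for v
  proof -
    have "\<bar>G n v - T n\<bar> \<le> ?e v" if "n \<le> L" for n by (rule member_le_sum) (use that in auto)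
    from this[OF n0] this[OF sL[of v]] have "\<bar>G n0 v - T n0\<bar> \<le> ?e v" "\<bar>G (s v) v - T (s v)\<bar> \<le> ?e v" .
    moreover have "G n0 (restrict v ?J) \<le> G (s v) (restrict v ?J)"
      unfolding G_def s_def by (rule best(2)[OF n0])
    then have "G n0 v \<le> G (s v) v" unfolding Grestr .
    ultimately show ?thesis by linarith
  qed
  have ei: "integrable ?P ?e" using devi by (intro Bochner_Integration.integrable_sum) auto
  have Ti: "integrable ?P (\<lambda>v. T (s v))" unfolding splitT using ii by (intro Bochner_Integration.integrable_sum integrable_mult_left) auto
  have "T n0 - 2 * real (Suc L) * ((1 + 4 * B\<^sup>2) / real q) = T n0 - 2 * (\<Sum>n\<le>L. (1 + 4 * B\<^sup>2) / real q)" by simp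
  also have "\<dots> \<le> T n0 - 2 * (\<Sum>n\<le>L. (\<integral>v. \<bar>G n v - T n\<bar> \<partial>?P))"
    using dev by (intro diff_left_mono mult_left_mono sum_mono) auto
  also have "\<dots> = (\<integral>v. T n0 - 2 * ?e v \<partial>?P)"
    using devi ei by (simp add: prob_space Bochner_Integration.integral_sum)
  also have "\<dots> \<le> (\<integral>v. T (s v) \<partial>?P)"
    by (rule integral_mono[OF _ Ti]) (use ei pt in auto)
  also have "\<dots> = (\<Sum>n\<le>L. (\<integral>v. indicator (A n) (restrict v ?J) * T n \<partial>?P))"
    unfolding splitT using ii by (intro Bochner_Integration.integral_sum integrable_mult_left) auto
  also have "\<dots> = (\<Sum>n\<le>L. (\<integral>v. indicator (A n) (restrict v ?J) * f n (restrict v {..<k}) \<partial>?P))"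
    by (intro sum.cong refl prod[symmetric]) auto
  also have "\<dots> = (\<integral>v. f (s v) (restrict v {..<k}) \<partial>?P)"
    unfolding split using fi by (intro Bochner_Integration.integral_sum[symmetric]) auto
  finally show ?thesis by (simp add: T_def s_def tensor_power_def)
qed

section \<open>Affinity\<close>

text \<open>Monotone convergence reduces the supremum to a maximum over finitely many candidates.
  The block averages then find a nearly maximal one with an error uniform in \<open>\<rho>\<close>,
  because it involves only the bound \<open>B\<close> and the number of candidates.\<close>

lemma J_ext_mixture_lower:
  assumes b: "smooth_field k b" and k: "1 \<le> k" and m: "m \<le> 2"
    and \<nu>: "\<nu> \<in> prob_measures (weak_topology (euclidean :: (real^3) topology))"
    and c: "ereal c < enn2ereal (\<integral>\<^sup>+\<rho>. e2ennreal (J_ext k b m k (tensor_power k \<rho>)) \<partial>\<nu>)"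
  shows "\<exists>j\<ge>k. ereal c < J_ext k b m j (mixture \<nu> j)"
proof (cases "c < 0")
  case True
  then have "ereal c < 0" by simp
  also have "0 \<le> J_ext k b m k (mixture \<nu> k)" by (rule J_ext_nonneg)
  finally show ?thesis by blast
next
  case False
  interpret \<nu>: prob_space \<nu> by (rule nu_prob_space[OF \<nu>])
  obtain \<Psi> :: "nat \<Rightarrow> config \<Rightarrow> real" where \<Psi>: "\<And>n. \<Psi> n \<in> test_functions m k" "\<Psi> 0 = (\<lambda>_. 0)"
    and J: "\<And>F. F \<in> prob_measures (cfg_top k) \<Longrightarrow> J_ext k b m k F = (SUP n. ereal (\<integral>v. integrand k b m (\<Psi> n) v \<partial>F))"
    using J_ext_countable[OF b order_refl] by blast
  define f where "f = (\<lambda>n. integrand k b m (\<Psi> n))"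
  have fm: "f n \<in> borel_measurable (pborel {..<k})" for n
    unfolding f_def by (rule integrand_measurable[OF b order_refl \<Psi>(1)])
  have "\<forall>n. \<exists>B. \<forall>v\<in>cfgs k. \<bar>f n v\<bar> \<le> B"
  proof
    fix n
    obtain B where "\<And>v. v \<in> cfgs k \<Longrightarrow> \<bar>f n v\<bar> \<le> B"
      unfolding f_def using integrand_bounded[OF b order_refl \<Psi>(1)[of n]] by blast
    then show "\<exists>B. \<forall>v\<in>cfgs k. \<bar>f n v\<bar> \<le> B" by blast
  qed
  from choice[OF this] obtain B0 where B0: "\<forall>n. \<forall>v\<in>cfgs k. \<bar>f n v\<bar> \<le> B0 n" ..
  define T where "T = (\<lambda>n \<rho>. \<integral>v. f n v \<partial>tensor_power k \<rho>)"
  define Mx where "Mx = (\<lambda>L \<rho>. Max ((\<lambda>n. T n \<rho>) ` {..L}))"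
  have T0: "T 0 \<rho> = 0" for \<rho> by (simp add: T_def f_def \<Psi>(2) integrand_zero)
  have Tm: "T n \<in> borel_measurable \<nu>" for n
    unfolding T_def by (rule measurable_integral_tensor_power[OF \<nu> fm])
  have Mxm: "Mx L \<in> borel_measurable \<nu>" for L
    unfolding Mx_def by (intro borel_measurable_Max Tm) auto
  have Mx_ge: "T n \<rho> \<le> Mx L \<rho>" if "n \<le> L" for n L \<rho>
    unfolding Mx_def using that by (intro Max_ge) auto
  \<comment> \<open>Candidate 0 is the zero function, so the maxima are nonnegative.\<close>
  have Mx0: "0 \<le> Mx L \<rho>" for L \<rho> using Mx_ge[of 0 L \<rho>] T0 by simp
  have Mx_ex: "\<exists>n\<le>L. Mx L \<rho> = T n \<rho>" for L \<rho>
  proof -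
    have "Mx L \<rho> \<in> (\<lambda>n. T n \<rho>) ` {..L}" unfolding Mx_def by (rule Max_in) auto
    then show ?thesis by (auto simp del: Max_in)
  qed
  have Mx_mono: "Mx L \<rho> \<le> Mx L' \<rho>" if "L \<le> L'" for L L' \<rho>
  proof -
    obtain n where "n \<le> L" "Mx L \<rho> = T n \<rho>" using Mx_ex by blast
    then show ?thesis using Mx_ge[of n L' \<rho>] that by simp
  qed
  have "ennreal c < (\<integral>\<^sup>+\<rho>. e2ennreal (J_ext k b m k (tensor_power k \<rho>)) \<partial>\<nu>)"
    using c False by (simp add: less_ennreal.rep_eq enn2ereal_ennreal)
  also have "\<dots> \<le> (\<integral>\<^sup>+\<rho>. (SUP L. ennreal (Mx L \<rho>)) \<partial>\<nu>)"
  proof (rule nn_integral_mono)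
    fix \<rho> assume "\<rho> \<in> space \<nu>"
    then have \<rho>: "tensor_power k \<rho> \<in> prob_measures (cfg_top k)"
      by (intro tensor_power_prob_measures) (simp add: space_nu[OF \<nu>])
    have "J_ext k b m k (tensor_power k \<rho>) \<le> enn2ereal (SUP L. ennreal (Mx L \<rho>))"
      unfolding J[OF \<rho>]
    proof (rule SUP_least)
      fix n
      have "ereal (T n \<rho>) \<le> ereal (Mx n \<rho>)" using Mx_ge by simp
      also have "\<dots> = enn2ereal (ennreal (Mx n \<rho>))" by (rule enn2ereal_ennreal[OF Mx0, symmetric])
      also have "\<dots> \<le> enn2ereal (SUP L. ennreal (Mx L \<rho>))"
        unfolding less_eq_ennreal.rep_eq[symmetric] by (rule SUP_upper) simp
      finally show "ereal (\<integral>v. integrand k b m (\<Psi> n) v \<partial>tensor_power k \<rho>) \<le> enn2ereal (SUP L. ennreal (Mx L \<rho>))"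
        by (simp add: T_def f_def)
    qed
    from e2ennreal_mono[OF this] show "e2ennreal (J_ext k b m k (tensor_power k \<rho>)) \<le> (SUP L. ennreal (Mx L \<rho>))"
      by (simp only: e2ennreal_enn2ereal)
  qed
  also have "\<dots> = (SUP L. \<integral>\<^sup>+\<rho>. ennreal (Mx L \<rho>) \<partial>\<nu>)"
  proof (rule nn_integral_monotone_convergence_SUP)
    show "incseq (\<lambda>L \<rho>. ennreal (Mx L \<rho>))"
      by (auto simp: incseq_def le_fun_def intro!: ennreal_leI Mx_mono)
  qed (use Mxm in simp)
  finally obtain L where L: "ennreal c < (\<integral>\<^sup>+\<rho>. ennreal (Mx L \<rho>) \<partial>\<nu>)" unfolding less_SUP_iff by blast
  define B where "B = (\<Sum>n\<le>L. \<bar>B0 n\<bar>)"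
  have fB: "\<bar>f n v\<bar> \<le> B" if "n \<le> L" "v \<in> cfgs k" for n v
  proof -
    have "\<bar>B0 n\<bar> \<le> B" unfolding B_def by (rule member_le_sum) (use that in auto)
    moreover have "\<bar>f n v\<bar> \<le> B0 n" using B0 that by blast
    ultimately show ?thesis by linarith
  qed
  have tp: "prob_space (tensor_power i \<rho>)" "sets (tensor_power i \<rho>) = sets (pborel {..<i})" "space (tensor_power i \<rho>) = cfgs i"
    if "\<rho> \<in> space \<nu>" for i \<rho>
    using tensor_power_prob_measures[of \<rho> i] that space_prob_measures[of "tensor_power i \<rho>" "cfg_top i"]
    unfolding space_nu[OF \<nu>] by (auto simp: prob_measures_cfg_iff)
  have TB: "\<bar>T n \<rho>\<bar> \<le> B" if "n \<le> L" "\<rho> \<in> space \<nu>" for n \<rho>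
    unfolding T_def
    by (rule integral_bounded(2)[OF tp(1)[OF that(2)]])
       (use fm fB[OF that(1)] tp(3)[OF that(2)] in \<open>auto simp: measurable_cong_sets[OF tp(2)[OF that(2)] refl]\<close>)
  have MxB: "\<bar>Mx L \<rho>\<bar> \<le> B" if "\<rho> \<in> space \<nu>" for \<rho>
    using Mx_ex[of L \<rho>] TB[OF _ that] by auto
  have Mxi: "integrable \<nu> (Mx L)"
    using MxB Mxm by (intro \<nu>.integrable_const_bound[where B = B]) auto
  have "ennreal c < ennreal (\<integral>\<rho>. Mx L \<rho> \<partial>\<nu>)"
    using L nn_integral_eq_integral[OF Mxi] Mx0 by simp
  then have cM: "c < (\<integral>\<rho>. Mx L \<rho> \<partial>\<nu>)" using False by (simp add: ennreal_less_iff)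
  define \<delta> where "\<delta> = (\<integral>\<rho>. Mx L \<rho> \<partial>\<nu>) - c"
  have \<delta>: "0 < \<delta>" using cM by (simp add: \<delta>_def)
  \<comment> \<open>The error of \<open>integral_best_ge\<close> before division by
    \<open>q\<close>.\<close>
  define E where "E = 2 * real (Suc L) * (1 + 4 * B\<^sup>2)"
  have E: "0 < E" unfolding E_def by (intro mult_pos_pos add_pos_nonneg) auto
  obtain q :: nat where q: "E / \<delta> < real q" using reals_Archimedean2 by blast
  have "0 < E / \<delta>" using E \<delta> by simp
  then have q0: "0 < real q" using q by linarith
  then have q1: "1 \<le> q" by simp
  have Eq: "E / real q < \<delta>" using q q0 \<delta> by (simp add: field_simps)
  define p where "p = q * q"
  define j where "j = k + p * k"
  let ?s = "best k p L f"
  \<comment> \<open>One function on \<open>j\<close> particles that does not mention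
    \<open>\<rho>\<close>: the selector reads it off the later variables. This is why it can be
    integrated against the mixture.\<close>
  let ?X = "\<lambda>v. f (?s (restrict v {k..<j})) (restrict v {..<k})"
  have sm: "?s \<in> measurable (pborel {k..<j}) (count_space UNIV)"
    unfolding j_def by (rule measurable_best[OF fm])
  have kj: "k \<le> j" by (simp add: j_def)
  have Xm: "?X \<in> borel_measurable (pborel {..<j})"
  proof (rule measurable_compose_countable[where f = "\<lambda>n v. f n (restrict v {..<k})"])
    show "(\<lambda>v. f n (restrict v {..<k})) \<in> borel_measurable (pborel {..<j})" for n
      by (rule measurable_compose[OF measurable_restrict_cfg[OF kj] fm])
    show "(\<lambda>v. ?s (restrict v {k..<j})) \<in> measurable (pborel {..<j}) (count_space UNIV)"
      by (rule measurable_compose[OF measurable_restrict_subset sm]) auto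
  qed
  have XB: "\<bar>?X v\<bar> \<le> B" for v by (rule fB[OF best(1)]) (simp add: cfgs_iff)
  let ?g = "\<lambda>\<rho>. \<integral>v. ?X v \<partial>tensor_power j \<rho>"
  have gB: "\<bar>?g \<rho>\<bar> \<le> B" if "\<rho> \<in> space \<nu>" for \<rho>
    by (rule integral_bounded(2)[OF tp(1)[OF that]])
       (use Xm XB in \<open>auto simp: measurable_cong_sets[OF tp(2)[OF that] refl]\<close>)
  have gi: "integrable \<nu> ?g"
    using gB by (intro \<nu>.integrable_const_bound[where B = B] measurable_integral_tensor_power[OF \<nu> Xm]) auto
  have pt: "Mx L \<rho> - E / real q \<le> ?g \<rho>" if \<rho>: "\<rho> \<in> space \<nu>" for \<rho>
  proof -
    obtain n0 where n0: "n0 \<le> L" "Mx L \<rho> = T n0 \<rho>" using Mx_ex by blast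
    have "\<rho> \<in> prob_measures euclidean" using \<rho> by (simp add: space_nu[OF \<nu>])
    from integral_best_ge[OF this k p_def q1 fm fB n0(1)] show ?thesis
      by (simp add: n0(2) T_def E_def j_def)
  qed
  have "c < (\<integral>\<rho>. Mx L \<rho> \<partial>\<nu>) - E / real q" using Eq by (simp add: \<delta>_def)
  also have "\<dots> = (\<integral>\<rho>. Mx L \<rho> - E / real q \<partial>\<nu>)" using Mxi by (simp add: \<nu>.prob_space)
  also have "\<dots> \<le> (\<integral>\<rho>. ?g \<rho> \<partial>\<nu>)"
    by (rule integral_mono[OF _ gi pt]) (use Mxi in auto)
  also have "\<dots> = (\<integral>v. ?X v \<partial>mixture \<nu> j)" by (rule integral_mixture[OF \<nu> Xm XB, symmetric])
  finally have "ereal c < ereal (\<integral>v. ?X v \<partial>mixture \<nu> j)" by simp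
  also have "\<dots> \<le> J_ext k b m j (mixture \<nu> j)"
    using J_ext_selection[OF b kj m mixture_prob_measures[OF \<nu>] \<Psi>(1) sm best(1)]
    by (simp add: f_def)
  finally show ?thesis using kj by blast
qed

lemma J_ext_mixture_mono:
  assumes "smooth_field k b" "k \<le> i" "i \<le> j" "m \<le> 2"
    and \<nu>: "\<nu> \<in> prob_measures (weak_topology (euclidean :: (real^3) topology))"
  shows "J_ext k b m i (mixture \<nu> i) \<le> J_ext k b m j (mixture \<nu> j)"
  using J_ext_marginal[OF assms(1-4) mixture_prob_measures[OF \<nu>]]
  by (simp add: marginal_mixture[OF \<nu> assms(3)])

text \<open>The lower bound holds for some \<open>j\<close> and persists by monotonicity; the upper
  bound holds for every \<open>j \<ge> k\<close>.\<close>

lemma J_ext_mixture_tendsto: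
  assumes b: "smooth_field k b" and k: "1 \<le> k" and m: "m \<le> 2"
    and \<nu>: "\<nu> \<in> prob_measures (weak_topology (euclidean :: (real^3) topology))"
  shows "(\<lambda>j. J_ext k b m j (mixture \<nu> j)) \<longlonglongrightarrow>
    enn2ereal (\<integral>\<^sup>+\<rho>. e2ennreal (J_ext k b m k (tensor_power k \<rho>)) \<partial>\<nu>)" (is "_ \<longlonglongrightarrow> ?S")
proof (rule order_tendstoI)
  fix a assume "a < ?S"
  then obtain c where c: "a < ereal c" "ereal c < ?S" using ereal_dense2 by blast
  obtain j0 where j0: "k \<le> j0" "ereal c < J_ext k b m j0 (mixture \<nu> j0)"
    using J_ext_mixture_lower[OF b k m \<nu> c(2)] by blast
  have "a < J_ext k b m j (mixture \<nu> j)" if "j0 \<le> j" for j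
    using c(1) j0(2) J_ext_mixture_mono[OF b j0(1) that m \<nu>] by (meson less_le_trans less_trans)
  then show "eventually (\<lambda>j. a < J_ext k b m j (mixture \<nu> j)) sequentially"
    by (auto simp: eventually_sequentially)
next
  fix a assume a: "?S < a"
  have "J_ext k b m j (mixture \<nu> j) < a" if "k \<le> j" for j
    using J_ext_mixture_le[OF b that \<nu>] a by (rule le_less_trans)
  then show "eventually (\<lambda>j. J_ext k b m j (mixture \<nu> j) < a) sequentially"
    by (auto simp: eventually_sequentially)
qed

lemma ereal_le_16_mult: "0 \<le> S \<Longrightarrow> S \<le> 16 * (S :: ereal)"
  using ereal_mult_right_mono[of 1 16 S] by simp

theorem theorem1p6:
  fixes k0 :: nat and b :: "(nat \<Rightarrow> real^3) \<Rightarrow> (nat \<Rightarrow> real^3)"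
  assumes "k0 \<ge> 1"
    and "smooth_field k0 b" and "bounded_field k0 b" and "divergence_free k0 b"
  shows
    "(\<forall>N\<ge>k0.
        (\<forall>f. regular_density 1 N f \<longrightarrow>
           I_ext k0 b N (density (cfg_leb N) (\<lambda>v. ennreal (f v))) = enn2ereal (I_formula k0 b N f)) \<and>
        (\<forall>f. regular_density 2 N f \<longrightarrow>
           K_ext k0 b N (density (cfg_leb N) (\<lambda>v. ennreal (f v))) = enn2ereal (K_formula k0 b N f)) \<and>
        (\<forall>F \<in> prob_measures (cfg_top N). 0 \<le> I_ext k0 b N F \<and> 0 \<le> K_ext k0 b N F) \<and>
        convex_on_prob_measures (cfg_top N) (I_ext k0 b N) \<and>
        convex_on_prob_measures (cfg_top N) (K_ext k0 b N) \<and>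
        lsc_on_topology (weak_topology (cfg_top N)) (I_ext k0 b N) \<and>
        lsc_on_topology (weak_topology (cfg_top N)) (K_ext k0 b N))
     \<and>
     (\<forall>N\<ge>k0. \<forall>F \<in> prob_measures (cfg_top N). \<forall>j. k0 \<le> j \<and> j \<le> N \<longrightarrow>
        I_ext k0 b j (marginal j F) \<le> I_ext k0 b N F \<and>
        K_ext k0 b j (marginal j F) \<le> K_ext k0 b N F)
     \<and>
     (\<forall>\<nu> \<in> prob_measures (weak_topology (euclidean :: (real^3) topology)).
        (SUP j\<in>{1..}. fisher_info j (mixture \<nu> j)) < \<infinity> \<and>
        (\<integral>\<^sup>+v. ennreal ((norm (v 0))\<^sup>2) \<partial>mixture \<nu> 1) < \<infinity> \<longrightarrow>
        (\<forall>i j. k0 \<le> i \<and> i \<le> j \<longrightarrow>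
           I_ext k0 b i (mixture \<nu> i) \<le> I_ext k0 b j (mixture \<nu> j) \<and>
           K_ext k0 b i (mixture \<nu> i) \<le> K_ext k0 b j (mixture \<nu> j)) \<and>
        (\<lambda>j. I_ext k0 b j (mixture \<nu> j)) \<longlonglongrightarrow>
           enn2ereal (\<integral>\<^sup>+\<rho>. e2ennreal (I_ext k0 b k0 (tensor_power k0 \<rho>)) \<partial>\<nu>) \<and>
        (\<exists>L. (\<lambda>j. K_ext k0 b j (mixture \<nu> j)) \<longlonglongrightarrow> L \<and>
           L \<le> enn2ereal (\<integral>\<^sup>+\<rho>. e2ennreal (K_ext k0 b k0 (tensor_power k0 \<rho>)) \<partial>\<nu>) \<and>
           enn2ereal (\<integral>\<^sup>+\<rho>. e2ennreal (K_ext k0 b k0 (tensor_power k0 \<rho>)) \<partial>\<nu>) \<le> 16 * L))"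
proof (intro conjI allI ballI impI)
  note b = assms(2) and div = assms(4)
  fix N assume N: "k0 \<le> N"
  show "I_ext k0 b N (density (cfg_leb N) (\<lambda>v. ennreal (f v))) = enn2ereal (I_formula k0 b N f)"
    if "regular_density 1 N f" for f
    by (rule I_ext_density[OF b div N that])
  show "K_ext k0 b N (density (cfg_leb N) (\<lambda>v. ennreal (f v))) = enn2ereal (K_formula k0 b N f)"
    if "regular_density 2 N f" for f
    by (rule K_ext_density[OF b div N that])
  show "0 \<le> I_ext k0 b N F" "0 \<le> K_ext k0 b N F" for F
    by (simp_all add: I_ext_eq K_ext_eq J_ext_nonneg)
  show "convex_on_prob_measures (cfg_top N) (I_ext k0 b N)" "convex_on_prob_measures (cfg_top N) (K_ext k0 b N)"
    unfolding I_ext_eq K_ext_eq by (rule J_ext_convex[OF b N])+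
  show "lsc_on_topology (weak_topology (cfg_top N)) (I_ext k0 b N)"
    "lsc_on_topology (weak_topology (cfg_top N)) (K_ext k0 b N)"
    unfolding I_ext_eq K_ext_eq by (rule J_ext_lsc[OF b N])+
  fix F j assume F: "F \<in> prob_measures (cfg_top N)" and j: "k0 \<le> j \<and> j \<le> N"
  show "I_ext k0 b j (marginal j F) \<le> I_ext k0 b N F" "K_ext k0 b j (marginal j F) \<le> K_ext k0 b N F"
    unfolding I_ext_eq K_ext_eq using j F by (auto intro!: J_ext_marginal[OF b])
next
  note b = assms(2)
  fix \<nu> assume \<nu>: "\<nu> \<in> prob_measures (weak_topology (euclidean :: (real^3) topology))"
  show "I_ext k0 b i (mixture \<nu> i) \<le> I_ext k0 b j (mixture \<nu> j)"
    "K_ext k0 b i (mixture \<nu> i) \<le> K_ext k0 b j (mixture \<nu> j)" if "k0 \<le> i \<and> i \<le> j" for i j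
    unfolding I_ext_eq K_ext_eq using that by (auto intro!: J_ext_mixture_mono[OF b _ _ _ \<nu>])
  show "(\<lambda>j. I_ext k0 b j (mixture \<nu> j)) \<longlonglongrightarrow>
      enn2ereal (\<integral>\<^sup>+\<rho>. e2ennreal (I_ext k0 b k0 (tensor_power k0 \<rho>)) \<partial>\<nu>)"
    unfolding I_ext_eq by (rule J_ext_mixture_tendsto[OF b assms(1) _ \<nu>]) simp
  let ?S = "enn2ereal (\<integral>\<^sup>+\<rho>. e2ennreal (K_ext k0 b k0 (tensor_power k0 \<rho>)) \<partial>\<nu>)"
  have "(\<lambda>j. K_ext k0 b j (mixture \<nu> j)) \<longlonglongrightarrow> ?S"
    unfolding K_ext_eq by (rule J_ext_mixture_tendsto[OF b assms(1) _ \<nu>]) simp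
  \<comment> \<open>Nonnegativity is enough because the witness for \<open>L\<close> is the averaged
    functional itself.\<close>
  moreover have "?S \<le> 16 * ?S" by (rule ereal_le_16_mult[OF enn2ereal_nonneg])
  ultimately show "\<exists>L. (\<lambda>j. K_ext k0 b j (mixture \<nu> j)) \<longlonglongrightarrow> L \<and> L \<le> ?S \<and> ?S \<le> 16 * L" by blast
qed

end
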